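(* Let $M$ be a semi-invariant submanifold of a normal complex contact metric manifold $\bar M$, with anti-invariant distribution $\mathcal D^{\bot}$ and structure vector fields $\bar U,\bar V$ tangent to $M$. Then the distribution $\mathcal D^{\bot}\oplus sp\{\bar U,\bar V\}$ on $M$ is involutive.
   Context: Complex contact metric manifolds. A complex contact manifold is a complex manifold $\bar M$ of complex dimension $2m+1$ with an open cover by coordinate neighborhoods $\mathcal U_i$ and holomorphic $1$-forms $\omega_i$ on $\mathcal U_i$ with $\omega_i\wedge(d\omega_i)^m\neq 0$ on $\mathcal U_i$ and $\omega_i=f_{ij}\omega_j$ on $\mathcal U_i\cap\mathcal U_j\ne\emptyset$ with $f_{ij}$ holomorphic. The kernels of the $\omega_i$ define the horizontal subbundle $\mathcal H\subset T\bar M$. Let $\bar J$ be the complex structure and $\bar g$ a Hermitian metric. A complex almost contact metric structure consists, on each $\mathcal U_i$ (index suppressed), of real $1$-forms $\bar u$, $\bar v=\bar u\circ \bar J$, with dual unit vector fields $\bar U$, $\bar V=-\bar J\bar U$, and $(1,1)$-tensor fields $\bar G$, $\bar H=\bar G\bar J$ such that $\bar G^2=\bar H^2=-I+\bar u\otimes\bar U+\bar v\otimes\bar V$, $\bar G\bar J=-\bar J\bar G$, $\bar G\bar U=0$, $\bar g(K,\bar GL)=-\bar g(\bar GK,L)$; on overlaps $u_j=cu_i-dv_i$, $v_j=du_i+cv_i$, $G_j=cG_i-dH_i$, $H_j=dG_i+cH_i$ for functions $c,d$ with $c^2+d^2=1$. Let $\bar\nabla$ be the Levi-Civita connection of $\bar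 g$ and $\bar\sigma(K)=\bar g(\bar\nabla_K\bar U,\bar V)$. $\bar M$ is a complex contact metric manifold if moreover $\mathcal H=\ker\bar u\cap\ker\bar v$ and $d\bar u(K,L)=\bar g(K,\bar GL)+(\bar\sigma\wedge\bar v)(K,L)$, $d\bar v(K,L)=\bar g(K,\bar HL)-(\bar\sigma\wedge\bar u)(K,L)$ (conventions $2d\alpha(K,L)=K\alpha(L)-L\alpha(K)-\alpha([K,L])$ and $2(\alpha\wedge\beta)(K,L)=\alpha(K)\beta(L)-\alpha(L)\beta(K)$). Normality (Korkmaz). For a $(1,1)$-tensor $F$ put $[F,F](K,L)=(\bar\nabla_{FK}F)L-(\bar\nabla_{FL}F)K-F(\bar\nabla_KF)L+F(\bar\nabla_LF)K$. Define $S(K,L)=[\bar G,\bar G](K,L)+2\bar g(K,\bar GL)\bar U-2\bar g(K,\bar HL)\bar V+2(\bar v(L)\bar HK-\bar v(K)\bar HL)+\bar\sigma(\bar GL)\bar HK-\bar\sigma(\bar GK)\bar HL+\bar\sigma(K)\bar G\bar HL-\bar\sigma(L)\bar G\bar HK$, $T(K,L)=[\bar H,\bar H](K,L)-2\bar g(K,\bar GL)\bar U+2\bar g(K,\bar HL)\bar V+2(\bar u(L)\bar GK-\bar u(K)\bar GL)+\bar\sigma(\bar HK)\bar GL-\bar\sigma(\bar HL)\bar GK+\bar\sigma(K)\bar G\bar HL-\bar\sigma(L)\bar G\bar HK$. $\bar M$ is normal if $S(K,L)=T(K,L)=0$ for all $K,L\in\mathcal H$ and $S(K,\bar U)=T(K,\bar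 V)=0$ for all $K$. Semi-invariant submanifolds. Let $M$ be a complex submanifold of the normal complex contact metric manifold $\bar M$ (real dimension $4m+2$), of real dimension $n+2$, with $\bar U,\bar V$ tangent to $M$. $M$ is semi-invariant if there are smooth distributions $\mathcal D,\mathcal D^{\bot}$ on $M$, orthogonal to $sp\{\bar U,\bar V\}$ (the span of $\bar U,\bar V$), with $TM=\mathcal D\oplus\mathcal D^{\bot}\oplus sp\{\bar U,\bar V\}$ (orthogonal sum), $\bar G\mathcal D=\mathcal D$, $\bar H\mathcal D=\mathcal D$, $\bar G\mathcal D^{\bot}\subset TM^{\bot}$, $\bar H\mathcal D^{\bot}\subset TM^{\bot}$, where $TM^\bot$ is the normal bundle. $\mathcal D$ is called the invariant and $\mathcal D^{\bot}$ the anti-invariant distribution. *)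

theory Defs
  imports "HOL-Analysis.Analysis"
begin

section \<open>Smooth and holomorphic maps on open subsets of Euclidean spaces\<close>

text \<open>These predicates are only ever applied to open sets.\<close>

primrec Ck_on ::
  "nat \<Rightarrow> ('a::real_normed_vector \<Rightarrow> 'b::real_normed_vector) \<Rightarrow> 'a set \<Rightarrow> bool" where
  "Ck_on 0 f S \<longleftrightarrow> continuous_on S f"
| "Ck_on (Suc k) f S \<longleftrightarrow> (\<forall>x\<in>S. f differentiable (at x)) \<and>
     (\<forall>v. Ck_on k (\<lambda>x. frechet_derivative f (at x) v) S)"

definition smooth_on ::
  "('a::real_normed_vector \<Rightarrow> 'b::real_normed_vector) \<Rightarrow> 'a set \<Rightarrow> bool" where
  "smooth_on f S \<longleftrightarrow> (\<forall>k. Ck_on k f S)"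

text \<open>Holomorphic in several variables: smooth with complex-linear differential
  (the Cauchy-Riemann equations).\<close>

definition holomorphic_fun_on :: "(complex^'n \<Rightarrow> complex) \<Rightarrow> (complex^'n) set \<Rightarrow> bool" where
  "holomorphic_fun_on f S \<longleftrightarrow> smooth_on f S \<and>
     (\<forall>x\<in>S. \<forall>v. frechet_derivative f (at x) (\<i> *s v) = \<i> * frechet_derivative f (at x) v)"

definition holomorphic_map_on ::
  "(complex^'n \<Rightarrow> complex^'k) \<Rightarrow> (complex^'n) set \<Rightarrow> bool" where
  "holomorphic_map_on f S \<longleftrightarrow> (\<forall>i. holomorphic_fun_on (\<lambda>x. f x $ i) S)"


section \<open>Complex manifolds\<close>

text \<open>A chart is a pair of its domain and its coordinate map; only the values of the map on
  the domain matter.  The manifold itself is the whole type \<open>'m\<close>.\<close>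

type_synonym ('m, 'n) chart = "'m set \<times> ('m \<Rightarrow> complex^'n)"

abbreviation chart_inv :: "('m, 'n::finite) chart \<Rightarrow> complex^'n \<Rightarrow> 'm" where
  "chart_inv c \<equiv> inv_into (fst c) (snd c)"

definition topological_chart :: "('m::topological_space, 'n::finite) chart \<Rightarrow> bool" where
  "topological_chart c \<longleftrightarrow> open (fst c) \<and> open (snd c ` fst c) \<and>
     homeomorphism (fst c) (snd c ` fst c) (snd c) (chart_inv c)"

definition holomorphically_compatible ::
  "('m, 'n::finite) chart \<Rightarrow> ('m, 'n) chart \<Rightarrow> bool" where
  "holomorphically_compatible c d \<longleftrightarrow>
     holomorphic_map_on (snd d \<circ> chart_inv c) (snd c ` (fst c \<inter> fst d)) \<and>
     holomorphic_map_on (snd c \<circ> chart_inv d) (snd d ` (fst c \<inter> fst d))"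

text \<open>Membership in the maximal atlas generated by \<open>A\<close>.\<close>

definition holomorphic_chart ::
  "('m::topological_space, 'n::finite) chart set \<Rightarrow> ('m, 'n) chart \<Rightarrow> bool" where
  "holomorphic_chart A c \<longleftrightarrow> topological_chart c \<and> (\<forall>a\<in>A. holomorphically_compatible c a)"

definition complex_atlas ::
  "('m::{second_countable_topology,t2_space}, 'n::finite) chart set \<Rightarrow> bool" where
  "complex_atlas A \<longleftrightarrow> (\<Union>c\<in>A. fst c) = UNIV \<and> (\<forall>c\<in>A. holomorphic_chart A c)"

definition coordinate_neighborhood ::
  "('m::topological_space, 'n::finite) chart set \<Rightarrow> 'm set \<Rightarrow> bool" where
  "coordinate_neighborhood A W \<longleftrightarrow> (\<exists>\<phi>. holomorphic_chart A (W, \<phi>))"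

text \<open>Tangent spaces.  For every point \<open>p\<close> one chart \<open>chart_at A p\<close> around \<open>p\<close> is chosen once
  and for all, and the tangent space at \<open>p\<close> is identified with \<open>complex^'n\<close> (as a real vector
  space) through the coordinates of that chart.  So a vector field is a function
  \<open>'m \<Rightarrow> complex^'n\<close> whose value at \<open>p\<close> is to be read in \<open>chart_at A p\<close>, and a tensor at \<open>p\<close> is a
  real multilinear map on \<open>complex^'n\<close>.  Since chart changes have complex-linear
  differentials, the complex structure \<open>J\<close> of the manifold is \<open>k \<mapsto> \<i> *s k\<close> in every
  tangent space.\<close>

definition chart_at :: "('m, 'n::finite) chart set \<Rightarrow> 'm \<Rightarrow> ('m, 'n) chart" where
  "chart_at A p = (SOME c. c \<in> A \<and> p \<in> fst c)"

definition differential ::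
  "('s, 'k::finite) chart set \<Rightarrow> ('m, 'n::finite) chart set \<Rightarrow> ('s \<Rightarrow> 'm) \<Rightarrow> 's \<Rightarrow>
    complex^'k \<Rightarrow> complex^'n" where
  "differential B A f p =
     frechet_derivative (snd (chart_at A (f p)) \<circ> f \<circ> chart_inv (chart_at B p))
       (at (snd (chart_at B p) p))"

text \<open>Components in the chart \<open>c\<close> of a tangent vector at \<open>p\<close>, and the vector field on the
  domain of \<open>c\<close> that has the constant components \<open>e\<close> in \<open>c\<close>.\<close>

definition components ::
  "('m, 'n::finite) chart set \<Rightarrow> ('m, 'n) chart \<Rightarrow> 'm \<Rightarrow> complex^'n \<Rightarrow> complex^'n" where
  "components A c p =
     frechet_derivative (snd c \<circ> chart_inv (chart_at A p)) (at (snd (chart_at A p) p))"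

definition coord_field ::
  "('m, 'n::finite) chart set \<Rightarrow> ('m, 'n) chart \<Rightarrow> complex^'n \<Rightarrow> 'm \<Rightarrow> complex^'n" where
  "coord_field A c e p = frechet_derivative (snd (chart_at A p) \<circ> chart_inv c) (at (snd c p)) e"

definition field_in_chart ::
  "('m, 'n::finite) chart set \<Rightarrow> ('m, 'n) chart \<Rightarrow> ('m \<Rightarrow> complex^'n) \<Rightarrow>
    complex^'n \<Rightarrow> complex^'n" where
  "field_in_chart A c X x = components A c (chart_inv c x) (X (chart_inv c x))"

definition smooth_function ::
  "('m, 'n::finite) chart set \<Rightarrow> 'm set \<Rightarrow> ('m \<Rightarrow> 'b::real_normed_vector) \<Rightarrow> bool" where
  "smooth_function A W f \<longleftrightarrow> (\<forall>c\<in>A. smooth_on (f \<circ> chart_inv c) (snd c ` (fst c \<inter> W)))"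

definition holomorphic_function ::
  "('m, 'n::finite) chart set \<Rightarrow> 'm set \<Rightarrow> ('m \<Rightarrow> complex) \<Rightarrow> bool" where
  "holomorphic_function A W f \<longleftrightarrow>
     (\<forall>c\<in>A. holomorphic_fun_on (f \<circ> chart_inv c) (snd c ` (fst c \<inter> W)))"

definition smooth_field ::
  "('m, 'n::finite) chart set \<Rightarrow> 'm set \<Rightarrow> ('m \<Rightarrow> complex^'n) \<Rightarrow> bool" where
  "smooth_field A W X \<longleftrightarrow> (\<forall>c\<in>A. smooth_on (field_in_chart A c X) (snd c ` (fst c \<inter> W)))"

definition smooth_form ::
  "('m, 'n::finite) chart set \<Rightarrow> 'm set \<Rightarrow> ('m \<Rightarrow> complex^'n \<Rightarrow> real) \<Rightarrow> bool" where
  "smooth_form A W \<alpha> \<longleftrightarrow> (\<forall>p\<in>W. linear (\<alpha> p)) \<and>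
     (\<forall>c\<in>A. \<forall>e. smooth_function A (fst c \<inter> W) (\<lambda>p. \<alpha> p (coord_field A c e p)))"

text \<open>Holomorphic 1-forms, as complex-linear forms on the real tangent spaces (which are
  complex vector spaces through \<open>J\<close> and as such isomorphic to the (1,0) tangent spaces).\<close>

definition holomorphic_form ::
  "('m, 'n::finite) chart set \<Rightarrow> 'm set \<Rightarrow> ('m \<Rightarrow> complex^'n \<Rightarrow> complex) \<Rightarrow> bool" where
  "holomorphic_form A W \<omega> \<longleftrightarrow>
     (\<forall>p\<in>W. linear (\<omega> p) \<and> (\<forall>k. \<omega> p (\<i> *s k) = \<i> * \<omega> p k)) \<and>
     (\<forall>c\<in>A. \<forall>e. holomorphic_function A (fst c \<inter> W) (\<lambda>p. \<omega> p (coord_field A c e p)))"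

definition smooth_endomorphism ::
  "('m, 'n::finite) chart set \<Rightarrow> 'm set \<Rightarrow> ('m \<Rightarrow> complex^'n \<Rightarrow> complex^'n) \<Rightarrow> bool" where
  "smooth_endomorphism A W F \<longleftrightarrow> (\<forall>p\<in>W. linear (F p)) \<and>
     (\<forall>c\<in>A. \<forall>e. smooth_field A (fst c \<inter> W) (\<lambda>p. F p (coord_field A c e p)))"

definition hermitian_metric ::
  "('m, 'n::finite) chart set \<Rightarrow> ('m \<Rightarrow> complex^'n \<Rightarrow> complex^'n \<Rightarrow> real) \<Rightarrow> bool" where
  "hermitian_metric A g \<longleftrightarrow>
     (\<forall>p. bilinear (g p) \<and> (\<forall>k l. g p k l = g p l k) \<and> (\<forall>k. k \<noteq> 0 \<longrightarrow> g p k k > 0) \<and>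
          (\<forall>k l. g p (\<i> *s k) (\<i> *s l) = g p k l)) \<and>
     (\<forall>c\<in>A. \<forall>e f. smooth_function A (fst c)
          (\<lambda>p. g p (coord_field A c e p) (coord_field A c f p)))"

definition field_derivative ::
  "('m, 'n::finite) chart set \<Rightarrow> ('m \<Rightarrow> complex^'n) \<Rightarrow> ('m \<Rightarrow> 'b::real_normed_vector) \<Rightarrow> 'm \<Rightarrow> 'b"
  where
  "field_derivative A X f p =
     frechet_derivative (f \<circ> chart_inv (chart_at A p)) (at (snd (chart_at A p) p)) (X p)"

definition lie_bracket ::
  "('m, 'n::finite) chart set \<Rightarrow> ('m \<Rightarrow> complex^'n) \<Rightarrow> ('m \<Rightarrow> complex^'n) \<Rightarrow> 'm \<Rightarrow> complex^'n"
  where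
  "lie_bracket A X Y p =
     frechet_derivative (field_in_chart A (chart_at A p) Y) (at (snd (chart_at A p) p)) (X p) -
     frechet_derivative (field_in_chart A (chart_at A p) X) (at (snd (chart_at A p) p)) (Y p)"

text \<open>Conventions: \<open>2 d\<alpha>(K,L) = K \<alpha>(L) - L \<alpha>(K) - \<alpha>([K,L])\<close> and
  \<open>2 (\<alpha> \<and> \<beta>)(K,L) = \<alpha>(K) \<beta>(L) - \<alpha>(L) \<beta>(K)\<close>.  In \<open>wedge_one\<close> the forms act on vector fields,
  with the point of evaluation already fixed.\<close>

definition ext_deriv ::
  "('m, 'n::finite) chart set \<Rightarrow> ('m \<Rightarrow> complex^'n \<Rightarrow> 'b::real_normed_vector) \<Rightarrow>
    ('m \<Rightarrow> complex^'n) \<Rightarrow> ('m \<Rightarrow> complex^'n) \<Rightarrow> 'm \<Rightarrow> 'b" where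
  "ext_deriv A \<alpha> K L p = (1/2) *\<^sub>R
     (field_derivative A K (\<lambda>q. \<alpha> q (L q)) p - field_derivative A L (\<lambda>q. \<alpha> q (K q)) p
      - \<alpha> p (lie_bracket A K L p))"

definition wedge_one :: "('v \<Rightarrow> real) \<Rightarrow> ('v \<Rightarrow> real) \<Rightarrow> 'v \<Rightarrow> 'v \<Rightarrow> real" where
  "wedge_one \<alpha> \<beta> K L = (\<alpha> K * \<beta> L - \<alpha> L * \<beta> K) / 2"

text \<open>Wedge products of complex-valued forms of arbitrary degrees in the same convention.  A
  form of degree \<open>k\<close> is a function of a sequence of arguments that depends only on the first
  \<open>k\<close> of them.\<close>

definition wedge ::
  "nat \<Rightarrow> nat \<Rightarrow> ((nat \<Rightarrow> 'v) \<Rightarrow> complex) \<Rightarrow> ((nat \<Rightarrow> 'v) \<Rightarrow> complex) \<Rightarrow> (nat \<Rightarrow> 'v) \<Rightarrow> complex"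
  where
  "wedge k l \<alpha> \<beta> X =
     (\<Sum>\<pi> | \<pi> permutes {..<k + l}.
        of_int (sign \<pi>) * \<alpha> (\<lambda>i. X (\<pi> i)) * \<beta> (\<lambda>i. X (\<pi> (k + i)))) / fact (k + l)"

primrec wedge_power_two ::
  "((nat \<Rightarrow> 'v) \<Rightarrow> complex) \<Rightarrow> nat \<Rightarrow> (nat \<Rightarrow> 'v) \<Rightarrow> complex" where
  "wedge_power_two \<alpha> 0 = (\<lambda>X. 1)"
| "wedge_power_two \<alpha> (Suc m) = wedge 2 (2 * m) \<alpha> (wedge_power_two \<alpha> m)"

text \<open>\<open>(\<omega> \<and> (d\<omega>)^m)(X 0, \<dots>, X (2m))\<close> at the point \<open>p\<close>.\<close>

definition contact_volume ::
  "('m, 'n::finite) chart set \<Rightarrow> nat \<Rightarrow> ('m \<Rightarrow> complex^'n \<Rightarrow> complex) \<Rightarrow> 'm \<Rightarrow>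
    (nat \<Rightarrow> 'm \<Rightarrow> complex^'n) \<Rightarrow> complex" where
  "contact_volume A m \<omega> p =
     wedge 1 (2 * m) (\<lambda>X. \<omega> p (X 0 p))
       (wedge_power_two (\<lambda>X. ext_deriv A \<omega> (X 0) (X 1) p) m)"


section \<open>The Levi-Civita connection\<close>

text \<open>A connection acts on vector fields that need only be smooth on some open set \<open>W\<close>; nothing
  is assumed about its values outside \<open>W\<close>.\<close>

definition affine_connection ::
  "('m::topological_space, 'n::finite) chart set \<Rightarrow>
    (('m \<Rightarrow> complex^'n) \<Rightarrow> ('m \<Rightarrow> complex^'n) \<Rightarrow> 'm \<Rightarrow> complex^'n) \<Rightarrow> bool" where
  "affine_connection A conn \<longleftrightarrow>
     (\<forall>W X Y Z. \<forall>f :: 'm \<Rightarrow> real.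
        open W \<and> smooth_field A W X \<and> smooth_field A W Y \<and> smooth_field A W Z \<and>
        smooth_function A W f \<longrightarrow>
        smooth_field A W (conn X Y) \<and>
        (\<forall>p\<in>W.
           conn (\<lambda>q. X q + Z q) Y p = conn X Y p + conn Z Y p \<and>
           conn (\<lambda>q. f q *\<^sub>R X q) Y p = f p *\<^sub>R conn X Y p \<and>
           conn X (\<lambda>q. Y q + Z q) p = conn X Y p + conn X Z p \<and>
           conn X (\<lambda>q. f q *\<^sub>R Y q) p = field_derivative A X f p *\<^sub>R Y p + f p *\<^sub>R conn X Y p))"

definition levi_civita_connection ::
  "('m::topological_space, 'n::finite) chart set \<Rightarrow>
    ('m \<Rightarrow> complex^'n \<Rightarrow> complex^'n \<Rightarrow> real) \<Rightarrow>
    (('m \<Rightarrow> complex^'n) \<Rightarrow> ('m \<Rightarrow> complex^'n) \<Rightarrow> 'm \<Rightarrow> complex^'n) \<Rightarrow> bool" where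
  "levi_civita_connection A g conn \<longleftrightarrow> affine_connection A conn \<and>
     (\<forall>W X Y Z. open W \<and> smooth_field A W X \<and> smooth_field A W Y \<and> smooth_field A W Z \<longrightarrow>
        (\<forall>p\<in>W.
           conn X Y p - conn Y X p = lie_bracket A X Y p \<and>
           field_derivative A Z (\<lambda>q. g q (X q) (Y q)) p =
             g p (conn Z X p) (Y p) + g p (X p) (conn Z Y p)))"

definition cov_deriv_endo ::
  "(('m \<Rightarrow> complex^'n) \<Rightarrow> ('m \<Rightarrow> complex^'n) \<Rightarrow> 'm \<Rightarrow> complex^'n) \<Rightarrow>
    ('m \<Rightarrow> complex^'n \<Rightarrow> complex^'n) \<Rightarrow> ('m \<Rightarrow> complex^'n) \<Rightarrow> ('m \<Rightarrow> complex^'n) \<Rightarrow>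
    'm \<Rightarrow> complex^'n" where
  "cov_deriv_endo conn F K L p = conn K (\<lambda>q. F q (L q)) p - F p (conn K L p)"

definition endo_bracket ::
  "(('m \<Rightarrow> complex^'n) \<Rightarrow> ('m \<Rightarrow> complex^'n) \<Rightarrow> 'm \<Rightarrow> complex^'n) \<Rightarrow>
    ('m \<Rightarrow> complex^'n \<Rightarrow> complex^'n) \<Rightarrow> ('m \<Rightarrow> complex^'n) \<Rightarrow> ('m \<Rightarrow> complex^'n) \<Rightarrow>
    'm \<Rightarrow> complex^'n" where
  "endo_bracket conn F K L p =
     cov_deriv_endo conn F (\<lambda>q. F q (K q)) L p - cov_deriv_endo conn F (\<lambda>q. F q (L q)) K p
     - F p (cov_deriv_endo conn F K L p) + F p (cov_deriv_endo conn F L K p)"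


section \<open>Complex contact metric manifolds\<close>

locale complex_contact_manifold =
  fixes A :: "('m::{second_countable_topology,t2_space}, 'n::finite) chart set"
    and m :: nat
    and \<U> :: "'i \<Rightarrow> 'm set"
    and \<omega> :: "'i \<Rightarrow> 'm \<Rightarrow> complex^'n \<Rightarrow> complex"
  assumes atlas: "complex_atlas A"
    and dimension: "CARD('n) = 2 * m + 1"
    and cover: "(\<Union>i. \<U> i) = UNIV"
    and neighborhood: "\<And>i. coordinate_neighborhood A (\<U> i)"
    and contact_form: "\<And>i. holomorphic_form A (\<U> i) (\<omega> i)"
    and contact: "\<And>i p. p \<in> \<U> i \<Longrightarrow>
      \<exists>W X. open W \<and> p \<in> W \<and> (\<forall>k. smooth_field A W (X k)) \<and> contact_volume A m (\<omega> i) p X \<noteq> 0"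
    and transition: "\<And>i j. \<U> i \<inter> \<U> j \<noteq> {} \<Longrightarrow>
      \<exists>f. holomorphic_function A (\<U> i \<inter> \<U> j) f \<and>
          (\<forall>p\<in>\<U> i \<inter> \<U> j. \<forall>k. \<omega> i p k = f p * \<omega> j p k)"
begin

definition horizontal :: "'m \<Rightarrow> (complex^'n) set" where
  "horizontal p = {k. \<forall>i. p \<in> \<U> i \<longrightarrow> \<omega> i p k = 0}"

end

locale complex_almost_contact_metric_structure =
  fixes A :: "('m::{second_countable_topology,t2_space}, 'n::finite) chart set"
    and \<U> :: "'i \<Rightarrow> 'm set"
    and g :: "'m \<Rightarrow> complex^'n \<Rightarrow> complex^'n \<Rightarrow> real"
    and u v :: "'i \<Rightarrow> 'm \<Rightarrow> complex^'n \<Rightarrow> real"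
    and U V :: "'i \<Rightarrow> 'm \<Rightarrow> complex^'n"
    and G H :: "'i \<Rightarrow> 'm \<Rightarrow> complex^'n \<Rightarrow> complex^'n"
  assumes metric: "hermitian_metric A g"
    and smooth_u: "\<And>i. smooth_form A (\<U> i) (u i)"
    and smooth_U: "\<And>i. smooth_field A (\<U> i) (U i)"
    and smooth_G: "\<And>i. smooth_endomorphism A (\<U> i) (G i)"
    and v_eq: "\<And>i p k. p \<in> \<U> i \<Longrightarrow> v i p k = u i p (\<i> *s k)"
    and V_eq: "\<And>i p. p \<in> \<U> i \<Longrightarrow> V i p = - (\<i> *s U i p)"
    and H_eq: "\<And>i p k. p \<in> \<U> i \<Longrightarrow> H i p k = G i p (\<i> *s k)"
    and u_dual: "\<And>i p k. p \<in> \<U> i \<Longrightarrow> u i p k = g p (U i p) k"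
    and v_dual: "\<And>i p k. p \<in> \<U> i \<Longrightarrow> v i p k = g p (V i p) k"
    and U_unit: "\<And>i p. p \<in> \<U> i \<Longrightarrow> g p (U i p) (U i p) = 1"
    and V_unit: "\<And>i p. p \<in> \<U> i \<Longrightarrow> g p (V i p) (V i p) = 1"
    and G_square: "\<And>i p k. p \<in> \<U> i \<Longrightarrow>
      G i p (G i p k) = - k + u i p k *\<^sub>R U i p + v i p k *\<^sub>R V i p"
    and H_square: "\<And>i p k. p \<in> \<U> i \<Longrightarrow>
      H i p (H i p k) = - k + u i p k *\<^sub>R U i p + v i p k *\<^sub>R V i p"
    and G_J: "\<And>i p k. p \<in> \<U> i \<Longrightarrow> G i p (\<i> *s k) = - (\<i> *s G i p k)"
    and G_U: "\<And>i p. p \<in> \<U> i \<Longrightarrow> G i p (U i p) = 0"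
    and G_skew: "\<And>i p k l. p \<in> \<U> i \<Longrightarrow> g p k (G i p l) = - g p (G i p k) l"
    and overlap: "\<And>i j. \<exists>c d :: 'm \<Rightarrow> real.
      smooth_function A (\<U> i \<inter> \<U> j) c \<and> smooth_function A (\<U> i \<inter> \<U> j) d \<and>
      (\<forall>p\<in>\<U> i \<inter> \<U> j. (c p)\<^sup>2 + (d p)\<^sup>2 = 1 \<and>
         (\<forall>k. u j p k = c p * u i p k - d p * v i p k \<and>
              v j p k = d p * u i p k + c p * v i p k \<and>
              G j p k = c p *\<^sub>R G i p k - d p *\<^sub>R H i p k \<and>
              H j p k = d p *\<^sub>R G i p k + c p *\<^sub>R H i p k))"

locale complex_contact_metric_manifold =
  complex_contact_manifold A m \<U> \<omega> +
  complex_almost_contact_metric_structure A \<U> g u v U V G H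
  for A :: "('m::{second_countable_topology,t2_space}, 'n::finite) chart set"
    and m :: nat
    and \<U> :: "'i \<Rightarrow> 'm set"
    and \<omega> :: "'i \<Rightarrow> 'm \<Rightarrow> complex^'n \<Rightarrow> complex"
    and g :: "'m \<Rightarrow> complex^'n \<Rightarrow> complex^'n \<Rightarrow> real"
    and u v :: "'i \<Rightarrow> 'm \<Rightarrow> complex^'n \<Rightarrow> real"
    and U V :: "'i \<Rightarrow> 'm \<Rightarrow> complex^'n"
    and G H :: "'i \<Rightarrow> 'm \<Rightarrow> complex^'n \<Rightarrow> complex^'n" +
  fixes conn :: "('m \<Rightarrow> complex^'n) \<Rightarrow> ('m \<Rightarrow> complex^'n) \<Rightarrow> 'm \<Rightarrow> complex^'n"
    and \<sigma> :: "'i \<Rightarrow> ('m \<Rightarrow> complex^'n) \<Rightarrow> 'm \<Rightarrow> real"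
  assumes levi_civita: "levi_civita_connection A g conn"
    and \<sigma>_eq: "\<And>i K p. \<sigma> i K p = g p (conn K (U i) p) (V i p)"
    and horizontal_eq: "\<And>i p. p \<in> \<U> i \<Longrightarrow> horizontal p = {k. u i p k = 0 \<and> v i p k = 0}"
    and du: "\<And>i W K L p. open W \<Longrightarrow> W \<subseteq> \<U> i \<Longrightarrow> smooth_field A W K \<Longrightarrow> smooth_field A W L \<Longrightarrow>
      p \<in> W \<Longrightarrow>
      ext_deriv A (u i) K L p =
        g p (K p) (G i p (L p)) + wedge_one (\<lambda>X. \<sigma> i X p) (\<lambda>X. v i p (X p)) K L"
    and dv: "\<And>i W K L p. open W \<Longrightarrow> W \<subseteq> \<U> i \<Longrightarrow> smooth_field A W K \<Longrightarrow> smooth_field A W L \<Longrightarrow>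
      p \<in> W \<Longrightarrow>
      ext_deriv A (v i) K L p =
        g p (K p) (H i p (L p)) - wedge_one (\<lambda>X. \<sigma> i X p) (\<lambda>X. u i p (X p)) K L"
begin

definition S_tensor :: "'i \<Rightarrow> ('m \<Rightarrow> complex^'n) \<Rightarrow> ('m \<Rightarrow> complex^'n) \<Rightarrow> 'm \<Rightarrow> complex^'n" where
  "S_tensor i K L p =
     endo_bracket conn (G i) K L p
     + (2 * g p (K p) (G i p (L p))) *\<^sub>R U i p - (2 * g p (K p) (H i p (L p))) *\<^sub>R V i p
     + 2 *\<^sub>R (v i p (L p) *\<^sub>R H i p (K p) - v i p (K p) *\<^sub>R H i p (L p))
     + \<sigma> i (\<lambda>q. G i q (L q)) p *\<^sub>R H i p (K p) - \<sigma> i (\<lambda>q. G i q (K q)) p *\<^sub>R H i p (L p)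
     + \<sigma> i K p *\<^sub>R G i p (H i p (L p)) - \<sigma> i L p *\<^sub>R G i p (H i p (K p))"

definition T_tensor :: "'i \<Rightarrow> ('m \<Rightarrow> complex^'n) \<Rightarrow> ('m \<Rightarrow> complex^'n) \<Rightarrow> 'm \<Rightarrow> complex^'n" where
  "T_tensor i K L p =
     endo_bracket conn (H i) K L p
     - (2 * g p (K p) (G i p (L p))) *\<^sub>R U i p + (2 * g p (K p) (H i p (L p))) *\<^sub>R V i p
     + 2 *\<^sub>R (u i p (L p) *\<^sub>R G i p (K p) - u i p (K p) *\<^sub>R G i p (L p))
     + \<sigma> i (\<lambda>q. H i q (K q)) p *\<^sub>R G i p (L p) - \<sigma> i (\<lambda>q. H i q (L q)) p *\<^sub>R G i p (K p)
     + \<sigma> i K p *\<^sub>R G i p (H i p (L p)) - \<sigma> i L p *\<^sub>R G i p (H i p (K p))"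

end

locale normal_complex_contact_metric_manifold = complex_contact_metric_manifold +
  assumes normal_horizontal: "\<And>i W K L p. open W \<Longrightarrow> W \<subseteq> \<U> i \<Longrightarrow>
      smooth_field A W K \<Longrightarrow> smooth_field A W L \<Longrightarrow>
      (\<And>q. q \<in> W \<Longrightarrow> K q \<in> horizontal q) \<Longrightarrow> (\<And>q. q \<in> W \<Longrightarrow> L q \<in> horizontal q) \<Longrightarrow>
      p \<in> W \<Longrightarrow> S_tensor i K L p = 0 \<and> T_tensor i K L p = 0"
    and normal_vertical: "\<And>i W K p. open W \<Longrightarrow> W \<subseteq> \<U> i \<Longrightarrow> smooth_field A W K \<Longrightarrow>
      p \<in> W \<Longrightarrow> S_tensor i K (U i) p = 0 \<and> T_tensor i K (V i) p = 0"


section \<open>Semi-invariant submanifolds\<close>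

text \<open>A complex submanifold is a complex manifold \<open>'s\<close> with an injective holomorphic immersion
  \<open>\<iota>\<close>, so embedded submanifolds are included.  Tangent vectors of \<open>'s\<close> are regarded as
  tangent vectors of \<open>'m\<close> through the differential of \<open>\<iota>\<close>.\<close>

definition complex_submanifold ::
  "('m::{second_countable_topology,t2_space}, 'n::finite) chart set \<Rightarrow>
    ('s::{second_countable_topology,t2_space}, 'k::finite) chart set \<Rightarrow> ('s \<Rightarrow> 'm) \<Rightarrow> bool" where
  "complex_submanifold A B \<iota> \<longleftrightarrow> complex_atlas B \<and> continuous_on UNIV \<iota> \<and> inj \<iota> \<and>
     (\<forall>b\<in>B. \<forall>a\<in>A.
        holomorphic_map_on (snd a \<circ> \<iota> \<circ> chart_inv b) (snd b ` (fst b \<inter> \<iota> -` fst a))) \<and>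
     (\<forall>p. inj (differential B A \<iota> p))"

text \<open>A smooth distribution is a subbundle of the tangent bundle: near every point it has a frame
  of smooth vector fields.\<close>

definition smooth_distribution ::
  "('s::topological_space, 'k::finite) chart set \<Rightarrow> ('s \<Rightarrow> (complex^'k) set) \<Rightarrow> bool" where
  "smooth_distribution B D \<longleftrightarrow>
     (\<forall>p. \<exists>W. \<exists>r::nat. \<exists>E. open W \<and> p \<in> W \<and> (\<forall>i<r. smooth_field B W (E i)) \<and>
        (\<forall>q\<in>W. inj_on (\<lambda>i. E i q) {..<r} \<and> independent ((\<lambda>i. E i q) ` {..<r}) \<and>
               D q = span ((\<lambda>i. E i q) ` {..<r})))"

definition involutive ::
  "('s::topological_space, 'k::finite) chart set \<Rightarrow> ('s \<Rightarrow> (complex^'k) set) \<Rightarrow> bool" where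
  "involutive B D \<longleftrightarrow>
     (\<forall>W X Y. open W \<and> smooth_field B W X \<and> smooth_field B W Y \<and>
        (\<forall>p\<in>W. X p \<in> D p \<and> Y p \<in> D p) \<longrightarrow> (\<forall>p\<in>W. lie_bracket B X Y p \<in> D p))"

text \<open>The distribution \<open>sp{U, V}\<close> on the submanifold.  By the overlap conditions the span of
  \<open>U i\<close> and \<open>V i\<close> does not depend on the index \<open>i\<close>.\<close>

definition structure_span ::
  "('m, 'n::finite) chart set \<Rightarrow> ('i \<Rightarrow> 'm set) \<Rightarrow>
    ('i \<Rightarrow> 'm \<Rightarrow> complex^'n) \<Rightarrow> ('i \<Rightarrow> 'm \<Rightarrow> complex^'n) \<Rightarrow>
    ('s, 'k::finite) chart set \<Rightarrow> ('s \<Rightarrow> 'm) \<Rightarrow> 's \<Rightarrow> (complex^'k) set" where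
  "structure_span A \<U> U V B \<iota> p =
     {x. \<exists>i. \<iota> p \<in> \<U> i \<and> differential B A \<iota> p x \<in> span {U i (\<iota> p), V i (\<iota> p)}}"

definition fibrewise_orthogonal ::
  "('m, 'n::finite) chart set \<Rightarrow> ('m \<Rightarrow> complex^'n \<Rightarrow> complex^'n \<Rightarrow> real) \<Rightarrow>
    ('s, 'k::finite) chart set \<Rightarrow> ('s \<Rightarrow> 'm) \<Rightarrow>
    ('s \<Rightarrow> (complex^'k) set) \<Rightarrow> ('s \<Rightarrow> (complex^'k) set) \<Rightarrow> bool" where
  "fibrewise_orthogonal A g B \<iota> D E \<longleftrightarrow>
     (\<forall>p. \<forall>x\<in>D p. \<forall>y\<in>E p. g (\<iota> p) (differential B A \<iota> p x) (differential B A \<iota> p y) = 0)"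

definition normal_space ::
  "('m, 'n::finite) chart set \<Rightarrow> ('m \<Rightarrow> complex^'n \<Rightarrow> complex^'n \<Rightarrow> real) \<Rightarrow>
    ('s, 'k::finite) chart set \<Rightarrow> ('s \<Rightarrow> 'm) \<Rightarrow> 's \<Rightarrow> (complex^'n) set" where
  "normal_space A g B \<iota> p = {k. \<forall>x. g (\<iota> p) k (differential B A \<iota> p x) = 0}"

definition sum_distribution ::
  "('s \<Rightarrow> (complex^'k) set) \<Rightarrow> ('s \<Rightarrow> (complex^'k) set) \<Rightarrow> 's \<Rightarrow> (complex^'k::finite) set" where
  "sum_distribution D E p = {x + y | x y. x \<in> D p \<and> y \<in> E p}"

definition semi_invariant_submanifold ::
  "('m::{second_countable_topology,t2_space}, 'n::finite) chart set \<Rightarrow> ('i \<Rightarrow> 'm set) \<Rightarrow>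
    ('m \<Rightarrow> complex^'n \<Rightarrow> complex^'n \<Rightarrow> real) \<Rightarrow>
    ('i \<Rightarrow> 'm \<Rightarrow> complex^'n) \<Rightarrow> ('i \<Rightarrow> 'm \<Rightarrow> complex^'n) \<Rightarrow>
    ('i \<Rightarrow> 'm \<Rightarrow> complex^'n \<Rightarrow> complex^'n) \<Rightarrow> ('i \<Rightarrow> 'm \<Rightarrow> complex^'n \<Rightarrow> complex^'n) \<Rightarrow>
    ('s::{second_countable_topology,t2_space}, 'k::finite) chart set \<Rightarrow> ('s \<Rightarrow> 'm) \<Rightarrow>
    ('s \<Rightarrow> (complex^'k) set) \<Rightarrow> ('s \<Rightarrow> (complex^'k) set) \<Rightarrow> bool" where
  "semi_invariant_submanifold A \<U> g U V G H B \<iota> D Dperp \<longleftrightarrow>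
     complex_submanifold A B \<iota> \<and>
     (\<forall>p i. \<iota> p \<in> \<U> i \<longrightarrow>
        U i (\<iota> p) \<in> range (differential B A \<iota> p) \<and> V i (\<iota> p) \<in> range (differential B A \<iota> p)) \<and>
     smooth_distribution B D \<and> smooth_distribution B Dperp \<and>
     fibrewise_orthogonal A g B \<iota> D Dperp \<and>
     fibrewise_orthogonal A g B \<iota> D (structure_span A \<U> U V B \<iota>) \<and>
     fibrewise_orthogonal A g B \<iota> Dperp (structure_span A \<U> U V B \<iota>) \<and>
     (\<forall>p. sum_distribution D (sum_distribution Dperp (structure_span A \<U> U V B \<iota>)) p = UNIV) \<and>
     (\<forall>p i. \<iota> p \<in> \<U> i \<longrightarrow>
        G i (\<iota> p) ` differential B A \<iota> p ` D p = differential B A \<iota> p ` D p \<and>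
        H i (\<iota> p) ` differential B A \<iota> p ` D p = differential B A \<iota> p ` D p \<and>
        G i (\<iota> p) ` differential B A \<iota> p ` Dperp p \<subseteq> normal_space A g B \<iota> p \<and>
        H i (\<iota> p) ` differential B A \<iota> p ` Dperp p \<subseteq> normal_space A g B \<iota> p)"

end

theory Submission
  imports Defs
begin

text \<open>
  Pull the forms \<open>u\<close>, \<open>v\<close> back to forms \<open>\<alpha>\<close>, \<open>\<beta>\<close> on the submanifold, and the bilinear forms
  \<open>g(\<cdot>, G\<cdot>)\<close>, \<open>g(\<cdot>, H\<cdot>)\<close> to \<open>\<Phi>\<close>, \<open>\<Psi>\<close>, so that \<open>d\<alpha> = \<Phi> + \<sigma> \<and> \<beta>\<close> and \<open>d\<beta> = \<Psi> - \<sigma> \<and> \<alpha>\<close>.  The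
  anti-invariant distribution, \<open>U\<close> and \<open>V\<close> all lie in the kernels of \<open>\<Phi>\<close> and \<open>\<Psi>\<close>.  If \<open>X\<close>, \<open>Y\<close> are
  such fields with \<open>\<beta>\<close> zero and \<open>\<alpha>\<close> constant on them, and \<open>Z\<close> is a section of the invariant
  distribution, then applying \<open>\<alpha>\<close> to the Jacobi identity of \<open>X, Y, Z\<close> (that is, \<open>d\<^sup>2\<alpha> = 0\<close>) gives
  \<open>\<Phi>([X, Y], Z) = 0\<close>, so \<open>[X, Y]\<close> is orthogonal to \<open>G D = D\<close>; with \<open>\<alpha>\<close> and \<open>\<beta>\<close> exchanged it is
  orthogonal to \<open>H D = D\<close>.  This covers every pair among \<open>Dperp\<close>, \<open>U\<close>, \<open>V\<close> except \<open>[U, V]\<close>, which is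
  found to be vertical upstairs, by comparing the formulas for \<open>du(V, Z)\<close> and \<open>dv(U, Z)\<close> with the
  metric connection.  Everything else follows by the Leibniz rule.
\<close>

section \<open>Calculus of smooth maps\<close>

lemma Ck_on_SucD: "Ck_on (Suc k) f S \<Longrightarrow> Ck_on k f S"
proof (induction k arbitrary: f)
  case 0
  then show ?case
    by (simp add: continuous_at_imp_continuous_on differentiable_imp_continuous_within)
next
  case (Suc k)
  then show ?case
    by (metis Ck_on.simps(2))
qed

lemma Ck_on_subset: "Ck_on k f S \<Longrightarrow> T \<subseteq> S \<Longrightarrow> Ck_on k f T"
  by (induction k arbitrary: f) (auto intro: continuous_on_subset)

text \<open>No differentiability is assumed: the two maps have exactly the same derivatives at
  \<open>x\<close>, so the choice operator inside \<open>frechet_derivative\<close> picks the same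
  one for both.\<close>

lemma frechet_derivative_cong_open:
  assumes "open S" "x \<in> S" "\<And>y. y \<in> S \<Longrightarrow> f y = h y"
  shows "frechet_derivative f (at x) = frechet_derivative h (at x)"
proof -
  have "(f has_derivative D) (at x) \<longleftrightarrow> (h has_derivative D) (at x)" for D
    using assms has_derivative_transform_within_open by metis
  then show ?thesis
    by (simp add: frechet_derivative_def)
qed

lemma differentiable_cong_open:
  assumes "open S" "x \<in> S" "\<And>y. y \<in> S \<Longrightarrow> f y = h y"
  shows "f differentiable (at x) \<longleftrightarrow> h differentiable (at x)"
  using assms has_derivative_transform_within_open unfolding differentiable_def by metis

lemma Ck_on_cong:
  assumes "open S" "\<And>y. y \<in> S \<Longrightarrow> f y = h y"
  shows "Ck_on k f S \<longleftrightarrow> Ck_on k h S"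
  using assms(2)
proof (induction k arbitrary: f h)
  case 0
  then show ?case
    by (simp cong: continuous_on_cong)
next
  case (Suc k)
  have "Ck_on k (\<lambda>x. frechet_derivative f (at x) v) S \<longleftrightarrow> Ck_on k (\<lambda>x. frechet_derivative h (at x) v) S" for v
    by (intro Suc.IH) (metis frechet_derivative_cong_open[OF assms(1)] Suc.prems)
  then show ?case
    using differentiable_cong_open[OF assms(1) _ Suc.prems] by simp
qed

lemma fd_eqI: "(f has_derivative D) (at x) \<Longrightarrow> frechet_derivative f (at x) v = D v"
  using frechet_derivative_at by metis

lemma has_fd: "f differentiable (at x) \<Longrightarrow> (f has_derivative frechet_derivative f (at x)) (at x)"
  using frechet_derivative_works by blast

text \<open>Replaces the chosen \<open>frechet_derivative\<close> by an explicit derivative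
  \<open>D\<close>, so that each closure property below needs only the usual differentiation rule
  and the induction hypothesis.\<close>

lemma Ck_on_SucI:
  assumes "open S" "\<And>x. x \<in> S \<Longrightarrow> (f has_derivative D x) (at x)" "\<And>v. Ck_on k (\<lambda>x. D x v) S"
  shows "Ck_on (Suc k) f S"
proof -
  have "Ck_on k (\<lambda>x. frechet_derivative f (at x) v) S" for v
  proof (rule Ck_on_cong[OF assms(1), THEN iffD2])
    show "Ck_on k (\<lambda>x. D x v) S"
      by (rule assms(3))
  qed (rule fd_eqI[OF assms(2)])
  moreover have "f differentiable (at x)" if "x \<in> S" for x
    using assms(2)[OF that] by (auto simp: differentiable_def)
  ultimately show ?thesis
    by simp
qed

lemma Ck_on_const: "Ck_on k (\<lambda>x. c) S"
  by (induction k arbitrary: c) auto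

lemma Ck_on_add: "Ck_on k f S \<Longrightarrow> Ck_on k h S \<Longrightarrow> Ck_on k (\<lambda>x. f x + h x) S" if "open S"
proof (induction k arbitrary: f h)
  case 0
  then show ?case by (auto intro: continuous_intros)
next
  case (Suc k)
  then show ?case
    by (intro Ck_on_SucI[where D="\<lambda>x v. frechet_derivative f (at x) v + frechet_derivative h (at x) v"] that
        Suc.IH has_derivative_add has_fd) auto
qed

lemma Ck_on_sum:
  assumes "open S" "\<And>i. i \<in> I \<Longrightarrow> Ck_on k (f i) S"
  shows "Ck_on k (\<lambda>x. \<Sum>i\<in>I. f i x) S"
  using assms(2) by (induction I rule: infinite_finite_induct) (auto intro: Ck_on_const Ck_on_add[OF assms(1)])

text \<open>The product rule gives a sum of products in which one factor is differentiated;
  \<open>Ck_on_SucD\<close> lowers the other factor to order \<open>k\<close>, and the induction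
  hypothesis covers both summands.\<close>

lemma (in bounded_bilinear) Ck_on_bilinear:
  assumes "open S"
  shows "Ck_on k f S \<Longrightarrow> Ck_on k h S \<Longrightarrow> Ck_on k (\<lambda>x. prod (f x) (h x)) S"
proof (induction k arbitrary: f h)
  case 0
  then show ?case by (auto intro: continuous_on)
next
  case (Suc k)
  let ?D = "\<lambda>v x. prod (f x) (frechet_derivative h (at x) v) + prod (frechet_derivative f (at x) v) (h x)"
  have *: "((\<lambda>x. prod (f x) (h x)) has_derivative (\<lambda>v. ?D v x)) (at x)" if "x \<in> S" for x
    using Suc.prems that by (auto intro!: FDERIV has_fd)
  have "Ck_on k (?D v) S" for v
    using Suc.prems Ck_on_SucD[OF Suc.prems(1)] Ck_on_SucD[OF Suc.prems(2)]
    by (auto intro!: Ck_on_add[OF assms] Suc.IH)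
  with * show ?case
    by (intro Ck_on_SucI[OF assms(1)])
qed

lemma (in bounded_linear) Ck_on_linear:
  assumes "open S"
  shows "Ck_on k h S \<Longrightarrow> Ck_on k (\<lambda>x. f (h x)) S"
proof (induction k arbitrary: h)
  case 0
  then show ?case by (auto intro: continuous_on)
next
  case (Suc k)
  have *: "((\<lambda>x. f (h x)) has_derivative (\<lambda>v. f (frechet_derivative h (at x) v))) (at x)" if "x \<in> S" for x
    using Suc.prems that by (auto intro!: has_derivative has_fd)
  have "Ck_on k (\<lambda>x. f (frechet_derivative h (at x) v)) S" for v
    using Suc by auto
  with * show ?case
    by (intro Ck_on_SucI[OF assms(1)])
qed

lemma linear_sum_Basis:
  fixes T :: "'a::euclidean_space \<Rightarrow> 'b::real_vector"
  assumes "linear T"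
  shows "T w = (\<Sum>b\<in>Basis. (w \<bullet> b) *\<^sub>R T b)"
proof -
  have "T w = T (\<Sum>b\<in>Basis. (w \<bullet> b) *\<^sub>R b)"
    by (simp add: euclidean_representation)
  also have "\<dots> = (\<Sum>b\<in>Basis. (w \<bullet> b) *\<^sub>R T b)"
    by (simp only: linear_sum[OF assms] linear_scale[OF assms])
  finally show ?thesis .
qed

text \<open>Expanding \<open>X z\<close> in the standard basis makes this a finite sum of products.
  Differentials and forms evaluated on vector fields have this shape.\<close>

lemma Ck_on_linear_family:
  fixes T :: "'c::real_normed_vector \<Rightarrow> 'a::euclidean_space \<Rightarrow> 'b::real_normed_vector"
  assumes "open S" "\<And>z. z \<in> S \<Longrightarrow> linear (T z)" "\<And>b. b \<in> Basis \<Longrightarrow> Ck_on k (\<lambda>z. T z b) S" "Ck_on k X S"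
  shows "Ck_on k (\<lambda>z. T z (X z)) S"
proof -
  have "Ck_on k (\<lambda>z. \<Sum>b\<in>Basis. (X z \<bullet> b) *\<^sub>R T z b) S"
    by (intro Ck_on_sum bounded_bilinear.Ck_on_bilinear[OF bounded_bilinear_scaleR] assms
        bounded_linear.Ck_on_linear[OF bounded_linear_inner_left])
  then show ?thesis
    using Ck_on_cong[OF assms(1) linear_sum_Basis[OF assms(2)], where k=k] by simp
qed

text \<open>By the chain rule the derivative is the linear family
  \<open>frechet_derivative h (at (f x))\<close> applied to the derivative of \<open>f\<close>. Its
  basis values are directional derivatives of \<open>h\<close> composed with \<open>f\<close>, which
  is why the induction generalises over \<open>h\<close>.\<close>

lemma Ck_on_compose:
  fixes f :: "'c::real_normed_vector \<Rightarrow> 'a::euclidean_space" and h :: "'a \<Rightarrow> 'b::real_normed_vector"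
  assumes "open S" "open R" "f ` S \<subseteq> R"
  shows "Ck_on k f S \<Longrightarrow> Ck_on k h R \<Longrightarrow> Ck_on k (\<lambda>x. h (f x)) S"
proof (induction k arbitrary: h)
  case 0
  then show ?case
    using assms(3) by (auto intro: continuous_on_compose2)
next
  case (Suc k)
  let ?D = "\<lambda>x v. frechet_derivative h (at (f x)) (frechet_derivative f (at x) v)"
  have *: "((\<lambda>x. h (f x)) has_derivative (\<lambda>v. ?D x v)) (at x)" if "x \<in> S" for x
  proof (rule has_derivative_compose[where g=h and f=f])
    show "(f has_derivative frechet_derivative f (at x)) (at x)"
      using Suc.prems(1) that by (intro has_fd) simp
    show "(h has_derivative frechet_derivative h (at (f x))) (at (f x))"
      using Suc.prems(2) that assms(3) by (intro has_fd) auto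
  qed
  have "Ck_on k (\<lambda>x. ?D x v) S" for v
  proof (rule Ck_on_linear_family[where T="\<lambda>x. frechet_derivative h (at (f x))"])
    show "Ck_on k (\<lambda>z. frechet_derivative h (at (f z)) b) S" for b
      using Suc.prems by (intro Suc.IH Ck_on_SucD[OF Suc.prems(1)]) simp
    show "linear (frechet_derivative h (at (f z)))" if "z \<in> S" for z
      using Suc.prems(2) that assms(3) by (intro linear_frechet_derivative) auto
  qed (use Suc.prems(1) assms(1) in auto)
  with * show ?case
    by (intro Ck_on_SucI[OF assms(1)])
qed

lemma Ck_on_inverse:
  fixes f :: "'c::real_normed_vector \<Rightarrow> 'a::real_normed_field"
  assumes "open S" "\<And>x. x \<in> S \<Longrightarrow> f x \<noteq> 0"
  shows "Ck_on k f S \<Longrightarrow> Ck_on k (\<lambda>x. inverse (f x)) S"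
proof (induction k)
  case 0
  then show ?case
    using assms(2) by (auto intro: continuous_intros)
next
  case (Suc k)
  let ?D = "\<lambda>x v. - 1 * (inverse (f x) * frechet_derivative f (at x) v * inverse (f x))"
  have *: "((\<lambda>x. inverse (f x)) has_derivative (\<lambda>v. ?D x v)) (at x)" if "x \<in> S" for x
    using Deriv.has_derivative_inverse[of f x "frechet_derivative f (at x)" UNIV]
      assms(2)[OF that] has_fd[of f x] Suc.prems that by simp
  have "Ck_on k (\<lambda>x. ?D x v) S" for v
    using Suc Ck_on_SucD[OF Suc.prems]
    by (intro bounded_bilinear.Ck_on_bilinear[OF bounded_bilinear_mult] Ck_on_const assms(1)) auto
  with * show ?case
    by (intro Ck_on_SucI[OF assms(1)])
qed

lemma Ck_on_prod:
  fixes f :: "'i \<Rightarrow> 'c::real_normed_vector \<Rightarrow> 'a::real_normed_field"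
  assumes "open S" "\<And>i. i \<in> I \<Longrightarrow> Ck_on k (f i) S"
  shows "Ck_on k (\<lambda>x. \<Prod>i\<in>I. f i x) S"
  using assms(2)
  by (induction I rule: infinite_finite_induct)
    (auto intro: Ck_on_const bounded_bilinear.Ck_on_bilinear[OF bounded_bilinear_mult assms(1)])

lemma bounded_linear_axis: "bounded_linear (axis j :: 'a::euclidean_space \<Rightarrow> 'a^'n)"
  by (rule linear_conv_bounded_linear[THEN iffD1]) (auto intro!: linearI simp: axis_def vec_eq_iff)

lemma sum_axis_nth: "(\<Sum>j\<in>UNIV. axis j (x $ j)) = (x :: 'a::comm_monoid_add^'n)"
  by (simp add: vec_eq_iff axis_def if_distrib[of "\<lambda>h. h $ _"] if_distrib cong: if_cong)

lemma Ck_on_vec: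
  fixes f :: "'c::real_normed_vector \<Rightarrow> 'a::euclidean_space^'n"
  assumes "open S" "\<And>j. Ck_on k (\<lambda>x. f x $ j) S"
  shows "Ck_on k f S"
proof -
  have "Ck_on k (\<lambda>x. \<Sum>j\<in>UNIV. axis j (f x $ j)) S"
    by (intro Ck_on_sum bounded_linear.Ck_on_linear[OF bounded_linear_axis] assms)
  then show ?thesis
    by (simp add: sum_axis_nth)
qed

lemma Ck_on_det:
  fixes M :: "'c::real_normed_vector \<Rightarrow> complex^'n^'n"
  assumes "open S" "\<And>i j. Ck_on k (\<lambda>x. M x $ i $ j) S"
  shows "Ck_on k (\<lambda>x. det (M x)) S"
  unfolding det_def
  by (intro Ck_on_sum Ck_on_prod bounded_bilinear.Ck_on_bilinear[OF bounded_bilinear_mult] Ck_on_const assms)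

abbreviation fd :: "('a::real_normed_vector \<Rightarrow> 'b::real_normed_vector) \<Rightarrow> 'a \<Rightarrow> 'a \<Rightarrow> 'b" where
  "fd f x \<equiv> frechet_derivative f (at x)"

section \<open>Smooth maps\<close>

lemma smooth_on_differentiable: "smooth_on f S \<Longrightarrow> x \<in> S \<Longrightarrow> f differentiable (at x)"
  unfolding smooth_on_def by (metis Ck_on.simps(2))

lemma smooth_on_has_fd: "smooth_on f S \<Longrightarrow> x \<in> S \<Longrightarrow> (f has_derivative fd f x) (at x)"
  by (simp add: has_fd smooth_on_differentiable)

lemma smooth_on_fd: "smooth_on f S \<Longrightarrow> smooth_on (\<lambda>x. fd f x v) S"
  unfolding smooth_on_def by (metis Ck_on.simps(2))

lemma smooth_on_continuous: "smooth_on f S \<Longrightarrow> continuous_on S f"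
  unfolding smooth_on_def by (metis Ck_on.simps(1))

lemma smooth_on_subset: "smooth_on f S \<Longrightarrow> T \<subseteq> S \<Longrightarrow> smooth_on f T"
  unfolding smooth_on_def using Ck_on_subset by blast

lemma smooth_on_cong:
  assumes "open S" "\<And>y. y \<in> S \<Longrightarrow> f y = h y"
  shows "smooth_on f S \<longleftrightarrow> smooth_on h S"
  using Ck_on_cong[OF assms(1), of f h] assms(2) by (simp add: smooth_on_def)

lemma smooth_on_add: "open S \<Longrightarrow> smooth_on f S \<Longrightarrow> smooth_on h S \<Longrightarrow> smooth_on (\<lambda>x. f x + h x) S"
  by (simp add: smooth_on_def Ck_on_add)

lemma smooth_on_sum:
  "open S \<Longrightarrow> (\<And>i. i \<in> I \<Longrightarrow> smooth_on (f i) S) \<Longrightarrow> smooth_on (\<lambda>x. \<Sum>i\<in>I. f i x) S"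
  by (simp add: smooth_on_def Ck_on_sum)

lemma (in bounded_bilinear) smooth_on_bilinear:
  "open S \<Longrightarrow> smooth_on f S \<Longrightarrow> smooth_on h S \<Longrightarrow> smooth_on (\<lambda>x. prod (f x) (h x)) S"
  by (simp add: smooth_on_def Ck_on_bilinear)

lemma (in bounded_linear) smooth_on_linear:
  "open S \<Longrightarrow> smooth_on h S \<Longrightarrow> smooth_on (\<lambda>x. f (h x)) S"
  by (simp add: smooth_on_def Ck_on_linear)

lemma smooth_on_diff: "open S \<Longrightarrow> smooth_on f S \<Longrightarrow> smooth_on h S \<Longrightarrow> smooth_on (\<lambda>x. f x - h x) S"
  for f h :: "'a::real_normed_vector \<Rightarrow> 'b::real_normed_vector"
  using smooth_on_add[of S f "\<lambda>x. - h x"] bounded_linear.smooth_on_linear[OF bounded_linear_minus[OF bounded_linear_ident], of S h]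
  by simp

lemma smooth_on_linear_family:
  fixes T :: "'c::real_normed_vector \<Rightarrow> 'a::euclidean_space \<Rightarrow> 'b::real_normed_vector"
  assumes "open S" "\<And>z. z \<in> S \<Longrightarrow> linear (T z)" "\<And>b. b \<in> Basis \<Longrightarrow> smooth_on (\<lambda>z. T z b) S" "smooth_on X S"
  shows "smooth_on (\<lambda>z. T z (X z)) S"
  using assms Ck_on_linear_family[of S T _ X] by (simp add: smooth_on_def)

lemma smooth_on_compose:
  fixes f :: "'c::real_normed_vector \<Rightarrow> 'a::euclidean_space" and h :: "'a \<Rightarrow> 'b::real_normed_vector"
  assumes "open S" "open R" "f ` S \<subseteq> R" "smooth_on f S" "smooth_on h R"
  shows "smooth_on (\<lambda>x. h (f x)) S"
  using assms(4,5) unfolding smooth_on_def by (blast intro: Ck_on_compose[OF assms(1-3)])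

lemma smooth_on_vec:
  fixes f :: "'c::real_normed_vector \<Rightarrow> 'a::euclidean_space^'n"
  assumes "open S" "\<And>j. smooth_on (\<lambda>x. f x $ j) S"
  shows "smooth_on f S"
  using assms by (simp add: smooth_on_def Ck_on_vec)

lemma smooth_on_divide:
  fixes f h :: "'c::real_normed_vector \<Rightarrow> 'a::real_normed_field"
  assumes "open S" "\<And>x. x \<in> S \<Longrightarrow> h x \<noteq> 0" "smooth_on f S" "smooth_on h S"
  shows "smooth_on (\<lambda>x. f x / h x) S"
  unfolding divide_inverse
  using assms Ck_on_inverse[OF assms(1,2)]
  by (intro bounded_bilinear.smooth_on_bilinear[OF bounded_bilinear_mult]) (auto simp: smooth_on_def)

lemma smooth_on_det:
  fixes M :: "'c::real_normed_vector \<Rightarrow> complex^'n^'n"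
  assumes "open S" "\<And>i j. smooth_on (\<lambda>x. M x $ i $ j) S"
  shows "smooth_on (\<lambda>x. det (M x)) S"
  using assms by (simp add: smooth_on_def Ck_on_det)

section \<open>Product rule for linear families and symmetry of second derivatives\<close>

text \<open>Differentiating the expansion in the standard basis gives two terms: one freezes the
  argument at \<open>X y\<close> and differentiates the linear map, the other differentiates the
  argument.\<close>

lemma has_derivative_linear_family:
  fixes T :: "'c::real_normed_vector \<Rightarrow> 'a::euclidean_space \<Rightarrow> 'b::real_normed_vector"
  assumes "open S" "y \<in> S" "\<And>z. z \<in> S \<Longrightarrow> linear (T z)" "\<And>b. (\<lambda>z. T z b) differentiable (at y)"
    "X differentiable (at y)"
  shows "((\<lambda>z. T z (X z)) has_derivative (\<lambda>w. fd (\<lambda>z. T z (X y)) y w + T y (fd X y w))) (at y)"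
proof -
  have *: "((\<lambda>z. T z (Z z)) has_derivative
      (\<lambda>w. (\<Sum>b\<in>Basis. (Z y \<bullet> b) *\<^sub>R fd (\<lambda>z. T z b) y w) + T y (fd Z y w))) (at y)"
    if "Z differentiable (at y)" for Z
  proof -
    have "((\<lambda>z. \<Sum>b\<in>Basis. (Z z \<bullet> b) *\<^sub>R T z b) has_derivative
      (\<lambda>w. \<Sum>b\<in>Basis. (Z y \<bullet> b) *\<^sub>R fd (\<lambda>z. T z b) y w + (fd Z y w \<bullet> b) *\<^sub>R T y b)) (at y)"
      by (intro has_derivative_sum has_derivative_scaleR has_derivative_inner_left has_fd that assms)
    moreover have "T z (Z z) = (\<Sum>b\<in>Basis. (Z z \<bullet> b) *\<^sub>R T z b)" if "z \<in> S" for z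
      using linear_sum_Basis[OF assms(3)[OF that]] .
    ultimately have "((\<lambda>z. T z (Z z)) has_derivative
      (\<lambda>w. \<Sum>b\<in>Basis. (Z y \<bullet> b) *\<^sub>R fd (\<lambda>z. T z b) y w + (fd Z y w \<bullet> b) *\<^sub>R T y b)) (at y)"
      using has_derivative_transform_within_open[OF _ assms(1,2)] by (smt (verit, best))
    then show ?thesis
      by (simp add: sum.distrib linear_sum_Basis[OF assms(3)[OF assms(2)], symmetric])
  qed
  have "fd (\<lambda>z. T z (X y)) y w = (\<Sum>b\<in>Basis. (X y \<bullet> b) *\<^sub>R fd (\<lambda>z. T z b) y w)" for w
    using fd_eqI[OF *[of "\<lambda>z. X y"], of w] linear_0[OF assms(3)[OF assms(2)]] by simp
  then show ?thesis
    using *[OF assms(5)] by simp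
qed

lemma has_real_derivative_along_line:
  fixes h :: "'a::real_normed_vector \<Rightarrow> real"
  assumes "h differentiable (at (x + t *\<^sub>R k))"
  shows "((\<lambda>s. h (x + s *\<^sub>R k)) has_real_derivative fd h (x + t *\<^sub>R k) k) (at t)"
proof -
  have "((\<lambda>s. h (x + s *\<^sub>R k)) has_derivative (\<lambda>s. fd h (x + t *\<^sub>R k) (s *\<^sub>R k))) (at t)"
  proof (rule has_derivative_compose[where g=h and f="\<lambda>s. x + s *\<^sub>R k"])
    show "((\<lambda>s. x + s *\<^sub>R k) has_derivative (\<lambda>s. s *\<^sub>R k)) (at t)"
      by (auto intro!: derivative_eq_intros)
  qed (rule has_fd[OF assms])
  then show ?thesis
    by (simp add: has_field_derivative_def linear_scale[OF linear_frechet_derivative[OF assms]] mult.commute[of _ "fd _ _ _"])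
qed

text \<open>Two mean value theorems: one in direction \<open>k\<close> for the increment of
  \<open>h\<close> along \<open>t *\<^sub>R l\<close>, then one in direction \<open>l\<close> for
  the derivative of \<open>h\<close> along \<open>k\<close>.\<close>

lemma second_difference_mean_value:
  fixes h :: "'a::real_normed_vector \<Rightarrow> real"
  assumes "smooth_on h S" "ball x d \<subseteq> S" "0 < t" "t * (norm k + norm l) < d"
  shows "\<exists>z\<in>ball x d. h (x + t *\<^sub>R k + t *\<^sub>R l) - h (x + t *\<^sub>R k) - h (x + t *\<^sub>R l) + h x
    = t\<^sup>2 * fd (\<lambda>z. fd h z k) z l"
proof -
  \<comment> \<open>The whole parallelogram spanned by \<open>t *\<^sub>R k\<close> and
    \<open>t *\<^sub>R l\<close> stays in the ball.\<close>
  have S: "x + a *\<^sub>R k + b *\<^sub>R l \<in> ball x d" if "0 \<le> a" "a \<le> t" "0 \<le> b" "b \<le> t" for a b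
  proof -
    have "norm (a *\<^sub>R k + b *\<^sub>R l) \<le> a * norm k + b * norm l"
      using that norm_triangle_ineq[of "a *\<^sub>R k" "b *\<^sub>R l"] by simp
    also have "\<dots> \<le> t * norm k + t * norm l"
      using that by (intro add_mono mult_right_mono) auto
    finally have "norm (a *\<^sub>R k + b *\<^sub>R l) < d"
      using assms(4) by (simp add: algebra_simps)
    moreover have "x - (x + a *\<^sub>R k + b *\<^sub>R l) = - (a *\<^sub>R k + b *\<^sub>R l)"
      by simp
    ultimately show ?thesis
      by (simp only: mem_ball dist_norm norm_minus_cancel)
  qed
  define F where "F = (\<lambda>s. h (x + t *\<^sub>R l + s *\<^sub>R k) - h (x + s *\<^sub>R k))"
  have "(F has_real_derivative fd h (x + t *\<^sub>R l + s *\<^sub>R k) k - fd h (x + s *\<^sub>R k) k) (at s)"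
    if "0 \<le> s" "s \<le> t" for s
    unfolding F_def
    using S[of s 0] S[of s t] that assms(2,3)
    by (intro DERIV_diff has_real_derivative_along_line smooth_on_differentiable[OF assms(1)])
      (auto simp: algebra_simps)
  from MVT2[OF assms(3) this] obtain a where a: "0 < a" "a < t"
    "F t - F 0 = t * (fd h (x + t *\<^sub>R l + a *\<^sub>R k) k - fd h (x + a *\<^sub>R k) k)"
    by auto
  define E where "E = (\<lambda>s. fd h (x + a *\<^sub>R k + s *\<^sub>R l) k)"
  have "(E has_real_derivative fd (\<lambda>z. fd h z k) (x + a *\<^sub>R k + s *\<^sub>R l) l) (at s)"
    if "0 \<le> s" "s \<le> t" for s
    unfolding E_def
    using S[of a s] that a assms(2)
    by (intro has_real_derivative_along_line smooth_on_differentiable[OF smooth_on_fd[OF assms(1)]]) auto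
  from MVT2[OF assms(3) this] obtain b where b: "0 < b" "b < t"
    "E t - E 0 = t * fd (\<lambda>z. fd h z k) (x + a *\<^sub>R k + b *\<^sub>R l) l"
    by auto
  have "F t - F 0 = t * (E t - E 0)"
    using a(3) by (simp add: E_def add.assoc add.commute[of "t *\<^sub>R l"])
  then have "F t - F 0 = t\<^sup>2 * fd (\<lambda>z. fd h z k) (x + a *\<^sub>R k + b *\<^sub>R l) l"
    using b(3) by (simp add: power2_eq_square)
  moreover have "F t - F 0 = h (x + t *\<^sub>R k + t *\<^sub>R l) - h (x + t *\<^sub>R k) - h (x + t *\<^sub>R l) + h x"
    by (simp add: F_def algebra_simps)
  ultimately show ?thesis
    using S[of a b] a b by auto
qed

text \<open>The second difference is symmetric in \<open>k\<close> and \<open>l\<close>, so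
  arbitrarily close to \<open>x\<close> a value of one mixed derivative equals a value of the other;
  continuity carries this to \<open>x\<close>.\<close>

lemma symmetric_second_derivative_real:
  fixes h :: "'a::real_normed_vector \<Rightarrow> real"
  assumes "open S" "x \<in> S" "smooth_on h S"
  shows "fd (\<lambda>z. fd h z k) x l = fd (\<lambda>z. fd h z l) x k"
proof -
  let ?A = "\<lambda>z. fd (\<lambda>z. fd h z k) z l" and ?B = "\<lambda>z. fd (\<lambda>z. fd h z l) z k"
  have cont: "isCont ?A x" "isCont ?B x"
    using assms smooth_on_continuous[OF smooth_on_fd[OF smooth_on_fd[OF assms(3)]]]
    by (auto simp: continuous_on_eq_continuous_at)
  have "\<bar>?A x - ?B x\<bar> \<le> e" if e: "0 < e" for e
  proof -
    obtain d1 where d1: "0 < d1" "\<And>z. dist z x < d1 \<Longrightarrow> dist (?A z) (?A x) < e/2"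
      using cont(1)[unfolded continuous_at_eps_delta, rule_format, OF half_gt_zero[OF e]] by blast
    obtain d2 where d2: "0 < d2" "\<And>z. dist z x < d2 \<Longrightarrow> dist (?B z) (?B x) < e/2"
      using cont(2)[unfolded continuous_at_eps_delta, rule_format, OF half_gt_zero[OF e]] by blast
    obtain d3 where d3: "0 < d3" "ball x d3 \<subseteq> S"
      using assms(1,2) by (meson openE)
    define d where "d = min d1 (min d2 d3)"
    then have le: "d \<le> d1" "d \<le> d2" "d \<le> d3"
      by auto
    \<comment> \<open>Small enough that \<open>t * (norm k + norm l) < d\<close>; the summand 1
      keeps the denominator positive when both directions vanish.\<close>
    define t where "t = d / (2 * (norm k + norm l + 1))"
    have pos: "0 < norm k + norm l + 1"
      by (simp add: add_nonneg_pos)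
    have "0 < d"
      using d1(1) d2(1) d3(1) by (simp add: d_def)
    have d: "ball x d \<subseteq> S"
      using d3(2) subset_ball[OF le(3), of x] by simp
    have "0 < t"
      using pos \<open>0 < d\<close> by (simp add: t_def)
    have "norm k + norm l < 2 * (norm k + norm l + 1)"
      using pos by (simp add: distrib_left)
    then have "t * (norm k + norm l) < t * (2 * (norm k + norm l + 1))"
      using \<open>0 < t\<close> by (rule mult_strict_left_mono)
    also have "\<dots> = d"
      using pos by (simp add: t_def)
    finally have lt: "t * (norm k + norm l) < d" .
    obtain y where y: "y \<in> ball x d" "h (x + t *\<^sub>R k + t *\<^sub>R l) - h (x + t *\<^sub>R k) - h (x + t *\<^sub>R l) + h x = t\<^sup>2 * ?A y"
      using second_difference_mean_value[OF assms(3) d \<open>0 < t\<close> lt] by blast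
    obtain z where z: "z \<in> ball x d" "h (x + t *\<^sub>R l + t *\<^sub>R k) - h (x + t *\<^sub>R l) - h (x + t *\<^sub>R k) + h x = t\<^sup>2 * ?B z"
      using second_difference_mean_value[OF assms(3) d \<open>0 < t\<close>, of l k] lt by (auto simp: add.commute)
    have "h (x + t *\<^sub>R k + t *\<^sub>R l) = h (x + t *\<^sub>R l + t *\<^sub>R k)"
      by (simp add: add.assoc add.commute[of "t *\<^sub>R k"])
    then have "t\<^sup>2 * ?A y = t\<^sup>2 * ?B z"
      using y(2) z(2) by argo
    then have "?A y = ?B z"
      using \<open>0 < t\<close> by simp
    moreover have "dist (?A y) (?A x) < e/2" "dist (?B z) (?B x) < e/2"
      using d1(2)[of y] d2(2)[of z] y(1) z(1) le by (auto simp: dist_commute)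
    ultimately show ?thesis
      unfolding dist_real_def by linarith
  qed
  then show ?thesis
    using field_le_epsilon[of "\<bar>?A x - ?B x\<bar>" 0] by simp
qed

lemma fd_inner:
  "h differentiable (at x) \<Longrightarrow> fd (\<lambda>z. h z \<bullet> b) x v = fd h x v \<bullet> b"
  by (intro fd_eqI has_derivative_inner_left has_fd)

lemma symmetric_second_derivative:
  fixes h :: "'a::real_normed_vector \<Rightarrow> 'b::euclidean_space"
  assumes "open S" "x \<in> S" "smooth_on h S"
  shows "fd (\<lambda>z. fd h z k) x l = fd (\<lambda>z. fd h z l) x k"
proof (rule euclidean_eqI)
  fix b :: 'b
  have h: "smooth_on (\<lambda>z. h z \<bullet> b) S"
    using bounded_linear.smooth_on_linear[OF bounded_linear_inner_left] assms by blast
  have "fd (\<lambda>z. fd h z k) x l \<bullet> b = fd (\<lambda>z. fd (\<lambda>z. h z \<bullet> b) z k) x l" for k l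
  proof -
    have "fd (\<lambda>z. fd h z k) x l \<bullet> b = fd (\<lambda>z. fd h z k \<bullet> b) x l"
      using smooth_on_differentiable[OF smooth_on_fd[OF assms(3)] assms(2)] by (simp add: fd_inner)
    also have "\<dots> = fd (\<lambda>z. fd (\<lambda>z. h z \<bullet> b) z k) x l"
      by (subst frechet_derivative_cong_open[OF assms(1,2)])
        (auto simp: fd_inner smooth_on_differentiable[OF assms(3)])
    finally show ?thesis .
  qed
  then show "fd (\<lambda>z. fd h z k) x l \<bullet> b = fd (\<lambda>z. fd h z l) x k \<bullet> b"
    using symmetric_second_derivative_real[OF assms(1,2) h] by simp
qed

section \<open>Brackets of vector fields on Euclidean space\<close>

text \<open>The coordinate form of \<open>lie_bracket\<close>, so that bracket computations take
  place on open subsets of Euclidean spaces.\<close>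

definition vbracket :: "('a::real_normed_vector \<Rightarrow> 'a) \<Rightarrow> ('a \<Rightarrow> 'a) \<Rightarrow> 'a \<Rightarrow> 'a" where
  "vbracket X Y y = fd Y y (X y) - fd X y (Y y)"

lemma vbracket_swap: "vbracket Y X y = - vbracket X Y y"
  by (simp add: vbracket_def)

lemma has_derivative_fd_apply:
  fixes F :: "'a::euclidean_space \<Rightarrow> 'b::real_normed_vector"
  assumes "open S" "y \<in> S" "smooth_on F S" "X differentiable (at y)"
  shows "((\<lambda>z. fd F z (X z)) has_derivative
    (\<lambda>w. fd (\<lambda>z. fd F z (X y)) y w + fd F y (fd X y w))) (at y)"
  by (rule has_derivative_linear_family[where T="fd F" and X=X, OF assms(1,2) _ _ assms(4)])
    (auto intro: linear_frechet_derivative smooth_on_differentiable[OF smooth_on_fd[OF assms(3)] assms(2)]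
      smooth_on_differentiable[OF assms(3)])

lemma smooth_on_fd_apply:
  fixes F :: "'a::euclidean_space \<Rightarrow> 'b::real_normed_vector"
  assumes "open S" "smooth_on F S" "smooth_on X S"
  shows "smooth_on (\<lambda>z. fd F z (X z)) S"
  by (rule smooth_on_linear_family[where T="fd F" and X=X, OF assms(1) _ _ assms(3)])
    (auto intro: linear_frechet_derivative smooth_on_fd[OF assms(2)] smooth_on_differentiable[OF assms(2)])

lemma smooth_on_vbracket:
  fixes X :: "'a::euclidean_space \<Rightarrow> 'a"
  assumes "open S" "smooth_on X S" "smooth_on Y S"
  shows "smooth_on (vbracket X Y) S"
  unfolding vbracket_def[abs_def] using assms by (intro smooth_on_diff smooth_on_fd_apply)

text \<open>The iterated brackets expand into second derivatives, which cancel by symmetry, and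
  compositions of first derivatives, which cancel in pairs.\<close>

lemma vbracket_jacobi:
  fixes X :: "'a::euclidean_space \<Rightarrow> 'a"
  assumes "open S" "y \<in> S" "smooth_on X S" "smooth_on Y S" "smooth_on Z S"
  shows "vbracket (vbracket X Y) Z y + vbracket (vbracket Y Z) X y + vbracket (vbracket Z X) Y y = 0"
proof -
  have fd_vb: "fd (vbracket K L) y w = fd (\<lambda>z. fd L z (K y)) y w + fd L y (fd K y w)
      - (fd (\<lambda>z. fd K z (L y)) y w + fd K y (fd L y w))"
    if "smooth_on K S" "smooth_on L S" for K L w
    unfolding vbracket_def[abs_def]
    by (intro fd_eqI has_derivative_diff has_derivative_fd_apply[OF assms(1,2)] that
        smooth_on_differentiable[OF that(1) assms(2)] smooth_on_differentiable[OF that(2) assms(2)])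
  have lin: "fd K y (a - b) = fd K y a - fd K y b" if "smooth_on K S" for K a b
    by (rule linear_diff[OF linear_frechet_derivative[OF smooth_on_differentiable[OF that assms(2)]]])
  have sym: "fd (\<lambda>z. fd X z k) y l = fd (\<lambda>z. fd X z l) y k"
    "fd (\<lambda>z. fd Y z k) y l = fd (\<lambda>z. fd Y z l) y k"
    "fd (\<lambda>z. fd Z z k) y l = fd (\<lambda>z. fd Z z l) y k" for k l
    using symmetric_second_derivative[OF assms(1,2)] assms(3-5) by blast+
  show ?thesis
    unfolding vbracket_def[of "vbracket _ _"] fd_vb[OF assms(3,4)] fd_vb[OF assms(4,5)] fd_vb[OF assms(5,3)]
    unfolding vbracket_def lin[OF assms(3)] lin[OF assms(4)] lin[OF assms(5)]
    using sym(1)[of "Y y" "Z y"] sym(2)[of "X y" "Z y"] sym(3)[of "X y" "Y y"]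
    by (simp add: algebra_simps)
qed

text \<open>The product rule isolates the terms in which the fields are differentiated, and these
  form \<open>T\<close> of the bracket. The last parenthesis keeps the fields frozen: for a 1-form
  it is twice the exterior derivative, for \<open>T = fd f\<close> it vanishes by symmetry.\<close>

lemma linear_family_vbracket:
  fixes K :: "'a::euclidean_space \<Rightarrow> 'a" and T :: "'a \<Rightarrow> 'a \<Rightarrow> 'b::real_normed_vector"
  assumes "open S" "y \<in> S" "\<And>z. z \<in> S \<Longrightarrow> linear (T z)" "\<And>k. (\<lambda>z. T z k) differentiable (at y)"
    "K differentiable (at y)" "L differentiable (at y)"
  shows "T y (vbracket K L y) = fd (\<lambda>z. T z (L z)) y (K y) - fd (\<lambda>z. T z (K z)) y (L y)
    - (fd (\<lambda>z. T z (L y)) y (K y) - fd (\<lambda>z. T z (K y)) y (L y))"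
proof -
  have *: "fd (\<lambda>z. T z (X z)) y w = fd (\<lambda>z. T z (X y)) y w + T y (fd X y w)"
    if "X differentiable (at y)" for X w
    by (rule fd_eqI[OF has_derivative_linear_family[OF assms(1-4) that]])
  show ?thesis
    unfolding vbracket_def linear_diff[OF assms(3)[OF assms(2)]] *[OF assms(5)] *[OF assms(6)]
    by simp
qed

lemma vbracket_related:
  fixes f :: "'a::euclidean_space \<Rightarrow> 'b::euclidean_space"
  assumes "open S" "y \<in> S" "smooth_on f S" "K differentiable (at y)" "L differentiable (at y)"
    "K' differentiable (at (f y))" "L' differentiable (at (f y))"
    "\<And>z. z \<in> S \<Longrightarrow> fd f z (K z) = K' (f z)" "\<And>z. z \<in> S \<Longrightarrow> fd f z (L z) = L' (f z)"
  shows "fd f y (vbracket K L y) = vbracket K' L' (f y)"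
proof -
  have f: "f differentiable (at z)" if "z \<in> S" for z
    by (rule smooth_on_differentiable[OF assms(3) that])
  have *: "fd (\<lambda>z. fd f z (X z)) y w = fd X' (f y) (fd f y w)"
    if "X' differentiable (at (f y))" "\<And>z. z \<in> S \<Longrightarrow> fd f z (X z) = X' (f z)" for X X' w
  proof -
    have "fd (\<lambda>z. fd f z (X z)) y w = fd (\<lambda>z. X' (f z)) y w"
      using frechet_derivative_cong_open[OF assms(1,2) that(2)] by (rule fun_cong)
    also have "\<dots> = fd X' (f y) (fd f y w)"
      by (rule fd_eqI, rule has_derivative_compose[where f=f and g=X'])
        (rule has_fd[OF f[OF assms(2)]], rule has_fd[OF that(1)])
    finally show ?thesis .
  qed
  have "fd f y (vbracket K L y) = fd (\<lambda>z. fd f z (L z)) y (K y) - fd (\<lambda>z. fd f z (K z)) y (L y)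
    - (fd (\<lambda>z. fd f z (L y)) y (K y) - fd (\<lambda>z. fd f z (K y)) y (L y))"
    by (rule linear_family_vbracket[where T="fd f", OF assms(1,2) _ _ assms(4,5)])
      (auto intro: linear_frechet_derivative f smooth_on_differentiable[OF smooth_on_fd[OF assms(3)] assms(2)])
  also have "\<dots> = fd (\<lambda>z. fd f z (L z)) y (K y) - fd (\<lambda>z. fd f z (K z)) y (L y)"
    using symmetric_second_derivative[OF assms(1-3)] by simp
  also have "\<dots> = vbracket K' L' (f y)"
    using *[OF assms(6), of K] *[OF assms(7), of L] assms by (simp add: vbracket_def)
  finally show ?thesis .
qed

text \<open>The exterior derivative commutes with pullback because the extra term of the product
  rule, \<open>T\<close> applied to a second derivative of \<open>f\<close>, is symmetric in
  \<open>k\<close> and \<open>l\<close>.\<close>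

lemma pullback_form_antisymmetrized:
  fixes f :: "'a::euclidean_space \<Rightarrow> 'b::euclidean_space" and T :: "'b \<Rightarrow> 'b \<Rightarrow> real"
  assumes S: "open S" "y \<in> S" and R: "f ` S \<subseteq> R" and f: "smooth_on f S"
    and lin: "\<And>x. x \<in> R \<Longrightarrow> linear (T x)" and T: "\<And>e. smooth_on (\<lambda>x. T x e) R"
  shows "fd (\<lambda>z. T (f z) (fd f z l)) y k - fd (\<lambda>z. T (f z) (fd f z k)) y l
      = fd (\<lambda>x. T x (fd f y l)) (f y) (fd f y k) - fd (\<lambda>x. T x (fd f y k)) (f y) (fd f y l)"
proof -
  have R': "f z \<in> R" if "z \<in> S" for z
    using R that by auto
  have fy: "f differentiable (at y)"
    by (rule smooth_on_differentiable[OF f S(2)])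
  have Tf: "((\<lambda>z. T (f z) e) has_derivative (\<lambda>w. fd (\<lambda>x. T x e) (f y) (fd f y w))) (at y)" for e
    by (rule has_derivative_compose[where f=f and g="\<lambda>x. T x e", OF has_fd[OF fy]
          has_fd[OF smooth_on_differentiable[OF T R'[OF S(2)]]]])
  have *: "((\<lambda>z. T (f z) (fd f z l)) has_derivative
      (\<lambda>w. fd (\<lambda>z. T (f z) (fd f y l)) y w + T (f y) (fd (\<lambda>z. fd f z l) y w))) (at y)" for l
    by (rule has_derivative_linear_family[where T="\<lambda>z. T (f z)" and X="\<lambda>z. fd f z l", OF S])
      (auto intro: lin R' smooth_on_differentiable[OF smooth_on_fd[OF f] S(2)] Tf[THEN differentiableI])
  show "fd (\<lambda>z. T (f z) (fd f z l)) y k - fd (\<lambda>z. T (f z) (fd f z k)) y l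
      = fd (\<lambda>x. T x (fd f y l)) (f y) (fd f y k) - fd (\<lambda>x. T x (fd f y k)) (f y) (fd f y l)"
    unfolding fd_eqI[OF *] fd_eqI[OF Tf] symmetric_second_derivative[OF S f, of k l] by simp
qed

text \<open>The form \<open>\<alpha>\<close> is applied to the Jacobi identity. Both forms are kept
  abstract so that the lemma can be used again with their roles exchanged.\<close>

lemma vbracket_kernel:
  fixes X Y Z :: "'a::euclidean_space \<Rightarrow> 'a" and \<alpha> \<beta> :: "'a \<Rightarrow> 'a \<Rightarrow> real"
  assumes S: "open S"
    and lin: "\<And>z. z \<in> S \<Longrightarrow> linear (\<alpha> z)" "\<And>z. z \<in> S \<Longrightarrow> linear (\<beta> z)"
    and diff: "\<And>z k. z \<in> S \<Longrightarrow> (\<lambda>z. \<alpha> z k) differentiable (at z)"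
      "\<And>z k. z \<in> S \<Longrightarrow> (\<lambda>z. \<beta> z k) differentiable (at z)"
    and d\<alpha>: "\<And>z k l. z \<in> S \<Longrightarrow> fd (\<lambda>z. \<alpha> z l) z k - fd (\<lambda>z. \<alpha> z k) z l
      = 2 * \<Phi> z k l + s z k * \<beta> z l - s z l * \<beta> z k"
    and d\<beta>: "\<And>z k l. z \<in> S \<Longrightarrow> fd (\<lambda>z. \<beta> z l) z k - fd (\<lambda>z. \<beta> z k) z l
      = 2 * \<Psi> z k l - s z k * \<alpha> z l + s z l * \<alpha> z k"
    and skew: "\<And>z k l. z \<in> S \<Longrightarrow> \<Phi> z k l = - \<Phi> z l k"
    and smooth: "smooth_on X S" "smooth_on Y S" "smooth_on Z S"
    and \<alpha>: "\<And>z. z \<in> S \<Longrightarrow> \<alpha> z (X z) = a" "\<And>z. z \<in> S \<Longrightarrow> \<alpha> z (Y z) = b" "\<And>z. z \<in> S \<Longrightarrow> \<alpha> z (Z z) = 0"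
    and \<beta>: "\<And>z. z \<in> S \<Longrightarrow> \<beta> z (X z) = 0" "\<And>z. z \<in> S \<Longrightarrow> \<beta> z (Y z) = 0" "\<And>z. z \<in> S \<Longrightarrow> \<beta> z (Z z) = 0"
    and \<Phi>: "\<And>z k. z \<in> S \<Longrightarrow> \<Phi> z (X z) k = 0" "\<And>z k. z \<in> S \<Longrightarrow> \<Phi> z (Y z) k = 0"
    and \<Psi>: "\<And>z. z \<in> S \<Longrightarrow> \<Psi> z (X z) (Y z) = 0" "\<And>z. z \<in> S \<Longrightarrow> \<Psi> z (Y z) (Z z) = 0"
      "\<And>z. z \<in> S \<Longrightarrow> \<Psi> z (Z z) (X z) = 0"
    and y: "y \<in> S"
  shows "\<Phi> y (vbracket X Y y) (Z y) = 0"
proof -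
  have const: "fd (\<lambda>z. \<gamma> z (K z)) z w = 0" if "z \<in> S" "\<And>z. z \<in> S \<Longrightarrow> \<gamma> z (K z) = c"
    for \<gamma> :: "'a \<Rightarrow> 'a \<Rightarrow> real" and K c z w
    using frechet_derivative_cong_open[OF S that(1), of "\<lambda>z. \<gamma> z (K z)" "\<lambda>_. c"] that(2) by simp
  \<comment> \<open>When \<open>\<alpha>\<close> is constant on both fields, the derivatives of
    these values vanish and the structure equation alone determines \<open>\<alpha>\<close> on the
    bracket.\<close>
  have \<alpha>_br: "\<alpha> z (vbracket K L z) = - 2 * \<Phi> z (K z) (L z) - s z (K z) * \<beta> z (L z) + s z (L z) * \<beta> z (K z)"
    if "z \<in> S" "smooth_on K S" "smooth_on L S" "\<And>z. z \<in> S \<Longrightarrow> \<alpha> z (K z) = c" "\<And>z. z \<in> S \<Longrightarrow> \<alpha> z (L z) = d"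
    for K L z c d
    using const[where \<gamma>=\<alpha> and K=K, OF that(1,4)] const[where \<gamma>=\<alpha> and K=L, OF that(1,5)] d\<alpha>[OF that(1), of "L z" "K z"] linear_family_vbracket[of S z \<alpha> K L, OF S that(1) lin(1) diff(1)[OF that(1)]
        smooth_on_differentiable[OF that(2,1)] smooth_on_differentiable[OF that(3,1)]] by simp
  have \<beta>_br: "\<beta> z (vbracket K L z) = - 2 * \<Psi> z (K z) (L z) + s z (K z) * \<alpha> z (L z) - s z (L z) * \<alpha> z (K z)"
    if "z \<in> S" "smooth_on K S" "smooth_on L S" "\<And>z. z \<in> S \<Longrightarrow> \<beta> z (K z) = 0" "\<And>z. z \<in> S \<Longrightarrow> \<beta> z (L z) = 0"
    for K L z
    using const[where \<gamma>=\<beta> and K=K, OF that(1,4)] const[where \<gamma>=\<beta> and K=L, OF that(1,5)] d\<beta>[OF that(1), of "L z" "K z"] linear_family_vbracket[of S z \<beta> K L, OF S that(1) lin(2) diff(2)[OF that(1)]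
        smooth_on_differentiable[OF that(2,1)] smooth_on_differentiable[OF that(3,1)]] by simp
  have sm: "smooth_on (vbracket X Y) S" "smooth_on (vbracket Y Z) S" "smooth_on (vbracket Z X) S"
    using smooth_on_vbracket[OF S] smooth by blast+
  have \<Phi>0: "\<Phi> z k (X z) = 0" "\<Phi> z k (Y z) = 0" if "z \<in> S" for z k
    using skew[OF that, of k] \<Phi>[OF that] by simp_all
  \<comment> \<open>These values vanish on all of \<open>S\<close>, so they are constant and
    \<open>\<alpha>_br\<close> applies once more, to the iterated brackets.\<close>
  have br0: "\<alpha> z (vbracket X Y z) = 0" "\<alpha> z (vbracket Y Z z) = 0" "\<alpha> z (vbracket Z X z) = 0"
    if "z \<in> S" for z
    using \<alpha>_br[OF that smooth(1,2) \<alpha>(1,2)] \<alpha>_br[OF that smooth(2,3) \<alpha>(2,3)]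
      \<alpha>_br[OF that smooth(3,1) \<alpha>(3,1)] \<Phi>[OF that] \<Phi>0[OF that] \<beta>[OF that] by simp_all
  have br\<beta>: "\<beta> y (vbracket X Y y) = s y (X y) * b - s y (Y y) * a"
    "\<beta> y (vbracket Y Z y) = - s y (Z y) * b" "\<beta> y (vbracket Z X y) = s y (Z y) * a"
    using \<beta>_br[OF y smooth(1,2) \<beta>(1,2)] \<beta>_br[OF y smooth(2,3) \<beta>(2,3)]
      \<beta>_br[OF y smooth(3,1) \<beta>(3,1)] \<Psi>[OF y] \<alpha>[OF y] by simp_all
  \<comment> \<open>In the sum of the three values all products of two values of \<open>s\<close>
    cancel, which leaves \<open>- 2 * \<Phi> y (vbracket X Y y) (Z y)\<close>.\<close>
  have "\<alpha> y (vbracket (vbracket X Y) Z y) = - 2 * \<Phi> y (vbracket X Y y) (Z y) + s y (Z y) * (s y (X y) * b - s y (Y y) * a)"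
    "\<alpha> y (vbracket (vbracket Y Z) X y) = - (s y (X y) * s y (Z y) * b)"
    "\<alpha> y (vbracket (vbracket Z X) Y y) = s y (Y y) * s y (Z y) * a"
    using \<alpha>_br[OF y sm(1) smooth(3) br0(1) \<alpha>(3)] \<alpha>_br[OF y sm(2) smooth(1) br0(2) \<alpha>(1)]
      \<alpha>_br[OF y sm(3) smooth(2) br0(3) \<alpha>(2)] br\<beta> \<Phi>0[OF y] \<beta>[OF y] by simp_all
  moreover have "\<alpha> y (vbracket (vbracket X Y) Z y) + \<alpha> y (vbracket (vbracket Y Z) X y)
      + \<alpha> y (vbracket (vbracket Z X) Y y) = 0"
    using arg_cong[OF vbracket_jacobi[OF S y smooth], of "\<alpha> y"]
    by (simp add: linear_add[OF lin(1)[OF y]] linear_0[OF lin(1)[OF y]])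
  ultimately show ?thesis
    by (simp add: algebra_simps)
qed

section \<open>Leibniz rules for brackets\<close>

lemma vbracket_add_left:
  assumes "X differentiable (at y)" "X' differentiable (at y)" "Y differentiable (at y)"
  shows "vbracket (\<lambda>z. X z + X' z) Y y = vbracket X Y y + vbracket X' Y y"
  using assms
  by (simp add: vbracket_def fd_eqI[OF has_derivative_add[OF has_fd has_fd]]
      linear_add[OF linear_frechet_derivative])

lemma vbracket_scale_left:
  fixes a :: "'a::real_normed_vector \<Rightarrow> real"
  assumes "a differentiable (at y)" "X differentiable (at y)" "Y differentiable (at y)"
  shows "vbracket (\<lambda>z. a z *\<^sub>R X z) Y y = a y *\<^sub>R vbracket X Y y - fd a y (Y y) *\<^sub>R X y"
proof -
  have "fd (\<lambda>z. a z *\<^sub>R X z) y v = a y *\<^sub>R fd X y v + fd a y v *\<^sub>R X y" for v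
    using assms by (intro fd_eqI has_derivative_scaleR has_fd)
  then show ?thesis
    using assms
    by (simp add: vbracket_def linear_scale[OF linear_frechet_derivative] algebra_simps)
qed

lemma vbracket_cong_open:
  assumes "open S" "y \<in> S" "\<And>z. z \<in> S \<Longrightarrow> X z = X' z" "\<And>z. z \<in> S \<Longrightarrow> Y z = Y' z"
  shows "vbracket X Y y = vbracket X' Y' y"
  using frechet_derivative_cong_open[OF assms(1,2), of X X'] frechet_derivative_cong_open[OF assms(1,2), of Y Y']
    assms by (simp add: vbracket_def)

text \<open>Differentiating the coefficients contributes only multiples of \<open>E y\<close> and
  \<open>F y\<close>, which already lie in \<open>N\<close>.\<close>

lemma vbracket_combination_in_subspace:
  fixes a b :: "'a::real_normed_vector \<Rightarrow> real"
  assumes "subspace N" "vbracket X Y y \<in> N" "vbracket E Y y \<in> N" "vbracket F Y y \<in> N" "E y \<in> N" "F y \<in> N"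
    and diff: "a differentiable (at y)" "b differentiable (at y)" "X differentiable (at y)"
      "Y differentiable (at y)" "E differentiable (at y)" "F differentiable (at y)"
  shows "vbracket (\<lambda>z. X z + a z *\<^sub>R E z + b z *\<^sub>R F z) Y y \<in> N"
proof -
  have "(\<lambda>z. a z *\<^sub>R E z) differentiable (at y)" "(\<lambda>z. b z *\<^sub>R F z) differentiable (at y)"
    using diff by (auto intro: differentiable_scaleR)
  then have "vbracket (\<lambda>z. X z + a z *\<^sub>R E z + b z *\<^sub>R F z) Y y = vbracket X Y y
      + (a y *\<^sub>R vbracket E Y y - fd a y (Y y) *\<^sub>R E y)
      + (b y *\<^sub>R vbracket F Y y - fd b y (Y y) *\<^sub>R F y)"
    using diff by (simp add: vbracket_add_left vbracket_scale_left)
  then show ?thesis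
    using assms(1-6) by (simp add: subspace_add subspace_diff subspace_scale)
qed

text \<open>Cramer's rule exhibits the lift as a smooth function.\<close>

lemma smooth_lift:
  fixes f :: "complex^'k \<Rightarrow> complex^'n"
  assumes S: "open S" "y \<in> S" and f: "smooth_on f S"
    and holo: "\<And>z v. z \<in> S \<Longrightarrow> fd f z (\<i> *s v) = \<i> *s fd f z v"
    and inj: "\<And>z. z \<in> S \<Longrightarrow> inj (fd f z)"
    and X: "smooth_on X S" "\<And>z. z \<in> S \<Longrightarrow> X z \<in> range (fd f z)"
  obtains T Y where "open T" "y \<in> T" "T \<subseteq> S" "smooth_on Y T" "\<And>z. z \<in> T \<Longrightarrow> fd f z (Y z) = X z"
proof -
  \<comment> \<open>The complex Jacobian matrix: complex linearity makes the real differential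
    multiplication by it.\<close>
  define M :: "complex^'k \<Rightarrow> complex^'k^'n" where "M = (\<lambda>z. \<chi> i j. fd f z (axis j 1) $ i)"
  have fd_M: "fd f z v = M z *v v" if "z \<in> S" for z v
  proof -
    have lin: "linear (fd f z)"
      by (intro linear_frechet_derivative smooth_on_differentiable[OF f that])
    have cs: "c *s v = Re c *\<^sub>R v + Im c *\<^sub>R (\<i> *s v)" for c :: complex and v :: "complex^'x"
      by (simp add: vec_eq_iff complex_eq_iff)
    have scale: "fd f z (c *s v) = c *s fd f z v" for c v
      unfolding cs[of c] by (simp add: linear_add[OF lin] linear_scale[OF lin] holo[OF that])
    have "v = (\<Sum>j\<in>UNIV. v $ j *s axis j 1)"
      by (simp add: basis_expansion)
    then have "fd f z v = (\<Sum>j\<in>UNIV. v $ j *s fd f z (axis j 1))"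
      by (metis (no_types, lifting) linear_sum[OF lin] scale sum.cong)
    then show ?thesis
      by (simp add: vec_eq_iff M_def matrix_vector_mult_def mult.commute)
  qed
  have "inj ((*v) (M y))"
    using inj[OF S(2)] fd_M[OF S(2)] by (metis (no_types, lifting) ext)
  then obtain L where L: "L ** M y = mat 1"
    using matrix_left_invertible_injective by blast
  \<comment> \<open>The matrix \<open>M z\<close> need not be square. Multiplying by a left inverse
    of \<open>M y\<close> gives a square matrix that is the identity at \<open>y\<close> and hence
    invertible near \<open>y\<close>.\<close>
  define N where "N = (\<lambda>z. L ** M z)"
  have N_smooth: "smooth_on (\<lambda>z. N z $ i $ j) S" for i j
  proof -
    have "smooth_on (\<lambda>z. \<Sum>k\<in>UNIV. L $ i $ k * fd f z (axis j 1) $ k) S"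
      by (intro smooth_on_sum S bounded_linear.smooth_on_linear[OF bounded_linear_mult_right]
          bounded_linear.smooth_on_linear[OF bounded_linear_vec_nth] smooth_on_fd f)
    then show ?thesis
      by (simp add: N_def matrix_matrix_mult_def M_def)
  qed
  define T where "T = {z \<in> S. det (N z) \<noteq> 0}"
  have "open T"
  proof -
    have "continuous_on S (\<lambda>z. det (N z))"
      by (intro smooth_on_continuous smooth_on_det S N_smooth)
    then have "open (S \<inter> (\<lambda>z. det (N z)) -` (- {0}))"
      using S(1) by (intro continuous_open_preimage) auto
    moreover have "T = S \<inter> (\<lambda>z. det (N z)) -` (- {0})"
      by (auto simp: T_def)
    ultimately show ?thesis
      by simp
  qed
  have "y \<in> T"
    using S(2) L by (simp add: T_def N_def)
  have "T \<subseteq> S"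
    by (auto simp: T_def)
  define w where "w = (\<lambda>z. L *v X z)"
  have w_smooth: "smooth_on (\<lambda>z. w z $ i) S" for i
    unfolding w_def matrix_vector_mult_def vec_lambda_beta
    by (intro smooth_on_sum S bounded_linear.smooth_on_linear[OF bounded_linear_mult_right]
        bounded_linear.smooth_on_linear[OF bounded_linear_vec_nth] X)
  define Y :: "complex^'k \<Rightarrow> complex^'k" where
    "Y = (\<lambda>z. \<chi> k. det (\<chi> i j. if j = k then w z $ i else N z $ i $ j) / det (N z))"
  have "smooth_on Y T"
  proof (rule smooth_on_vec[OF \<open>open T\<close>])
    fix k
    have "smooth_on (\<lambda>z. (\<chi> i j. if j = k then w z $ i else N z $ i $ j) $ i $ j) T" for i j
      using smooth_on_subset[OF w_smooth \<open>T \<subseteq> S\<close>] smooth_on_subset[OF N_smooth \<open>T \<subseteq> S\<close>]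
      by (cases "j = k") simp_all
    then show "smooth_on (\<lambda>z. Y z $ k) T"
      unfolding Y_def vec_lambda_beta
      using smooth_on_subset[OF N_smooth \<open>T \<subseteq> S\<close>]
      by (intro smooth_on_divide smooth_on_det \<open>open T\<close>) (auto simp: T_def)
  qed
  moreover have "fd f z (Y z) = X z" if "z \<in> T" for z
  proof -
    have "z \<in> S" "det (N z) \<noteq> 0"
      using that by (auto simp: T_def)
    \<comment> \<open>The range hypothesis supplies a solution of the full system. It also solves
      the square system obtained through \<open>L\<close>, whose only solution is
      \<open>Y z\<close>.\<close>
    obtain v where v: "X z = M z *v v"
      using X(2)[OF \<open>z \<in> S\<close>] fd_M[OF \<open>z \<in> S\<close>] by auto
    then have "N z *v v = w z"
      by (simp add: N_def w_def matrix_vector_mul_assoc)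
    then have "v = Y z"
      using cramer[OF \<open>det (N z) \<noteq> 0\<close>] by (simp add: Y_def)
    then show ?thesis
      using v fd_M[OF \<open>z \<in> S\<close>] by simp
  qed
  ultimately show thesis
    using that \<open>open T\<close> \<open>y \<in> T\<close> \<open>T \<subseteq> S\<close> by blast
qed

section \<open>Charts\<close>

lemma chart_inv_left: "topological_chart c \<Longrightarrow> q \<in> fst c \<Longrightarrow> chart_inv c (snd c q) = q"
  by (auto simp: topological_chart_def homeomorphism_def)

lemma open_chart_image: "topological_chart c \<Longrightarrow> open W \<Longrightarrow> open (snd c ` (fst c \<inter> W))"
  unfolding topological_chart_def
  by (metis homeomorphism_imp_open_map openin_open_Int openin_open_eq)

text \<open>Inserting \<open>d\<close> and its inverse between \<open>F\<close> and
  \<open>\<phi>\<close> changes nothing near \<open>q\<close>, so the chain rule for the coordinate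
  expressions transfers. With the identity as \<open>\<phi>\<close> this is the change of
  charts.\<close>

lemma has_derivative_through_chart:
  fixes b :: "('s::topological_space, 'k::finite) chart" and d :: "('m::topological_space, 'n::finite) chart"
  assumes b: "topological_chart b" "q \<in> fst b" and d: "topological_chart d" "\<phi> q \<in> fst d"
    and \<phi>: "continuous_on UNIV \<phi>" "(snd d \<circ> \<phi> \<circ> chart_inv b) differentiable (at (snd b q))"
    and F: "(F \<circ> chart_inv d) differentiable (at (snd d (\<phi> q)))"
  shows "(F \<circ> \<phi> \<circ> chart_inv b has_derivative
    (\<lambda>v. fd (F \<circ> chart_inv d) (snd d (\<phi> q)) (fd (snd d \<circ> \<phi> \<circ> chart_inv b) (snd b q) v))) (at (snd b q))"
proof -
  let ?W = "snd b ` (fst b \<inter> \<phi> -` fst d)"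
  have eq: "(snd d \<circ> \<phi> \<circ> chart_inv b) (snd b q) = snd d (\<phi> q)"
    by (simp add: chart_inv_left[OF b])
  have "open (\<phi> -` fst d)"
    using d(1) \<phi>(1) by (simp add: open_vimage topological_chart_def)
  then have W: "open ?W"
    by (rule open_chart_image[OF b(1)])
  have "((\<lambda>x. (F \<circ> chart_inv d) ((snd d \<circ> \<phi> \<circ> chart_inv b) x)) has_derivative
    (\<lambda>v. fd (F \<circ> chart_inv d) (snd d (\<phi> q)) (fd (snd d \<circ> \<phi> \<circ> chart_inv b) (snd b q) v))) (at (snd b q))"
    by (rule has_derivative_compose[where f="snd d \<circ> \<phi> \<circ> chart_inv b" and g="F \<circ> chart_inv d", OF has_fd[OF \<phi>(2)]])
      (simp only: eq has_fd[OF F])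
  then show ?thesis
    by (rule has_derivative_transform_within_open[OF _ W])
      (use b d in \<open>auto simp: chart_inv_left[OF b(1)] chart_inv_left[OF d(1)]\<close>)
qed

lemma holomorphic_map_on_smooth: "open S \<Longrightarrow> holomorphic_map_on f S \<Longrightarrow> smooth_on f S"
  by (rule smooth_on_vec) (simp_all add: holomorphic_map_on_def holomorphic_fun_on_def)

lemma holomorphic_map_on_fd_complex:
  assumes "open S" "holomorphic_map_on f S" "x \<in> S"
  shows "fd f x (\<i> *s k) = \<i> *s fd f x k"
proof -
  have "fd (\<lambda>x. f x $ j) x v = fd f x v $ j" for j v
    by (rule fd_eqI, rule bounded_linear.has_derivative[OF bounded_linear_vec_nth])
      (rule smooth_on_has_fd[OF holomorphic_map_on_smooth[OF assms(1,2)] assms(3)])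
  moreover have "fd (\<lambda>x. f x $ j) x (\<i> *s k) = \<i> * fd (\<lambda>x. f x $ j) x k" for j
    using assms(2,3) by (simp add: holomorphic_map_on_def holomorphic_fun_on_def)
  ultimately show ?thesis
    by (simp add: vec_eq_iff)
qed

text \<open>Built on an atlas alone, so that the same chart calculus serves the ambient manifold and
  the submanifold.\<close>

locale complex_manifold =
  fixes A :: "('m::{second_countable_topology,t2_space}, 'n::finite) chart set"
  assumes complex_atlas: "complex_atlas A"
begin

section \<open>Tangent vectors and fields in charts\<close>

lemma chart_at: "chart_at A p \<in> A" "p \<in> fst (chart_at A p)"
proof -
  have "\<exists>c. c \<in> A \<and> p \<in> fst c"
    using complex_atlas UNIV_I[of p] unfolding complex_atlas_def by blast
  from someI_ex[OF this] show "chart_at A p \<in> A" "p \<in> fst (chart_at A p)"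
    by (simp_all add: chart_at_def)
qed

lemma topological_chart: "c \<in> A \<Longrightarrow> topological_chart c"
  using complex_atlas by (simp add: complex_atlas_def holomorphic_chart_def)

lemma open_chart: "c \<in> A \<Longrightarrow> open (fst c)"
  using topological_chart by (simp add: topological_chart_def)

lemmas inv_left = chart_inv_left[OF topological_chart]
lemmas open_image = open_chart_image[OF topological_chart]

lemma transition:
  assumes "c \<in> A" "d \<in> A"
  shows smooth_transition: "smooth_on (snd d \<circ> chart_inv c) (snd c ` (fst c \<inter> fst d))"
    and transition_complex: "q \<in> fst c \<Longrightarrow> q \<in> fst d \<Longrightarrow>
      fd (snd d \<circ> chart_inv c) (snd c q) (\<i> *s k) = \<i> *s fd (snd d \<circ> chart_inv c) (snd c q) k"
proof -
  have "holomorphically_compatible c d"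
    using assms complex_atlas by (simp add: complex_atlas_def holomorphic_chart_def)
  then have h: "holomorphic_map_on (snd d \<circ> chart_inv c) (snd c ` (fst c \<inter> fst d))"
    by (simp add: holomorphically_compatible_def)
  have o: "open (snd c ` (fst c \<inter> fst d))"
    using assms by (simp add: open_image open_chart)
  show "smooth_on (snd d \<circ> chart_inv c) (snd c ` (fst c \<inter> fst d))"
    by (rule holomorphic_map_on_smooth[OF o h])
  show "fd (snd d \<circ> chart_inv c) (snd c q) (\<i> *s k) = \<i> *s fd (snd d \<circ> chart_inv c) (snd c q) k"
    if "q \<in> fst c" "q \<in> fst d"
    using that by (intro holomorphic_map_on_fd_complex[OF o h]) auto
qed

lemma transition_differentiable:
  "c \<in> A \<Longrightarrow> d \<in> A \<Longrightarrow> q \<in> fst c \<Longrightarrow> q \<in> fst d \<Longrightarrow>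
    (snd d \<circ> chart_inv c) differentiable (at (snd c q))"
  by (rule smooth_on_differentiable[OF smooth_transition]) auto

lemma transition_linear:
  "c \<in> A \<Longrightarrow> d \<in> A \<Longrightarrow> q \<in> fst c \<Longrightarrow> q \<in> fst d \<Longrightarrow> linear (fd (snd d \<circ> chart_inv c) (snd c q))"
  by (rule linear_frechet_derivative[OF transition_differentiable])

lemma has_derivative_change_chart:
  assumes "c \<in> A" "d \<in> A" "q \<in> fst c" "q \<in> fst d" "(F \<circ> chart_inv d) differentiable (at (snd d q))"
  shows "(F \<circ> chart_inv c has_derivative
    (\<lambda>v. fd (F \<circ> chart_inv d) (snd d q) (fd (snd d \<circ> chart_inv c) (snd c q) v))) (at (snd c q))"
  using has_derivative_through_chart[of c q d id F] assms
  by (simp add: topological_chart transition_differentiable)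

lemma transition_self: "c \<in> A \<Longrightarrow> q \<in> fst c \<Longrightarrow> fd (snd c \<circ> chart_inv c) (snd c q) k = k"
proof -
  assume c: "c \<in> A" "q \<in> fst c"
  have "open (snd c ` fst c)"
    using topological_chart[OF c(1)] by (simp add: topological_chart_def)
  then have "fd (snd c \<circ> chart_inv c) (snd c q) = fd (\<lambda>x. x) (snd c q)"
    using c by (intro frechet_derivative_cong_open[of "snd c ` fst c"]) (auto simp: inv_left)
  then show ?thesis
    by simp
qed

lemma transition_trans:
  assumes "c \<in> A" "d \<in> A" "e \<in> A" "q \<in> fst c" "q \<in> fst d" "q \<in> fst e"
  shows "fd (snd e \<circ> chart_inv d) (snd d q) (fd (snd d \<circ> chart_inv c) (snd c q) k)
    = fd (snd e \<circ> chart_inv c) (snd c q) k"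
  using fd_eqI[OF has_derivative_change_chart[OF assms(1,2,4,5)
        transition_differentiable[OF assms(2,3,5,6)]]] by simp

lemma components_coord_field:
  "c \<in> A \<Longrightarrow> d \<in> A \<Longrightarrow> q \<in> fst c \<Longrightarrow> q \<in> fst d \<Longrightarrow>
    components A d q (coord_field A c e q) = fd (snd d \<circ> chart_inv c) (snd c q) e"
  unfolding components_def coord_field_def by (simp add: transition_trans chart_at)

lemma components_coord_field_same: "c \<in> A \<Longrightarrow> q \<in> fst c \<Longrightarrow> components A c q (coord_field A c e q) = e"
  by (simp add: components_coord_field transition_self)

lemma coord_field_components: "c \<in> A \<Longrightarrow> q \<in> fst c \<Longrightarrow> coord_field A c (components A c q k) q = k"
  unfolding components_def coord_field_def by (simp add: transition_trans transition_self chart_at)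

lemma components_chart_at: "components A (chart_at A q) q k = k"
  unfolding components_def by (simp add: transition_self chart_at)

lemma linear_components: "c \<in> A \<Longrightarrow> q \<in> fst c \<Longrightarrow> linear (components A c q)"
  unfolding components_def by (simp add: transition_linear chart_at)

lemma components_complex: "c \<in> A \<Longrightarrow> q \<in> fst c \<Longrightarrow> components A c q (\<i> *s k) = \<i> *s components A c q k"
  unfolding components_def by (simp add: transition_complex chart_at)

lemma linear_coord_field: "c \<in> A \<Longrightarrow> q \<in> fst c \<Longrightarrow> linear (\<lambda>e. coord_field A c e q)"
  unfolding coord_field_def by (simp add: transition_linear chart_at)

lemma coord_field_complex: "c \<in> A \<Longrightarrow> q \<in> fst c \<Longrightarrow> coord_field A c (\<i> *s k) q = \<i> *s coord_field A c k q"
  unfolding coord_field_def by (simp add: transition_complex chart_at)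

lemma field_in_chart_at:
  "c \<in> A \<Longrightarrow> q \<in> fst c \<Longrightarrow> field_in_chart A c X (snd c q) = components A c q (X q)"
  by (simp add: field_in_chart_def inv_left)

lemma field_in_chart_coord_field:
  assumes "a \<in> A" "c \<in> A" "x \<in> snd c ` (fst c \<inter> fst a)"
  shows "field_in_chart A c (coord_field A a e) x
    = fd (snd c \<circ> chart_inv a) ((snd a \<circ> chart_inv c) x) e"
  using assms by (auto simp: field_in_chart_at components_coord_field inv_left)

lemma transition_image:
  "c \<in> A \<Longrightarrow> (snd d \<circ> chart_inv c) ` snd c ` (fst c \<inter> fst d) \<subseteq> snd d ` (fst d \<inter> fst c)"
  by (auto simp: inv_left)

lemma smooth_field_in_chart_coord_field:
  assumes "a \<in> A" "c \<in> A"
  shows "smooth_on (field_in_chart A c (coord_field A a e)) (snd c ` (fst c \<inter> fst a))"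
proof -
  have o: "open (snd c ` (fst c \<inter> fst a))" "open (snd a ` (fst a \<inter> fst c))"
    using assms by (simp_all add: open_image open_chart)
  have "smooth_on (\<lambda>x. fd (snd c \<circ> chart_inv a) ((snd a \<circ> chart_inv c) x) e) (snd c ` (fst c \<inter> fst a))"
    by (rule smooth_on_compose[OF o transition_image[OF assms(2)] smooth_transition[OF assms(2,1)]
          smooth_on_fd[OF smooth_transition[OF assms]]])
  then show ?thesis
    by (subst smooth_on_cong[OF o(1) field_in_chart_coord_field[OF assms]])
qed

lemma smooth_field_coord_field:
  "a \<in> A \<Longrightarrow> W \<subseteq> fst a \<Longrightarrow> smooth_field A W (coord_field A a e)"
  unfolding smooth_field_def by (blast intro: smooth_on_subset[OF smooth_field_in_chart_coord_field])

section \<open>Brackets and exterior derivatives in coordinates\<close>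

lemma lie_bracket_eq:
  "lie_bracket A X Y p
    = vbracket (field_in_chart A (chart_at A p) X) (field_in_chart A (chart_at A p) Y) (snd (chart_at A p) p)"
  by (simp add: lie_bracket_def vbracket_def field_in_chart_at chart_at components_chart_at)

text \<open>The bracket is computed in the chosen chart at \<open>q\<close>, where the coordinate
  fields of \<open>a\<close> are directional derivatives of the chart change; its two terms are
  mixed second derivatives of that map.\<close>

lemma lie_bracket_coord_field:
  assumes a: "a \<in> A" "q \<in> fst a"
  shows "lie_bracket A (coord_field A a e) (coord_field A a e') q = 0"
proof -
  let ?c = "chart_at A q"
  let ?t = "snd ?c \<circ> chart_inv a"
  let ?R = "snd a ` (fst a \<inter> fst ?c)"
  note c = chart_at[of q]
  have R: "open ?R" "snd a q \<in> ?R"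
    using a c by (simp_all add: open_image open_chart)
  have *: "fd (field_in_chart A ?c (coord_field A a l)) (snd ?c q) (coord_field A a k q)
      = fd (\<lambda>y. fd ?t y l) (snd a q) k" for k l
  proof -
    have "fd (field_in_chart A ?c (coord_field A a l)) (snd ?c q)
      = fd (\<lambda>x. fd ?t ((snd a \<circ> chart_inv ?c) x) l) (snd ?c q)"
      using a c by (intro frechet_derivative_cong_open[of "snd ?c ` (fst ?c \<inter> fst a)"]
          field_in_chart_coord_field) (auto intro: open_image open_chart)
    moreover have "((\<lambda>x. fd ?t ((snd a \<circ> chart_inv ?c) x) l) has_derivative
        (\<lambda>v. fd (\<lambda>y. fd ?t y l) (snd a q) (fd (snd a \<circ> chart_inv ?c) (snd ?c q) v))) (at (snd ?c q))"
    proof (rule has_derivative_compose[where f="snd a \<circ> chart_inv ?c" and g="\<lambda>y. fd ?t y l"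
          and f'="fd (snd a \<circ> chart_inv ?c) (snd ?c q)" and g'="fd (\<lambda>y. fd ?t y l) (snd a q)"])
      show "(snd a \<circ> chart_inv ?c has_derivative fd (snd a \<circ> chart_inv ?c) (snd ?c q)) (at (snd ?c q))"
        using a c by (intro has_fd transition_differentiable)
      have "(snd a \<circ> chart_inv ?c) (snd ?c q) = snd a q"
        using c by (simp add: inv_left)
      then show "((\<lambda>y. fd ?t y l) has_derivative fd (\<lambda>y. fd ?t y l) (snd a q))
          (at ((snd a \<circ> chart_inv ?c) (snd ?c q)))"
        using smooth_on_has_fd[OF smooth_on_fd[OF smooth_transition[OF a(1) c(1)]] R(2)] by simp
    qed
    moreover have "fd (snd a \<circ> chart_inv ?c) (snd ?c q) (coord_field A a k q) = k"
      using a c by (simp add: coord_field_def transition_trans transition_self)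
    ultimately show ?thesis
      by (simp add: fd_eqI)
  qed
  show ?thesis
    unfolding lie_bracket_def *
    using symmetric_second_derivative[OF R smooth_transition[OF a(1) c(1)]] by simp
qed

lemma field_derivative_eq:
  assumes "a \<in> A" "q \<in> fst a" "(F \<circ> chart_inv a) differentiable (at (snd a q))"
  shows "field_derivative A X F q = fd (F \<circ> chart_inv a) (snd a q) (components A a q (X q))"
  unfolding field_derivative_def components_def
  using assms by (intro fd_eqI has_derivative_change_chart chart_at)

lemma field_derivative_cong:
  assumes "open W" "q \<in> W" "\<And>p. p \<in> W \<Longrightarrow> F p = F' p"
  shows "field_derivative A X F q = field_derivative A X F' q"
proof -
  let ?c = "chart_at A q"
  have "fd (F \<circ> chart_inv ?c) (snd ?c q) = fd (F' \<circ> chart_inv ?c) (snd ?c q)"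
    using assms chart_at[of q]
    by (intro frechet_derivative_cong_open[of "snd ?c ` (fst ?c \<inter> W)"]) (auto simp: inv_left intro: open_image)
  then show ?thesis
    by (simp add: field_derivative_def)
qed

lemma field_derivative_const:
  assumes "open W" "q \<in> W" "\<And>p. p \<in> W \<Longrightarrow> F p = c"
  shows "field_derivative A X F q = 0"
  using field_derivative_cong[OF assms] by (simp add: field_derivative_def o_def)

text \<open>Coordinate fields commute, so only the antisymmetrized derivatives of the coefficients
  remain; the factor 2 undoes the convention in \<open>ext_deriv\<close>.\<close>

lemma ext_deriv_coord_field:
  fixes \<alpha> :: "'m \<Rightarrow> complex^'n \<Rightarrow> real"
  assumes "a \<in> A" "q \<in> fst a \<inter> W" "smooth_form A W \<alpha>"
  defines "T \<equiv> \<lambda>x e. \<alpha> (chart_inv a x) (coord_field A a e (chart_inv a x))"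
  shows "2 * ext_deriv A \<alpha> (coord_field A a k) (coord_field A a l) q
    = fd (\<lambda>x. T x l) (snd a q) k - fd (\<lambda>x. T x k) (snd a q) l"
proof -
  have *: "(\<lambda>p. \<alpha> p (coord_field A a e p)) \<circ> chart_inv a = (\<lambda>x. T x e)" for e
    by (auto simp: T_def)
  have "smooth_on (\<lambda>x. T x e) (snd a ` (fst a \<inter> (fst a \<inter> W)))" for e
    using assms(1,3) unfolding smooth_form_def smooth_function_def *[symmetric] by blast
  then have "(\<lambda>x. T x e) differentiable (at (snd a q))" for e
    using assms(2) by (auto intro: smooth_on_differentiable)
  then have "field_derivative A X (\<lambda>p. \<alpha> p (coord_field A a e p)) q
      = fd (\<lambda>x. T x e) (snd a q) (components A a q (X q))" for X e
    using field_derivative_eq[of a q "\<lambda>p. \<alpha> p (coord_field A a e p)"] assms(1,2) by (simp add: *)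
  moreover have "\<alpha> q 0 = 0"
    using assms(2,3) by (auto simp: smooth_form_def linear_0)
  ultimately show ?thesis
    using assms(1,2) by (simp add: ext_deriv_def lie_bracket_coord_field components_coord_field_same)
qed

end

section \<open>Contact metric geometry\<close>

sublocale complex_contact_manifold \<subseteq> complex_manifold A
  by (unfold_locales) (rule atlas)

context complex_contact_metric_manifold
begin

section \<open>Algebra of the structure tensors\<close>

lemma open_neighborhood: "open (\<U> i)"
  using neighborhood[of i] by (auto simp: coordinate_neighborhood_def holomorphic_chart_def topological_chart_def)

lemma bilinear_g: "bilinear (g p)"
  using metric by (simp add: hermitian_metric_def)

lemma g_sym: "g p k l = g p l k"
  using metric by (simp add: hermitian_metric_def)

lemma g_pos: "k \<noteq> 0 \<Longrightarrow> 0 < g p k k"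
  using metric by (simp add: hermitian_metric_def)

lemma g_i: "g p (\<i> *s k) (\<i> *s l) = g p k l"
  using metric by (simp add: hermitian_metric_def)

lemmas g_simps = bilinear_ladd[OF bilinear_g] bilinear_radd[OF bilinear_g]
  bilinear_lsub[OF bilinear_g] bilinear_rsub[OF bilinear_g]
  bilinear_lneg[OF bilinear_g] bilinear_rneg[OF bilinear_g]
  bilinear_lmul[OF bilinear_g] bilinear_rmul[OF bilinear_g]
  bilinear_lzero[OF bilinear_g] bilinear_rzero[OF bilinear_g]

lemma i_i: "\<i> *s (\<i> *s k) = - k" for k :: "complex^'x"
  by (simp add: vec_eq_iff)

lemma linear_i: "linear (\<lambda>k :: complex^'x. \<i> *s k)"
  by (rule linearI) (simp_all add: vec_eq_iff algebra_simps)

context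
  fixes i p
  assumes p: "p \<in> \<U> i"
begin

lemma linear_u: "linear (u i p)"
  using smooth_u[of i] p by (simp add: smooth_form_def)

lemma linear_G: "linear (G i p)"
  using smooth_G[of i] p by (simp add: smooth_endomorphism_def)

lemma linear_v: "linear (v i p)"
  using linear_compose[OF linear_i linear_u] by (simp add: o_def ext[of "v i p", OF v_eq[OF p]])

lemma u_U: "u i p (U i p) = 1"
  by (simp add: u_dual[OF p] U_unit[OF p])

lemma v_V: "v i p (V i p) = 1"
  by (simp add: v_dual[OF p] V_unit[OF p])

text \<open>From \<open>v = u J\<close> and \<open>V = - J U\<close> follows
  \<open>v(U) = - u(V)\<close>, that is \<open>g(V, U) = - g(U, V)\<close>; symmetry of
  \<open>g\<close> forces both to vanish.\<close>

lemma g_U_V: "g p (U i p) (V i p) = 0"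
proof -
  have "v i p (U i p) = - u i p (V i p)"
    by (simp add: v_eq[OF p] V_eq[OF p] linear_neg[OF linear_u])
  then show ?thesis
    by (simp add: u_dual[OF p] v_dual[OF p] g_sym[of p "V i p"])
qed

lemma u_V: "u i p (V i p) = 0"
  by (simp add: u_dual[OF p] g_U_V)

lemma v_U: "v i p (U i p) = 0"
  by (simp add: v_dual[OF p] g_sym[of p "V i p"] g_U_V)

lemma G_V: "G i p (V i p) = 0"
  by (simp add: V_eq[OF p] linear_neg[OF linear_G] G_J[OF p] G_U[OF p])

lemma H_U: "H i p (U i p) = 0"
  by (simp add: H_eq[OF p] G_J[OF p] G_U[OF p])

lemma H_V: "H i p (V i p) = 0"
  using G_U[OF p] by (simp add: H_eq[OF p] V_eq[OF p] linear_neg[OF linear_i] i_i)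

text \<open>Skewness passes from \<open>G\<close> to \<open>H = G J\<close> because \<open>J\<close>
  is an isometry anticommuting with \<open>G\<close>.\<close>

lemma H_skew: "g p k (H i p l) = - g p (H i p k) l"
proof -
  have "g p k (H i p l) = - g p (G i p k) (\<i> *s l)"
    by (simp add: H_eq[OF p] G_skew[OF p])
  also have "\<dots> = - g p (\<i> *s G i p k) (\<i> *s (\<i> *s l))"
    by (simp only: g_i)
  also have "\<dots> = - g p (H i p k) l"
    by (simp add: H_eq[OF p] G_J[OF p] i_i g_simps)
  finally show ?thesis .
qed

lemma span_U_V: "k \<in> span {U i p, V i p} \<longleftrightarrow> k = u i p k *\<^sub>R U i p + v i p k *\<^sub>R V i p"
proof
  assume "k \<in> span {U i p, V i p}"
  then obtain a b where "k = a *\<^sub>R U i p + b *\<^sub>R V i p"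
    by (auto simp: span_insert algebra_simps)
  then show "k = u i p k *\<^sub>R U i p + v i p k *\<^sub>R V i p"
    by (simp add: linear_add[OF linear_u] linear_scale[OF linear_u] linear_add[OF linear_v]
        linear_scale[OF linear_v] u_U u_V v_U v_V)
next
  assume "k = u i p k *\<^sub>R U i p + v i p k *\<^sub>R V i p"
  then show "k \<in> span {U i p, V i p}"
    by (metis insertCI span_add span_base span_scale)
qed

end

text \<open>The overlap condition concerns the forms; nondegeneracy of \<open>g\<close> transfers it
  to their dual fields.\<close>

lemma span_U_V_overlap:
  assumes "p \<in> \<U> i" "p \<in> \<U> j"
  shows "span {U j p, V j p} \<subseteq> span {U i p, V i p}"
proof -
  obtain c d :: real where cd: "\<And>k. u j p k = c * u i p k - d * v i p k" "\<And>k. v j p k = d * u i p k + c * v i p k"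
    using overlap[of i j] assms by blast
  have nondeg: "k = l" if "\<And>x. g p k x = g p l x" for k l
  proof -
    have "g p (k - l) (k - l) = 0"
      using that by (simp add: g_simps)
    then show ?thesis
      using g_pos[of "k - l" p] by force
  qed
  have "U j p = c *\<^sub>R U i p - d *\<^sub>R V i p"
    using cd(1) assms by (intro nondeg) (simp add: u_dual v_dual g_simps)
  moreover have "V j p = d *\<^sub>R U i p + c *\<^sub>R V i p"
    using cd(2) assms by (intro nondeg) (simp add: u_dual v_dual g_simps)
  ultimately show ?thesis
    by (intro span_minimal) (auto intro!: span_add span_diff span_scale intro: span_base)
qed

text \<open>On the coordinate field of \<open>e\<close>, \<open>v\<close> equals \<open>u\<close> on
  the coordinate field of \<open>\<i> *s e\<close>, which again has constant components.\<close>

lemma smooth_form_v: "smooth_form A (\<U> i) (v i)"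
  unfolding smooth_form_def
proof (intro conjI ballI allI)
  fix c e assume c: "c \<in> A"
  have u: "smooth_function A (fst c \<inter> \<U> i) (\<lambda>p. u i p (coord_field A c (\<i> *s e) p))"
    using smooth_u[of i] c by (simp add: smooth_form_def)
  show "smooth_function A (fst c \<inter> \<U> i) (\<lambda>p. v i p (coord_field A c e p))"
    unfolding smooth_function_def
  proof
    fix d assume d: "d \<in> A"
    have "open (snd d ` (fst d \<inter> (fst c \<inter> \<U> i)))"
      using c d by (intro open_image open_Int open_chart open_neighborhood)
    then show "smooth_on ((\<lambda>p. v i p (coord_field A c e p)) \<circ> chart_inv d) (snd d ` (fst d \<inter> (fst c \<inter> \<U> i)))"
      using u d c unfolding smooth_function_def
      by (subst smooth_on_cong[where h="(\<lambda>p. u i p (coord_field A c (\<i> *s e) p)) \<circ> chart_inv d"])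
        (auto simp: inv_left v_eq coord_field_complex)
  qed
qed (rule linear_v)

lemma smooth_V: "smooth_field A (\<U> i) (V i)"
  unfolding smooth_field_def
proof
  fix c assume c: "c \<in> A"
  have o: "open (snd c ` (fst c \<inter> \<U> i))"
    using c by (intro open_image open_neighborhood)
  have "smooth_on (\<lambda>x. - (\<i> *s field_in_chart A c (U i) x)) (snd c ` (fst c \<inter> \<U> i))"
    using smooth_U[of i] c
    by (intro bounded_linear.smooth_on_linear[OF bounded_linear_minus[OF bounded_linear_ident]]
        bounded_linear.smooth_on_linear[OF linear_conv_bounded_linear[THEN iffD1, OF linear_i]] o)
      (auto simp: smooth_field_def)
  then show "smooth_on (field_in_chart A c (V i)) (snd c ` (fst c \<inter> \<U> i))"
    using c
    by (subst smooth_on_cong[OF o, where h="\<lambda>x. - (\<i> *s field_in_chart A c (U i) x)"])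
      (auto simp: field_in_chart_at V_eq linear_neg[OF linear_components] components_complex)
qed

section \<open>The Levi-Civita connection and the bracket of U and V\<close>

lemma smooth_field_subset: "smooth_field A W X \<Longrightarrow> W' \<subseteq> W \<Longrightarrow> smooth_field A W' X"
  unfolding smooth_field_def by (blast intro: smooth_on_subset)

lemma torsion_free:
  "open W \<Longrightarrow> smooth_field A W X \<Longrightarrow> smooth_field A W Y \<Longrightarrow> p \<in> W \<Longrightarrow>
    lie_bracket A X Y p = conn X Y p - conn Y X p"
  using levi_civita unfolding levi_civita_connection_def by metis

lemma metric_connection:
  "open W \<Longrightarrow> smooth_field A W X \<Longrightarrow> smooth_field A W Y \<Longrightarrow> smooth_field A W Z \<Longrightarrow> p \<in> W \<Longrightarrow>
    field_derivative A Z (\<lambda>q. g q (X q) (Y q)) p = g p (conn Z X p) (Y p) + g p (X p) (conn Z Y p)"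
  using levi_civita unfolding levi_civita_connection_def by metis

text \<open>Expanding \<open>du(V, Z)\<close> and \<open>dv(U, Z)\<close> with the metric connection, all terms but \<open>g(\<nabla>\<^sub>V U, Z)\<close> and
  \<open>g(\<nabla>\<^sub>U V, Z)\<close> cancel against \<open>\<sigma>(Z)\<close>.\<close>

lemma lie_bracket_U_V_orthogonal:
  assumes p: "p \<in> \<U> i" and z: "u i p z = 0" "v i p z = 0"
  shows "g p (lie_bracket A (U i) (V i) p) z = 0"
proof -
  let ?a = "chart_at A p"
  define W where "W = fst ?a \<inter> \<U> i"
  \<comment> \<open>A smooth extension of \<open>z\<close>. It is known to be horizontal only at
    \<open>p\<close>, so derivatives of \<open>u(Z)\<close> and \<open>v(Z)\<close> have to be
    kept.\<close>
  define Z where "Z = coord_field A ?a z"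
  have W: "open W" "p \<in> W" "W \<subseteq> \<U> i"
    using p chart_at[of p] by (auto simp: W_def open_chart open_neighborhood)
  have sm: "smooth_field A W (U i)" "smooth_field A W (V i)" "smooth_field A W Z"
    using smooth_field_subset[OF smooth_U] smooth_field_subset[OF smooth_V] W(3)
      smooth_field_coord_field[OF chart_at(1), of W p z]
    by (auto simp: W_def Z_def)
  have Zp: "Z p = z"
    using components_chart_at[of p "Z p"] components_coord_field_same[OF chart_at, of p z] by (simp add: Z_def)
  have u_Z: "field_derivative A X (\<lambda>q. u i q (Z q)) p = field_derivative A X (\<lambda>q. g q (U i q) (Z q)) p"
    and v_Z: "field_derivative A X (\<lambda>q. v i q (Z q)) p = field_derivative A X (\<lambda>q. g q (V i q) (Z q)) p" for X
    using W by (intro field_derivative_cong[OF W(1,2)]; auto simp: u_dual v_dual)+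
  \<comment> \<open>These functions vanish identically on \<open>W\<close>. Expanded by the metric
    connection, the third gives \<open>\<sigma>(Z) = - g(U, \<nabla>_Z V)\<close>.\<close>
  have "field_derivative A Z (\<lambda>q. u i q (V i q)) p = 0" "field_derivative A Z (\<lambda>q. v i q (U i q)) p = 0"
    "field_derivative A Z (\<lambda>q. g q (U i q) (V i q)) p = 0"
    using W(3) by (auto intro!: field_derivative_const[OF W(1,2)] simp: u_V v_U g_U_V)
  note zero = this(1,2) this(3)[unfolded metric_connection[OF W(1) sm(1,2,3) W(2)]]
  have "u i p (lie_bracket A (V i) Z p) = g p (U i p) (conn (V i) Z p) - g p (U i p) (conn Z (V i) p)"
    "v i p (lie_bracket A (U i) Z p) = g p (V i p) (conn (U i) Z p) - g p (V i p) (conn Z (U i) p)"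
    using torsion_free[OF W(1) sm(2,3) W(2)] torsion_free[OF W(1) sm(1,3) W(2)]
    by (simp_all add: u_dual[OF p] v_dual[OF p] g_simps)
  note br = this
  have "g p (conn (V i) (U i) p) z = 0"
  proof -
    have "2 * ext_deriv A (u i) (V i) Z p = g p (conn (V i) (U i) p) z + g p (U i p) (conn Z (V i) p)"
      unfolding ext_deriv_def u_Z metric_connection[OF W(1) sm(1,3,2) W(2)] zero br Zp by simp
    moreover have "2 * ext_deriv A (u i) (V i) Z p = - \<sigma> i Z p"
      unfolding du[OF W(1,3) sm(2,3) W(2)]
      using G_V[OF p] z by (simp add: Zp G_skew[OF p] g_simps wedge_one_def v_V[OF p])
    ultimately show ?thesis
      using zero(3) by (simp add: \<sigma>_eq)
  qed
  moreover have "g p (conn (U i) (V i) p) z = 0"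
  proof -
    have "2 * ext_deriv A (v i) (U i) Z p = g p (conn (U i) (V i) p) z + g p (V i p) (conn Z (U i) p)"
      unfolding ext_deriv_def v_Z metric_connection[OF W(1) sm(2,3,1) W(2)] zero br Zp by simp
    moreover have "2 * ext_deriv A (v i) (U i) Z p = \<sigma> i Z p"
      unfolding dv[OF W(1,3) sm(1,3) W(2)]
      using H_U[OF p] z by (simp add: Zp H_skew[OF p] g_simps wedge_one_def u_U[OF p])
    ultimately show ?thesis
      by (simp add: \<sigma>_eq g_sym[of p "V i p"])
  qed
  ultimately show ?thesis
    by (simp add: torsion_free[OF W(1) sm(1,2) W(2)] g_simps)
qed

text \<open>The structure equations for \<open>du\<close> and \<open>dv\<close> on fields with
  constant components in \<open>a\<close>: the form in which they can be pulled back along the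
  inclusion.\<close>

lemma du_in_chart:
  fixes \<alpha> :: "'m \<Rightarrow> complex^'n \<Rightarrow> real"
  assumes a: "a \<in> A" and q: "q \<in> fst a" "q \<in> \<U> i"
  shows "fd (\<lambda>x. u i (chart_inv a x) (coord_field A a l (chart_inv a x))) (snd a q) k
      - fd (\<lambda>x. u i (chart_inv a x) (coord_field A a k (chart_inv a x))) (snd a q) l
    = 2 * g q (coord_field A a k q) (G i q (coord_field A a l q))
      + \<sigma> i (coord_field A a k) q * v i q (coord_field A a l q)
      - \<sigma> i (coord_field A a l) q * v i q (coord_field A a k q)" (is ?u)
    and "fd (\<lambda>x. v i (chart_inv a x) (coord_field A a l (chart_inv a x))) (snd a q) k
      - fd (\<lambda>x. v i (chart_inv a x) (coord_field A a k (chart_inv a x))) (snd a q) l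
    = 2 * g q (coord_field A a k q) (H i q (coord_field A a l q))
      - \<sigma> i (coord_field A a k) q * u i q (coord_field A a l q)
      + \<sigma> i (coord_field A a l) q * u i q (coord_field A a k q)" (is ?v)
proof -
  have W: "open (fst a \<inter> \<U> i)" "fst a \<inter> \<U> i \<subseteq> \<U> i" "q \<in> fst a \<inter> \<U> i"
    using a q by (auto intro: open_chart open_neighborhood)
  have sm: "smooth_field A (fst a \<inter> \<U> i) (coord_field A a e)" for e
    using a by (intro smooth_field_coord_field) auto
  have q': "q \<in> fst a \<inter> \<U> i"
    using q by simp
  show ?u
    unfolding ext_deriv_coord_field[OF a q', OF smooth_u, symmetric]
      du[OF W(1,2) sm sm W(3)] by (simp add: wedge_one_def)
  show ?v
    unfolding ext_deriv_coord_field[OF a q', OF smooth_form_v, symmetric]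
      dv[OF W(1,2) sm sm W(3)] by (simp add: wedge_one_def field_simps)
qed

end

section \<open>Semi-invariant submanifolds\<close>

locale semi_invariant = complex_contact_metric_manifold A m \<U> \<omega> g u v U V G H conn \<sigma>
  for A :: "('m::{second_countable_topology,t2_space}, 'n::finite) chart set"
    and m :: nat
    and \<U> :: "'i \<Rightarrow> 'm set"
    and \<omega> :: "'i \<Rightarrow> 'm \<Rightarrow> complex^'n \<Rightarrow> complex"
    and g :: "'m \<Rightarrow> complex^'n \<Rightarrow> complex^'n \<Rightarrow> real"
    and u v :: "'i \<Rightarrow> 'm \<Rightarrow> complex^'n \<Rightarrow> real"
    and U V :: "'i \<Rightarrow> 'm \<Rightarrow> complex^'n"
    and G H :: "'i \<Rightarrow> 'm \<Rightarrow> complex^'n \<Rightarrow> complex^'n"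
    and conn :: "('m \<Rightarrow> complex^'n) \<Rightarrow> ('m \<Rightarrow> complex^'n) \<Rightarrow> 'm \<Rightarrow> complex^'n"
    and \<sigma> :: "'i \<Rightarrow> ('m \<Rightarrow> complex^'n) \<Rightarrow> 'm \<Rightarrow> real" +
  fixes B :: "('s::{second_countable_topology,t2_space}, 'k::finite) chart set"
    and \<iota> :: "'s \<Rightarrow> 'm"
    and D Dperp :: "'s \<Rightarrow> (complex^'k) set"
  assumes semi_invariant: "semi_invariant_submanifold A \<U> g U V G H B \<iota> D Dperp"

sublocale semi_invariant \<subseteq> M: complex_manifold B
  using semi_invariant
  by unfold_locales (simp add: semi_invariant_submanifold_def complex_submanifold_def)

context semi_invariant
begin

abbreviation T :: "'s \<Rightarrow> complex^'k \<Rightarrow> complex^'n" where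
  "T \<equiv> differential B A \<iota>"

section \<open>The inclusion in charts\<close>

lemma submanifold: "complex_submanifold A B \<iota>"
  using semi_invariant by (simp add: semi_invariant_submanifold_def)

lemma continuous_inclusion: "continuous_on UNIV \<iota>"
  using submanifold by (simp add: complex_submanifold_def)

lemma inj_T: "inj (T q)"
  using submanifold by (simp add: complex_submanifold_def)

lemma open_vimage_inclusion: "open W \<Longrightarrow> open (\<iota> -` W)"
  using continuous_inclusion by (simp add: open_vimage)

lemma inclusion_in_charts:
  assumes "a \<in> A" "b \<in> B"
  shows smooth_inclusion: "smooth_on (snd a \<circ> \<iota> \<circ> chart_inv b) (snd b ` (fst b \<inter> \<iota> -` fst a))"
    and inclusion_complex: "q \<in> fst b \<Longrightarrow> \<iota> q \<in> fst a \<Longrightarrow>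
      fd (snd a \<circ> \<iota> \<circ> chart_inv b) (snd b q) (\<i> *s k) = \<i> *s fd (snd a \<circ> \<iota> \<circ> chart_inv b) (snd b q) k"
proof -
  have h: "holomorphic_map_on (snd a \<circ> \<iota> \<circ> chart_inv b) (snd b ` (fst b \<inter> \<iota> -` fst a))"
    using submanifold assms by (simp add: complex_submanifold_def)
  have o: "open (snd b ` (fst b \<inter> \<iota> -` fst a))"
    using assms by (intro M.open_image open_vimage_inclusion open_chart)
  show "smooth_on (snd a \<circ> \<iota> \<circ> chart_inv b) (snd b ` (fst b \<inter> \<iota> -` fst a))"
    by (rule holomorphic_map_on_smooth[OF o h])
  show "fd (snd a \<circ> \<iota> \<circ> chart_inv b) (snd b q) (\<i> *s k) = \<i> *s fd (snd a \<circ> \<iota> \<circ> chart_inv b) (snd b q) k"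
    if "q \<in> fst b" "\<iota> q \<in> fst a"
    using that by (intro holomorphic_map_on_fd_complex[OF o h]) auto
qed

lemma inclusion_differentiable:
  "a \<in> A \<Longrightarrow> b \<in> B \<Longrightarrow> q \<in> fst b \<Longrightarrow> \<iota> q \<in> fst a \<Longrightarrow>
    (snd a \<circ> \<iota> \<circ> chart_inv b) differentiable (at (snd b q))"
  by (rule smooth_on_differentiable[OF smooth_inclusion]) auto

lemma linear_T: "linear (T q)"
  unfolding differential_def
  by (intro linear_frechet_derivative inclusion_differentiable chart_at M.chart_at)

text \<open>\<open>T\<close> is defined through the chosen charts. The inclusion, read from the
  chosen chart at \<open>q\<close> into \<open>a\<close>, is differentiated in two ways, through the
  chosen chart at \<open>\<iota> q\<close> and through \<open>b\<close>; uniqueness of derivatives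
  equates the results.\<close>

lemma fd_inclusion_components:
  assumes a: "a \<in> A" "\<iota> q \<in> fst a" and b: "b \<in> B" "q \<in> fst b"
  shows "fd (snd a \<circ> \<iota> \<circ> chart_inv b) (snd b q) (components B b q x) = components A a (\<iota> q) (T q x)"
proof -
  let ?b = "chart_at B q" and ?a = "chart_at A (\<iota> q)"
  note b' = M.chart_at[of q] and a' = chart_at[of "\<iota> q"]
  have "(snd a \<circ> \<iota> \<circ> chart_inv ?b has_derivative (\<lambda>x. components A a (\<iota> q) (T q x))) (at (snd ?b q))"
    unfolding components_def differential_def
    using a a' b' by (intro has_derivative_through_chart topological_chart M.topological_chart
        continuous_inclusion inclusion_differentiable transition_differentiable)
  moreover have "(snd a \<circ> \<iota> \<circ> chart_inv ?b has_derivative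
      (\<lambda>x. fd (snd a \<circ> \<iota> \<circ> chart_inv b) (snd b q) (components B b q x))) (at (snd ?b q))"
    unfolding components_def
    using a b b' by (intro M.has_derivative_change_chart inclusion_differentiable)
  ultimately show ?thesis
    using has_derivative_unique by metis
qed

section \<open>Orthogonality relations of the distributions\<close>

lemma structure_spanI: "\<iota> q \<in> \<U> i \<Longrightarrow> T q x \<in> span {U i (\<iota> q), V i (\<iota> q)} \<Longrightarrow>
    x \<in> structure_span A \<U> U V B \<iota> q"
  by (auto simp: structure_span_def)

text \<open>The index in \<open>structure_span\<close> is existential; since the spans agree on
  overlaps, any index available at the point may be used.\<close>

lemma structure_spanD:
  "x \<in> structure_span A \<U> U V B \<iota> q \<Longrightarrow> \<iota> q \<in> \<U> i \<Longrightarrow>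
    T q x = u i (\<iota> q) (T q x) *\<^sub>R U i (\<iota> q) + v i (\<iota> q) (T q x) *\<^sub>R V i (\<iota> q)"
  using span_U_V_overlap by (subst span_U_V[symmetric]) (auto simp: structure_span_def)

lemma smooth_D: "smooth_distribution B D"
  using semi_invariant by (simp add: semi_invariant_submanifold_def)

lemma tangent_decomposition:
  obtains x y w where "k = x + (y + w)" "x \<in> D q" "y \<in> Dperp q" "w \<in> structure_span A \<U> U V B \<iota> q"
proof -
  have "k \<in> sum_distribution D (sum_distribution Dperp (structure_span A \<U> U V B \<iota>)) q"
    using semi_invariant by (simp add: semi_invariant_submanifold_def)
  then show ?thesis
    unfolding sum_distribution_def using that by blast
qed

lemma D_orthogonal_Dperp: "x \<in> D q \<Longrightarrow> y \<in> Dperp q \<Longrightarrow> g (\<iota> q) (T q x) (T q y) = 0"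
  and D_orthogonal_span: "x \<in> D q \<Longrightarrow> w \<in> structure_span A \<U> U V B \<iota> q \<Longrightarrow> g (\<iota> q) (T q x) (T q w) = 0"
  and Dperp_orthogonal_span:
    "y \<in> Dperp q \<Longrightarrow> w \<in> structure_span A \<U> U V B \<iota> q \<Longrightarrow> g (\<iota> q) (T q y) (T q w) = 0"
  using semi_invariant by (auto simp: semi_invariant_submanifold_def fibrewise_orthogonal_def)

context
  fixes q i
  assumes q: "\<iota> q \<in> \<U> i"
begin

lemma U_tangent: "U i (\<iota> q) \<in> range (T q)"
  and V_tangent: "V i (\<iota> q) \<in> range (T q)"
  using semi_invariant q by (simp_all add: semi_invariant_submanifold_def)

lemma structure_fields_tangent:
  obtains x y where "T q x = U i (\<iota> q)" "T q y = V i (\<iota> q)"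
    "x \<in> structure_span A \<U> U V B \<iota> q" "y \<in> structure_span A \<U> U V B \<iota> q"
proof -
  obtain x y where xy: "T q x = U i (\<iota> q)" "T q y = V i (\<iota> q)"
    using U_tangent V_tangent by (metis rangeE)
  then show thesis
    using that[OF xy] structure_spanI[OF q] by (simp add: span_base)
qed

text \<open>\<open>u\<close> and \<open>v\<close> are inner products with \<open>U\<close> and
  \<open>V\<close>. These are tangent, hence images of vectors of the structure span, to which both
  distributions are orthogonal.\<close>

lemma u_D: "x \<in> D q \<Longrightarrow> u i (\<iota> q) (T q x) = 0"
  and v_D: "x \<in> D q \<Longrightarrow> v i (\<iota> q) (T q x) = 0"
  and u_Dperp: "x \<in> Dperp q \<Longrightarrow> u i (\<iota> q) (T q x) = 0"
  and v_Dperp: "x \<in> Dperp q \<Longrightarrow> v i (\<iota> q) (T q x) = 0"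
proof -
  obtain w w' where w: "T q w = U i (\<iota> q)" "T q w' = V i (\<iota> q)"
    "w \<in> structure_span A \<U> U V B \<iota> q" "w' \<in> structure_span A \<U> U V B \<iota> q"
    by (rule structure_fields_tangent)
  have *: "u i (\<iota> q) (T q x) = g (\<iota> q) (T q x) (T q w)" "v i (\<iota> q) (T q x) = g (\<iota> q) (T q x) (T q w')"
    by (simp_all add: u_dual[OF q] v_dual[OF q] w(1,2) g_sym)
  show "x \<in> D q \<Longrightarrow> u i (\<iota> q) (T q x) = 0" "x \<in> D q \<Longrightarrow> v i (\<iota> q) (T q x) = 0"
    "x \<in> Dperp q \<Longrightarrow> u i (\<iota> q) (T q x) = 0" "x \<in> Dperp q \<Longrightarrow> v i (\<iota> q) (T q x) = 0"
    using w(3,4) by (simp_all add: * D_orthogonal_span Dperp_orthogonal_span)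
qed

text \<open>\<open>G\<close> and \<open>H\<close> make vectors of \<open>Dperp\<close> normal, and
  skewness moves them to the other argument. So \<open>Dperp\<close> lies in the kernel of both
  pulled-back bilinear forms.\<close>

lemma G_Dperp: "x \<in> Dperp q \<Longrightarrow> g (\<iota> q) (T q x) (G i (\<iota> q) (T q y)) = 0"
  and H_Dperp: "x \<in> Dperp q \<Longrightarrow> g (\<iota> q) (T q x) (H i (\<iota> q) (T q y)) = 0"
proof -
  assume "x \<in> Dperp q"
  then have "G i (\<iota> q) (T q x) \<in> normal_space A g B \<iota> q" "H i (\<iota> q) (T q x) \<in> normal_space A g B \<iota> q"
    using semi_invariant q by (simp_all add: semi_invariant_submanifold_def image_subset_iff)
  then show "g (\<iota> q) (T q x) (G i (\<iota> q) (T q y)) = 0" "g (\<iota> q) (T q x) (H i (\<iota> q) (T q y)) = 0"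
    by (simp_all add: normal_space_def G_skew[OF q] H_skew[OF q])
qed

lemma D_image: "G i (\<iota> q) ` T q ` D q = T q ` D q" "H i (\<iota> q) ` T q ` D q = T q ` D q"
  using semi_invariant q by (simp_all add: semi_invariant_submanifold_def)

end

text \<open>The \<open>D\<close>-component of such a vector is orthogonal to itself, hence zero.
  Involutivity thereby becomes a question of orthogonality to \<open>D\<close>.\<close>

lemma orthogonal_D_imp:
  assumes "\<And>x. x \<in> D q \<Longrightarrow> g (\<iota> q) (T q k) (T q x) = 0"
  shows "k \<in> sum_distribution Dperp (structure_span A \<U> U V B \<iota>) q"
proof -
  obtain x y w where k: "k = x + (y + w)" "x \<in> D q" "y \<in> Dperp q" "w \<in> structure_span A \<U> U V B \<iota> q"
    by (rule tangent_decomposition)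
  have "g (\<iota> q) (T q x) (T q x) = g (\<iota> q) (T q k) (T q x)"
    using D_orthogonal_Dperp[OF k(2,3)] D_orthogonal_span[OF k(2,4)]
    by (simp add: k(1) linear_add[OF linear_T] g_simps g_sym[of _ "T q y"] g_sym[of _ "T q w"])
  then have "T q x = 0"
    using assms[OF k(2)] g_pos[of "T q x" "\<iota> q"] by force
  then have "x = 0"
    using inj_T[of q] linear_injective_0[OF linear_T] by blast
  then show ?thesis
    using k by (auto simp: sum_distribution_def)
qed

end

text \<open>With one chart of each manifold and one index fixed, the geometry becomes calculus on
  the open set \<open>chart_dom\<close>.\<close>

locale semi_invariant_charts = semi_invariant A m \<U> \<omega> g u v U V G H conn \<sigma> B \<iota> D Dperp
  for A :: "('m::{second_countable_topology,t2_space}, 'n::finite) chart set"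
    and m :: nat
    and \<U> :: "'i \<Rightarrow> 'm set"
    and \<omega> :: "'i \<Rightarrow> 'm \<Rightarrow> complex^'n \<Rightarrow> complex"
    and g :: "'m \<Rightarrow> complex^'n \<Rightarrow> complex^'n \<Rightarrow> real"
    and u v :: "'i \<Rightarrow> 'm \<Rightarrow> complex^'n \<Rightarrow> real"
    and U V :: "'i \<Rightarrow> 'm \<Rightarrow> complex^'n"
    and G H :: "'i \<Rightarrow> 'm \<Rightarrow> complex^'n \<Rightarrow> complex^'n"
    and conn :: "('m \<Rightarrow> complex^'n) \<Rightarrow> ('m \<Rightarrow> complex^'n) \<Rightarrow> 'm \<Rightarrow> complex^'n"
    and \<sigma> :: "'i \<Rightarrow> ('m \<Rightarrow> complex^'n) \<Rightarrow> 'm \<Rightarrow> real"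
    and B :: "('s::{second_countable_topology,t2_space}, 'k::finite) chart set"
    and \<iota> :: "'s \<Rightarrow> 'm"
    and D Dperp :: "'s \<Rightarrow> (complex^'k) set" +
  fixes a :: "('m, 'n) chart" and b :: "('s, 'k) chart" and i :: 'i
  assumes a: "a \<in> A" and b: "b \<in> B"
begin

section \<open>The structure forms pulled back to a chart\<close>

definition incl :: "complex^'k \<Rightarrow> complex^'n" where
  "incl = snd a \<circ> \<iota> \<circ> chart_inv b"

definition chart_dom :: "(complex^'k) set" where
  "chart_dom = snd b ` (fst b \<inter> \<iota> -` (fst a \<inter> \<U> i))"

text \<open>The vector with components \<open>k\<close> is pushed forward by the differential of
  \<open>incl\<close> and realised by a coordinate field of \<open>a\<close>. Thus the pullbacks
  here and below are coefficients in the chart \<open>a\<close> composed with \<open>incl\<close>,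
  as \<open>pullback_form_antisymmetrized\<close> expects.\<close>

definition \<alpha> :: "complex^'k \<Rightarrow> complex^'k \<Rightarrow> real" where
  "\<alpha> z k = u i (chart_inv a (incl z)) (coord_field A a (fd incl z k) (chart_inv a (incl z)))"

definition \<beta> :: "complex^'k \<Rightarrow> complex^'k \<Rightarrow> real" where
  "\<beta> z k = v i (chart_inv a (incl z)) (coord_field A a (fd incl z k) (chart_inv a (incl z)))"

definition \<Phi> :: "complex^'k \<Rightarrow> complex^'k \<Rightarrow> complex^'k \<Rightarrow> real" where
  "\<Phi> z k l = g (chart_inv a (incl z)) (coord_field A a (fd incl z k) (chart_inv a (incl z)))
    (G i (chart_inv a (incl z)) (coord_field A a (fd incl z l) (chart_inv a (incl z))))"

definition \<Psi> :: "complex^'k \<Rightarrow> complex^'k \<Rightarrow> complex^'k \<Rightarrow> real" where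
  "\<Psi> z k l = g (chart_inv a (incl z)) (coord_field A a (fd incl z k) (chart_inv a (incl z)))
    (H i (chart_inv a (incl z)) (coord_field A a (fd incl z l) (chart_inv a (incl z))))"

text \<open>The pullback of \<open>\<sigma>\<close>. Since \<open>\<sigma>\<close> takes a field,
  the pushed-forward vector is extended with constant components in \<open>a\<close>, exactly as in
  \<open>du_in_chart\<close>.\<close>

definition \<rho> :: "complex^'k \<Rightarrow> complex^'k \<Rightarrow> real" where
  "\<rho> z k = \<sigma> i (coord_field A a (fd incl z k)) (chart_inv a (incl z))"

lemma open_chart_dom: "open chart_dom"
  unfolding chart_dom_def
  using a b by (intro M.open_image open_vimage_inclusion open_Int open_chart open_neighborhood)

lemma chart_dom_cases:
  assumes "z \<in> chart_dom"
  obtains q where "z = snd b q" "q \<in> fst b" "\<iota> q \<in> fst a" "\<iota> q \<in> \<U> i"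
  using assms by (auto simp: chart_dom_def)

lemma smooth_incl: "smooth_on incl chart_dom"
  unfolding incl_def chart_dom_def by (rule smooth_on_subset[OF smooth_inclusion[OF a b]]) auto

lemma incl_differentiable: "z \<in> chart_dom \<Longrightarrow> incl differentiable (at z)"
  by (rule smooth_on_differentiable[OF smooth_incl])

lemma linear_fd_incl: "z \<in> chart_dom \<Longrightarrow> linear (fd incl z)"
  by (rule linear_frechet_derivative[OF incl_differentiable])

context
  fixes q
  assumes q: "q \<in> fst b" "\<iota> q \<in> fst a" "\<iota> q \<in> \<U> i"
begin

lemma in_chart_dom: "snd b q \<in> chart_dom"
  using q by (auto simp: chart_dom_def)

lemma incl_eq: "incl (snd b q) = snd a (\<iota> q)"
  using q by (simp add: incl_def M.inv_left[OF b])

lemma fd_incl_components: "fd incl (snd b q) (components B b q x) = components A a (\<iota> q) (T q x)"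
  unfolding incl_def using a b q by (intro fd_inclusion_components)

lemma coord_field_fd_incl:
  "coord_field A a (fd incl (snd b q) (components B b q x)) (\<iota> q) = T q x"
  using a q by (simp add: fd_incl_components coord_field_components)

lemma \<alpha>_components: "\<alpha> (snd b q) (components B b q x) = u i (\<iota> q) (T q x)"
  and \<beta>_components: "\<beta> (snd b q) (components B b q x) = v i (\<iota> q) (T q x)"
  and \<Phi>_components: "\<Phi> (snd b q) (components B b q x) (components B b q y) = g (\<iota> q) (T q x) (G i (\<iota> q) (T q y))"
  and \<Psi>_components: "\<Psi> (snd b q) (components B b q x) (components B b q y) = g (\<iota> q) (T q x) (H i (\<iota> q) (T q y))"
  unfolding \<alpha>_def \<beta>_def \<Phi>_def \<Psi>_def incl_eq
  using q by (simp_all add: inv_left[OF a] coord_field_fd_incl)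

lemma components_surj: obtains x where "k = components B b q x"
  using M.components_coord_field_same[OF b q(1)] by metis

end

lemma linear_\<alpha>: "z \<in> chart_dom \<Longrightarrow> linear (\<alpha> z)"
  and linear_\<beta>: "z \<in> chart_dom \<Longrightarrow> linear (\<beta> z)"
proof -
  assume z: "z \<in> chart_dom"
  then obtain q where q: "z = snd b q" "q \<in> fst b" "\<iota> q \<in> fst a" "\<iota> q \<in> \<U> i"
    by (rule chart_dom_cases)
  have "linear (\<lambda>k. coord_field A a (fd incl z k) (\<iota> q))"
    using linear_compose[OF linear_fd_incl[OF z] linear_coord_field[OF a q(3)]] by (simp add: o_def)
  from linear_compose[OF this linear_u[OF q(4)]] linear_compose[OF this linear_v[OF q(4)]]
  show "linear (\<alpha> z)" "linear (\<beta> z)"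
    using q by (simp_all add: \<alpha>_def[abs_def] \<beta>_def[abs_def] o_def incl_eq inv_left[OF a])
qed

lemma skew: "z \<in> chart_dom \<Longrightarrow> \<Phi> z k l = - \<Phi> z l k" "z \<in> chart_dom \<Longrightarrow> \<Psi> z k l = - \<Psi> z l k"
  by (erule chart_dom_cases, simp add: \<Phi>_def \<Psi>_def incl_eq inv_left[OF a] G_skew H_skew g_sym[of _ _ "coord_field A a (fd incl _ k) _"])+

text \<open>Serves \<open>u\<close> and \<open>v\<close> alike: \<open>\<tau>\<close> collects the
  coefficients of the form in \<open>a\<close>, and the pullback is \<open>\<tau>\<close> along
  \<open>incl\<close> applied to its differential.\<close>

lemma chart_form:
  assumes "smooth_form A (\<U> i) \<gamma>"
  defines "\<tau> \<equiv> \<lambda>x e. \<gamma> (chart_inv a x) (coord_field A a e (chart_inv a x))"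
  shows "z \<in> chart_dom \<Longrightarrow> fd (\<lambda>z. \<tau> (incl z) (fd incl z l)) z k - fd (\<lambda>z. \<tau> (incl z) (fd incl z k)) z l
      = fd (\<lambda>x. \<tau> x (fd incl z l)) (incl z) (fd incl z k) - fd (\<lambda>x. \<tau> x (fd incl z k)) (incl z) (fd incl z l)"
    and "smooth_on (\<lambda>z. \<tau> (incl z) (fd incl z l)) chart_dom"
proof -
  let ?R = "snd a ` (fst a \<inter> \<U> i)"
  have R: "incl ` chart_dom \<subseteq> ?R"
    by (auto elim!: chart_dom_cases simp: incl_eq)
  have sm: "smooth_on (\<lambda>x. \<tau> x e) ?R" for e
  proof -
    have "(\<lambda>p. \<gamma> p (coord_field A a e p)) \<circ> chart_inv a = (\<lambda>x. \<tau> x e)"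
      by (auto simp: \<tau>_def)
    moreover have "smooth_on ((\<lambda>p. \<gamma> p (coord_field A a e p)) \<circ> chart_inv a) (snd a ` (fst a \<inter> (fst a \<inter> \<U> i)))"
      using assms(1) a unfolding smooth_form_def smooth_function_def by blast
    ultimately show ?thesis
      by simp
  qed
  have lin: "linear (\<tau> x)" if x: "x \<in> ?R" for x
  proof -
    obtain p where p: "x = snd a p" "p \<in> fst a" "p \<in> \<U> i"
      using x by blast
    have "linear (\<gamma> p)"
      using assms(1) p by (simp add: smooth_form_def)
    from linear_compose[OF linear_coord_field[OF a p(2)] this] show ?thesis
      using p by (simp add: \<tau>_def o_def inv_left[OF a])
  qed
  show "fd (\<lambda>z. \<tau> (incl z) (fd incl z l)) z k - fd (\<lambda>z. \<tau> (incl z) (fd incl z k)) z l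
      = fd (\<lambda>x. \<tau> x (fd incl z l)) (incl z) (fd incl z k) - fd (\<lambda>x. \<tau> x (fd incl z k)) (incl z) (fd incl z l)" if "z \<in> chart_dom"
    by (rule pullback_form_antisymmetrized[where T=\<tau>, OF open_chart_dom that R smooth_incl lin sm])
  have "open ?R"
    using a by (intro open_image open_neighborhood)
  then have "smooth_on (\<lambda>z. \<tau> (incl z) e) chart_dom" for e
    by (rule smooth_on_compose[OF open_chart_dom _ R smooth_incl sm])
  then show "smooth_on (\<lambda>z. \<tau> (incl z) (fd incl z l)) chart_dom"
    using R lin
    by (intro smooth_on_linear_family[where T="\<lambda>z. \<tau> (incl z)" and X="\<lambda>z. fd incl z l", OF open_chart_dom])
      (auto intro: smooth_on_fd smooth_incl)
qed

lemma smooth_\<alpha>: "smooth_on (\<lambda>z. \<alpha> z k) chart_dom"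
  and smooth_\<beta>: "smooth_on (\<lambda>z. \<beta> z k) chart_dom"
  unfolding \<alpha>_def \<beta>_def by (rule chart_form(2)[OF smooth_u], rule chart_form(2)[OF smooth_form_v])

text \<open>Antisymmetrized derivatives commute with pullback, so the structure equations hold
  downstairs, in the form demanded by \<open>vbracket_kernel\<close>.\<close>

lemma d\<alpha>: "z \<in> chart_dom \<Longrightarrow> fd (\<lambda>z. \<alpha> z l) z k - fd (\<lambda>z. \<alpha> z k) z l
    = 2 * \<Phi> z k l + \<rho> z k * \<beta> z l - \<rho> z l * \<beta> z k"
  and d\<beta>: "z \<in> chart_dom \<Longrightarrow> fd (\<lambda>z. \<beta> z l) z k - fd (\<lambda>z. \<beta> z k) z l
    = 2 * \<Psi> z k l - \<rho> z k * \<alpha> z l + \<rho> z l * \<alpha> z k"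
proof -
  assume z: "z \<in> chart_dom"
  then obtain q where q: "z = snd b q" "q \<in> fst b" "\<iota> q \<in> fst a" "\<iota> q \<in> \<U> i"
    by (rule chart_dom_cases)
  have fz: "incl z = snd a (\<iota> q)" "chart_inv a (incl z) = \<iota> q"
    using q by (simp_all add: incl_eq inv_left[OF a])
  show "fd (\<lambda>z. \<alpha> z l) z k - fd (\<lambda>z. \<alpha> z k) z l = 2 * \<Phi> z k l + \<rho> z k * \<beta> z l - \<rho> z l * \<beta> z k"
    unfolding \<alpha>_def chart_form(1)[OF smooth_u z]
    unfolding fz(1) du_in_chart(1)[OF a q(3,4)] \<Phi>_def \<beta>_def \<rho>_def fz(2)[unfolded fz(1)] ..
  show "fd (\<lambda>z. \<beta> z l) z k - fd (\<lambda>z. \<beta> z k) z l = 2 * \<Psi> z k l - \<rho> z k * \<alpha> z l + \<rho> z l * \<alpha> z k"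
    unfolding \<beta>_def chart_form(1)[OF smooth_form_v z]
    unfolding fz(1) du_in_chart(2)[OF a q(3,4)] \<Psi>_def \<alpha>_def \<rho>_def fz(2)[unfolded fz(1)] ..
qed

section \<open>Fields adapted to the pulled-back forms\<close>

text \<open>The fields to which the Jacobi argument applies. The lift of \<open>U\<close> has the
  constants 1 and 0, that of \<open>V\<close> has 0 and 1, and sections of \<open>Dperp\<close> have
  0 and 0.\<close>

definition adapted :: "(complex^'k) set \<Rightarrow> (complex^'k \<Rightarrow> complex^'k) \<Rightarrow> real \<Rightarrow> real \<Rightarrow> bool" where
  "adapted S K c d \<longleftrightarrow> smooth_on K S \<and>
    (\<forall>z\<in>S. \<alpha> z (K z) = c \<and> \<beta> z (K z) = d \<and> (\<forall>l. \<Phi> z (K z) l = 0 \<and> \<Psi> z (K z) l = 0))"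

lemma adapted_bracket:
  assumes S: "open S" "S \<subseteq> chart_dom" "y \<in> S"
    and Z: "smooth_on Z S" "\<And>z. z \<in> S \<Longrightarrow> \<alpha> z (Z z) = 0 \<and> \<beta> z (Z z) = 0"
  shows "adapted S K c 0 \<Longrightarrow> adapted S L c' 0 \<Longrightarrow> \<Phi> y (vbracket K L y) (Z y) = 0"
    and "adapted S K 0 d \<Longrightarrow> adapted S L 0 d' \<Longrightarrow> \<Psi> y (vbracket K L y) (Z y) = 0"
proof -
  have chart_dom: "z \<in> chart_dom" if "z \<in> S" for z
    using S(2) that by auto
  have diff: "(\<lambda>z. \<alpha> z k) differentiable (at z)" "(\<lambda>z. \<beta> z k) differentiable (at z)" if "z \<in> S" for z k
    using smooth_on_differentiable[OF smooth_\<alpha> chart_dom[OF that]] smooth_on_differentiable[OF smooth_\<beta> chart_dom[OF that]] .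
  have skew0: "\<Phi> z k (K z) = 0 \<and> \<Psi> z k (K z) = 0" if "adapted S K c d" "z \<in> S" for K c d z k
    using that skew[OF chart_dom[OF that(2)], of k "K z"] by (auto simp: adapted_def)
  show "\<Phi> y (vbracket K L y) (Z y) = 0" if "adapted S K c 0" "adapted S L c' 0"
    using that skew0[OF that(1)] skew0[OF that(2)] Z
    by (intro vbracket_kernel[where S=S and \<alpha>=\<alpha> and \<beta>=\<beta> and \<Phi>=\<Phi> and \<Psi>=\<Psi> and s=\<rho> and a=c and b=c', OF S(1)]
        linear_\<alpha> linear_\<beta> diff d\<alpha> d\<beta> skew chart_dom S(3)) (auto simp: adapted_def)
  \<comment> \<open>The roles of the two forms are exchanged. As \<open>\<sigma>\<close> enters
    their structure equations with opposite signs, \<open>s\<close> becomes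
    \<open>- \<rho>\<close>.\<close>
  show "\<Psi> y (vbracket K L y) (Z y) = 0" if "adapted S K 0 d" "adapted S L 0 d'"
    using that skew0[OF that(1)] skew0[OF that(2)] Z
    by (intro vbracket_kernel[where S=S and \<alpha>=\<beta> and \<beta>=\<alpha> and \<Phi>=\<Psi> and \<Psi>=\<Phi> and s="\<lambda>z k. - \<rho> z k" and a=d and b=d', OF S(1)]
        linear_\<alpha> linear_\<beta> diff skew chart_dom S(3)) (auto simp: adapted_def d\<alpha>[OF chart_dom] d\<beta>[OF chart_dom])
qed

end

context semi_invariant_charts
begin

lemma inj_fd_incl:
  assumes "z \<in> chart_dom"
  shows "inj (fd incl z)"
proof -
  obtain q where q: "z = snd b q" "q \<in> fst b" "\<iota> q \<in> fst a" "\<iota> q \<in> \<U> i"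
    using assms by (rule chart_dom_cases)
  have *: "x = y" if eq: "fd incl z (components B b q x) = fd incl z (components B b q y)" for x y
  proof -
    have "T q x = T q y"
      using arg_cong[OF eq, of "\<lambda>k. coord_field A a k (\<iota> q)"] by (simp add: q coord_field_fd_incl)
    then show ?thesis
      using inj_T[of q] by (simp add: inj_eq)
  qed
  show ?thesis
  proof (rule injI)
    fix k l
    assume eq: "fd incl z k = fd incl z l"
    obtain x where x: "k = components B b q x"
      by (rule components_surj[OF q(2-)])
    obtain x' where x': "l = components B b q x'"
      by (rule components_surj[OF q(2-)])
    show "k = l"
      using * eq unfolding x x' by blast
  qed
qed

lemma smooth_field_in_chart_b:
  "smooth_field B W X \<Longrightarrow> S \<subseteq> snd b ` (fst b \<inter> W) \<Longrightarrow> smooth_on (field_in_chart B b X) S"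
  using b unfolding smooth_field_def by (blast intro: smooth_on_subset)

text \<open>Meant for \<open>U\<close> and \<open>V\<close>. Tangency places the field in the range
  of the injective differential of \<open>incl\<close>, so \<open>smooth_lift\<close> applies; being
  annihilated by \<open>G\<close> and \<open>H\<close>, the field lifts into both kernels by
  skewness.\<close>

lemma adapted_lift:
  assumes y: "y \<in> chart_dom" and X: "smooth_field A (\<U> i) X"
    and vals: "\<And>p. p \<in> \<U> i \<Longrightarrow> u i p (X p) = c" "\<And>p. p \<in> \<U> i \<Longrightarrow> v i p (X p) = d"
    and kernel: "\<And>p. p \<in> \<U> i \<Longrightarrow> G i p (X p) = 0" "\<And>p. p \<in> \<U> i \<Longrightarrow> H i p (X p) = 0"
    and tangent: "\<And>q. \<iota> q \<in> \<U> i \<Longrightarrow> X (\<iota> q) \<in> range (T q)"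
  obtains S E where "open S" "y \<in> S" "S \<subseteq> chart_dom" "adapted S E c d"
    "\<And>z. z \<in> S \<Longrightarrow> fd incl z (E z) = field_in_chart A a X (incl z)"
proof -
  have field: "field_in_chart A a X (incl (snd b q)) = fd incl (snd b q) (components B b q x)"
    if "q \<in> fst b" "\<iota> q \<in> fst a" "\<iota> q \<in> \<U> i" "X (\<iota> q) = T q x" for q x
    using a that by (simp add: incl_eq field_in_chart_at fd_incl_components)
  have "smooth_on (field_in_chart A a X) (snd a ` (fst a \<inter> \<U> i))"
    using X a by (simp add: smooth_field_def)
  moreover have "incl ` chart_dom \<subseteq> snd a ` (fst a \<inter> \<U> i)"
    by (auto elim!: chart_dom_cases simp: incl_eq)
  moreover have "open (snd a ` (fst a \<inter> \<U> i))"
    using a by (intro open_image open_neighborhood)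
  ultimately have "smooth_on (\<lambda>z. field_in_chart A a X (incl z)) chart_dom"
    by (intro smooth_on_compose[OF open_chart_dom _ _ smooth_incl])
  moreover have "field_in_chart A a X (incl z) \<in> range (fd incl z)" if "z \<in> chart_dom" for z
    using that
  proof (rule chart_dom_cases)
    fix q assume q: "z = snd b q" "q \<in> fst b" "\<iota> q \<in> fst a" "\<iota> q \<in> \<U> i"
    obtain x where "X (\<iota> q) = T q x"
      using tangent[OF q(4)] by auto
    from field[OF q(2-) this] show ?thesis
      by (simp add: q(1))
  qed
  moreover have "fd incl z (\<i> *s k) = \<i> *s fd incl z k" if "z \<in> chart_dom" for z k
    using that by (rule chart_dom_cases) (simp add: incl_def inclusion_complex[OF a b])
  ultimately obtain S E where S: "open S" "y \<in> S" "S \<subseteq> chart_dom" and E: "smooth_on E S"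
    "\<And>z. z \<in> S \<Longrightarrow> fd incl z (E z) = field_in_chart A a X (incl z)"
    using smooth_lift[OF open_chart_dom y smooth_incl _ inj_fd_incl, of "\<lambda>z. field_in_chart A a X (incl z)"] by metis
  have "adapted S E c d"
    unfolding adapted_def
  proof (intro conjI ballI E(1))
    fix z assume z: "z \<in> S"
    then have "z \<in> chart_dom"
      using S(3) by auto
    then obtain q where q: "z = snd b q" "q \<in> fst b" "\<iota> q \<in> fst a" "\<iota> q \<in> \<U> i"
      by (rule chart_dom_cases)
    obtain x where x: "X (\<iota> q) = T q x"
      using tangent[OF q(4)] by auto
    have "fd incl z (E z) = fd incl z (components B b q x)"
      using E(2)[OF z] field[OF q(2-) x] by (simp add: q(1))
    then have Ez: "E z = components B b q x"
      using inj_fd_incl[OF \<open>z \<in> chart_dom\<close>] by (simp add: inj_eq)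
    show "\<alpha> z (E z) = c" "\<beta> z (E z) = d"
      unfolding Ez unfolding q(1) \<alpha>_components[OF q(2-)] \<beta>_components[OF q(2-)] x[symmetric]
      by (rule vals[OF q(4)])+
    show "\<forall>l. \<Phi> z (E z) l = 0 \<and> \<Psi> z (E z) l = 0"
    proof
      fix l
      obtain k where "l = components B b q k"
        by (rule components_surj[OF q(2-)])
      then show "\<Phi> z (E z) l = 0 \<and> \<Psi> z (E z) l = 0"
        unfolding Ez unfolding q(1)
        by (simp add: \<Phi>_components[OF q(2-)] \<Psi>_components[OF q(2-)] x[symmetric] G_skew[OF q(4)]
            H_skew[OF q(4)] kernel[OF q(4)] g_simps)
    qed
  qed
  then show thesis
    using that S E(2) by blast
qed

text \<open>The vertical coefficients are \<open>\<alpha>\<close> and \<open>\<beta>\<close> of the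
  field, hence smooth. Subtracting the vertical part leaves a field that is smooth by construction
  and pointwise the \<open>Dperp\<close>-component.\<close>

lemma section_decomposition:
  assumes S: "open S" "S \<subseteq> chart_dom" and E: "adapted S E 1 0"
    "\<And>z. z \<in> S \<Longrightarrow> fd incl z (E z) = field_in_chart A a (U i) (incl z)"
    and F: "adapted S F 0 1" "\<And>z. z \<in> S \<Longrightarrow> fd incl z (F z) = field_in_chart A a (V i) (incl z)"
    and X: "smooth_field B W X" "S \<subseteq> snd b ` (fst b \<inter> W)"
    "\<And>q. q \<in> W \<Longrightarrow> X q \<in> sum_distribution Dperp (structure_span A \<U> U V B \<iota>) q"
  obtains h k Y where "smooth_on h S" "smooth_on k S" "adapted S Y 0 0"
    "\<And>z. z \<in> S \<Longrightarrow> field_in_chart B b X z = Y z + h z *\<^sub>R E z + k z *\<^sub>R F z"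
proof -
  define K where "K = field_in_chart B b X"
  define h where "h = (\<lambda>z. \<alpha> z (K z))"
  define k where "k = (\<lambda>z. \<beta> z (K z))"
  define Y where "Y = (\<lambda>z. K z - (h z *\<^sub>R E z + k z *\<^sub>R F z))"
  have K: "smooth_on K S"
    unfolding K_def by (rule smooth_field_in_chart_b[OF X(1,2)])
  have chart_dom: "z \<in> chart_dom" if "z \<in> S" for z
    using S(2) that by auto
  have h: "smooth_on h S" and k: "smooth_on k S"
    unfolding h_def k_def
    using smooth_on_linear_family[where T=\<alpha>, OF S(1) linear_\<alpha>[OF chart_dom] smooth_on_subset[OF smooth_\<alpha> S(2)] K]
      smooth_on_linear_family[where T=\<beta>, OF S(1) linear_\<beta>[OF chart_dom] smooth_on_subset[OF smooth_\<beta> S(2)] K]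
    by auto
  have Y: "smooth_on Y S"
    unfolding Y_def using E(1) F(1) K h k S(1)
    by (intro smooth_on_diff smooth_on_add bounded_bilinear.smooth_on_bilinear[OF bounded_bilinear_scaleR])
      (auto simp: adapted_def)
  have pointwise: "\<exists>q y. z = snd b q \<and> q \<in> fst b \<and> \<iota> q \<in> fst a \<and> \<iota> q \<in> \<U> i \<and> y \<in> Dperp q \<and> Y z = components B b q y"
    if z: "z \<in> S" for z
  proof -
    obtain q where q: "z = snd b q" "q \<in> fst b" "\<iota> q \<in> fst a" "\<iota> q \<in> \<U> i"
      using chart_dom[OF z] by (rule chart_dom_cases)
    obtain q' where "z = snd b q'" "q' \<in> fst b" "q' \<in> W"
      using X(2) z by blast
    then have "q \<in> W"
      using M.inv_left[OF b] q(1,2) by metis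
    then have "X q \<in> sum_distribution Dperp (structure_span A \<U> U V B \<iota>) q"
      by (rule X(3))
    then obtain y w where yw: "X q = y + w" "y \<in> Dperp q" "w \<in> structure_span A \<U> U V B \<iota> q"
      unfolding sum_distribution_def by blast
    have lin: "linear (components B b q)"
      by (rule M.linear_components[OF b q(2)])
    have Kz: "K z = components B b q y + components B b q w"
      unfolding K_def q(1) M.field_in_chart_at[OF b q(2)] yw(1) by (rule linear_add[OF lin])
    let ?a = "u i (\<iota> q) (T q w)" and ?b = "v i (\<iota> q) (T q w)"
    have hk: "h z = ?a" "k z = ?b"
      unfolding h_def k_def Kz linear_add[OF linear_\<alpha>[OF chart_dom[OF z]]] linear_add[OF linear_\<beta>[OF chart_dom[OF z]]]
      unfolding q(1) \<alpha>_components[OF q(2-)] \<beta>_components[OF q(2-)]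
      by (simp_all add: u_Dperp[OF q(4) yw(2)] v_Dperp[OF q(4) yw(2)])
    \<comment> \<open>The vertical part \<open>w\<close> is expressed through \<open>U\<close> and
      \<open>V\<close> upstairs; injectivity of the differential then gives the same expression
      through \<open>E\<close> and \<open>F\<close>.\<close>
    have "fd incl z (components B b q w) = components A a (\<iota> q) (?a *\<^sub>R U i (\<iota> q) + ?b *\<^sub>R V i (\<iota> q))"
      unfolding q(1) fd_incl_components[OF q(2-)] using structure_spanD[OF yw(3) q(4)] by simp
    also have "\<dots> = ?a *\<^sub>R fd incl z (E z) + ?b *\<^sub>R fd incl z (F z)"
      unfolding E(2)[OF z] F(2)[OF z] unfolding q(1) incl_eq[OF q(2-)] field_in_chart_at[OF a q(3)]
      by (simp add: linear_add[OF linear_components[OF a q(3)]] linear_scale[OF linear_components[OF a q(3)]])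
    also have "\<dots> = fd incl z (?a *\<^sub>R E z + ?b *\<^sub>R F z)"
      by (simp add: linear_add[OF linear_fd_incl[OF chart_dom[OF z]]] linear_scale[OF linear_fd_incl[OF chart_dom[OF z]]])
    finally have "components B b q w = ?a *\<^sub>R E z + ?b *\<^sub>R F z"
      using inj_fd_incl[OF chart_dom[OF z]] by (simp add: inj_eq)
    then have "Y z = components B b q y"
      by (simp add: Y_def Kz hk)
    then show ?thesis
      using q yw(2) by blast
  qed
  have *: "\<alpha> z (Y z) = 0 \<and> \<beta> z (Y z) = 0 \<and> \<Phi> z (Y z) l = 0 \<and> \<Psi> z (Y z) l = 0" if z: "z \<in> S" for z l
  proof -
    obtain q y where q: "z = snd b q" "q \<in> fst b" "\<iota> q \<in> fst a" "\<iota> q \<in> \<U> i" and y: "y \<in> Dperp q" "Y z = components B b q y"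
      using pointwise[OF z] by blast
    obtain x where "l = components B b q x"
      by (rule components_surj[OF q(2-)])
    then show ?thesis
      using y(1) q unfolding y(2)
      by (simp add: \<alpha>_components \<beta>_components \<Phi>_components \<Psi>_components u_Dperp v_Dperp G_Dperp H_Dperp)
  qed
  have "adapted S Y 0 0"
    using Y * by (simp add: adapted_def)
  then show thesis
    using that[OF h k] by (simp add: Y_def K_def)
qed

end

context semi_invariant
begin

section \<open>The involutivity argument\<close>

text \<open>The coefficients of \<open>x\<close> in a local frame are kept constant. This supplies
  the section of \<open>D\<close> in the Jacobi argument with a prescribed value at
  \<open>p\<close>.\<close>

lemma D_local_section:
  assumes "x \<in> D p"
  obtains W Z where "open W" "p \<in> W" "smooth_field B W Z" "\<And>q. q \<in> W \<Longrightarrow> Z q \<in> D q" "Z p = x"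
proof -
  obtain W and r :: nat and E where W: "open W" "p \<in> W" "\<And>i. i < r \<Longrightarrow> smooth_field B W (E i)"
    "\<And>q. q \<in> W \<Longrightarrow> inj_on (\<lambda>i. E i q) {..<r}" "\<And>q. q \<in> W \<Longrightarrow> D q = span ((\<lambda>i. E i q) ` {..<r})"
    using smooth_D unfolding smooth_distribution_def by metis
  obtain c where "x = (\<Sum>k\<in>(\<lambda>i. E i p) ` {..<r}. c k *\<^sub>R k)"
    using assms W(5)[OF W(2)] span_finite[of "(\<lambda>i. E i p) ` {..<r}"] by auto
  then have x: "x = (\<Sum>j<r. c (E j p) *\<^sub>R E j p)"
    by (simp add: sum.reindex[OF W(4)[OF W(2)]])
  define Z where "Z = (\<lambda>q. \<Sum>j<r. c (E j p) *\<^sub>R E j q)"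
  have "smooth_field B W Z"
    unfolding smooth_field_def
  proof
    fix b assume b: "b \<in> B"
    have o: "open (snd b ` (fst b \<inter> W))"
      using b W(1) by (rule M.open_image)
    have "smooth_on (\<lambda>z. \<Sum>j<r. c (E j p) *\<^sub>R field_in_chart B b (E j) z) (snd b ` (fst b \<inter> W))"
      using W(3) b by (intro smooth_on_sum o bounded_linear.smooth_on_linear[OF bounded_linear_scaleR_right])
        (auto simp: smooth_field_def)
    moreover have "field_in_chart B b Z z = (\<Sum>j<r. c (E j p) *\<^sub>R field_in_chart B b (E j) z)"
      if z: "z \<in> snd b ` (fst b \<inter> W)" for z
    proof -
      have "linear (components B b (chart_inv b z))"
        using z b by (auto simp: M.inv_left intro: M.linear_components)
      then show ?thesis
        by (simp add: field_in_chart_def Z_def linear_sum linear_scale)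
    qed
    ultimately show "smooth_on (field_in_chart B b Z) (snd b ` (fst b \<inter> W))"
      using smooth_on_cong[OF o, of "field_in_chart B b Z"] by simp
  qed
  moreover have "Z q \<in> D q" if "q \<in> W" for q
    unfolding Z_def W(5)[OF that] by (intro span_sum span_scale span_base) auto
  ultimately show thesis
    using that W(1,2) x Z_def by blast
qed

lemma involutive_Dperp_span: "involutive B (sum_distribution Dperp (structure_span A \<U> U V B \<iota>))"
  unfolding involutive_def
proof (intro allI impI ballI, elim conjE)
  fix W X Y p
  assume W: "open W" "p \<in> W" and X: "smooth_field B W X" and Y: "smooth_field B W Y"
    and XY: "\<forall>p\<in>W. X p \<in> sum_distribution Dperp (structure_span A \<U> U V B \<iota>) p \<and>
      Y p \<in> sum_distribution Dperp (structure_span A \<U> U V B \<iota>) p"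
  obtain i where i: "\<iota> p \<in> \<U> i"
    using cover by blast
  \<comment> \<open>In the chosen charts components at \<open>p\<close> and \<open>\<iota> p\<close>
    are the tangent vectors themselves, so the differential of \<open>C.incl\<close> at
    \<open>y\<close> is \<open>T p\<close>.\<close>
  define a where "a = chart_at A (\<iota> p)"
  define b where "b = chart_at B p"
  have a: "a \<in> A" "\<iota> p \<in> fst a" and b: "b \<in> B" "p \<in> fst b"
    by (simp_all add: a_def b_def chart_at M.chart_at)
  interpret C: semi_invariant_charts A m \<U> \<omega> g u v U V G H conn \<sigma> B \<iota> D Dperp a b i
    by unfold_locales (rule a(1), rule b(1))
  define y where "y = snd b p"
  have y: "y \<in> C.chart_dom"
    unfolding y_def by (rule C.in_chart_dom[OF b(2) a(2) i])
  have comp: "components B b p k = k" for k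
    unfolding b_def by (rule M.components_chart_at)
  have fd_y: "fd C.incl y k = T p k" for k
    using C.fd_incl_components[OF b(2) a(2) i, of k] components_chart_at[of "\<iota> p" "T p k"]
    by (simp add: comp y_def a_def)
  \<comment> \<open>\<open>E\<close> here and \<open>F\<close> below are the local lifts of
    \<open>U\<close> and \<open>V\<close> to the chart of the submanifold.\<close>
  obtain S1 E where S1: "open S1" "y \<in> S1" "S1 \<subseteq> C.chart_dom" and E: "C.adapted S1 E 1 0"
    "\<And>z. z \<in> S1 \<Longrightarrow> fd C.incl z (E z) = field_in_chart A a (U i) (C.incl z)"
    by (rule C.adapted_lift[OF y smooth_U[of i], where c=1 and d=0])
      (auto simp: u_U v_U G_U H_U U_tangent)
  obtain S2 F where S2: "open S2" "y \<in> S2" "S2 \<subseteq> C.chart_dom" and F: "C.adapted S2 F 0 1"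
    "\<And>z. z \<in> S2 \<Longrightarrow> fd C.incl z (F z) = field_in_chart A a (V i) (C.incl z)"
    by (rule C.adapted_lift[OF y smooth_V[of i], where c=0 and d=1])
      (auto simp: u_V v_V G_V H_V V_tangent)
  define S where "S = S1 \<inter> S2 \<inter> snd b ` (fst b \<inter> W)"
  have S: "open S" "y \<in> S" "S \<subseteq> C.chart_dom" "S \<subseteq> snd b ` (fst b \<inter> W)"
    using S1 S2 W b by (auto simp: S_def y_def intro: M.open_image)
  have adapted_subset: "C.adapted S' K c d" if "C.adapted S0 K c d" "S' \<subseteq> S0" for S0 S' K c d
    using that smooth_on_subset unfolding C.adapted_def by blast
  have E': "C.adapted S E 1 0" and F': "C.adapted S F 0 1"
    by (rule adapted_subset[OF E(1)], simp add: S_def le_infI1) (rule adapted_subset[OF F(1)], simp add: S_def le_infI1)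
  have E_rel: "fd C.incl z (E z) = field_in_chart A a (U i) (C.incl z)"
    and F_rel: "fd C.incl z (F z) = field_in_chart A a (V i) (C.incl z)" if "z \<in> S" for z
    using that E(2) F(2) by (auto simp: S_def)
  obtain h1 k1 X' where X': "smooth_on h1 S" "smooth_on k1 S" "C.adapted S X' 0 0"
    "\<And>z. z \<in> S \<Longrightarrow> field_in_chart B b X z = X' z + h1 z *\<^sub>R E z + k1 z *\<^sub>R F z"
    using C.section_decomposition[OF S(1,3) E' E_rel F' F_rel X S(4)] XY by blast
  obtain h2 k2 Y' where Y': "smooth_on h2 S" "smooth_on k2 S" "C.adapted S Y' 0 0"
    "\<And>z. z \<in> S \<Longrightarrow> field_in_chart B b Y z = Y' z + h2 z *\<^sub>R E z + k2 z *\<^sub>R F z"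
    using C.section_decomposition[OF S(1,3) E' E_rel F' F_rel Y S(4)] XY by blast

  \<comment> \<open>The tangent vectors orthogonal to \<open>D p\<close>. By
    \<open>orthogonal_D_imp\<close> it suffices that the bracket lies in this subspace.\<close>
  define N where "N = {k. \<forall>x\<in>D p. g (\<iota> p) (T p k) (T p x) = 0}"
  have N: "subspace N"
    by (rule subspaceI) (simp_all add: N_def linear_0[OF linear_T] linear_add[OF linear_T]
        linear_scale[OF linear_T] g_simps)
  have Ey: "T p (E y) = U i (\<iota> p)" and Fy: "T p (F y) = V i (\<iota> p)"
    using E_rel[OF S(2)] F_rel[OF S(2)] C.incl_eq[OF b(2) a(2) i] a field_in_chart_at
      components_chart_at[of "\<iota> p"] by (simp_all add: fd_y[symmetric] y_def a_def)
  have EF_N: "E y \<in> N" "F y \<in> N"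
    by (simp_all add: N_def Ey Fy u_dual[OF i, symmetric] v_dual[OF i, symmetric] u_D[OF i] v_D[OF i])
  \<comment> \<open>If \<open>\<beta>\<close> vanishes on both fields, the bracket is orthogonal to
    \<open>G D\<close>; if \<open>\<alpha>\<close> does, to \<open>H D\<close>. Either image is all
    of \<open>D\<close>.\<close>
  have bracket_N: "vbracket K L y \<in> N"
    if "C.adapted S K c 0 \<and> C.adapted S L c' 0 \<or> C.adapted S K 0 d \<and> C.adapted S L 0 d'" for K L c c' d d'
    unfolding N_def
  proof (safe)
    let ?w = "vbracket K L y"
    have orth: "(C.adapted S K c 0 \<and> C.adapted S L c' 0 \<longrightarrow> g (\<iota> p) (T p ?w) (G i (\<iota> p) (T p x)) = 0) \<and>
      (C.adapted S K 0 d \<and> C.adapted S L 0 d' \<longrightarrow> g (\<iota> p) (T p ?w) (H i (\<iota> p) (T p x)) = 0)"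
      if x: "x \<in> D p" for x
    proof -
      obtain W' Z where Z: "open W'" "p \<in> W'" "smooth_field B W' Z" "\<And>q. q \<in> W' \<Longrightarrow> Z q \<in> D q" "Z p = x"
        using D_local_section[OF x] by blast
      define R where "R = S \<inter> snd b ` (fst b \<inter> W')"
      have R: "open R" "R \<subseteq> C.chart_dom" "y \<in> R" "R \<subseteq> S"
        using S Z(1,2) b by (auto simp: R_def y_def intro: M.open_image)
      have smooth_Z: "smooth_on (field_in_chart B b Z) R"
        by (rule C.smooth_field_in_chart_b[OF Z(3)]) (simp add: R_def)
      have zero: "C.\<alpha> z (field_in_chart B b Z z) = 0 \<and> C.\<beta> z (field_in_chart B b Z z) = 0" if z: "z \<in> R" for z
      proof -
        obtain q where q: "z = snd b q" "q \<in> fst b" "\<iota> q \<in> fst a" "\<iota> q \<in> \<U> i"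
          using z R(2) by (auto elim: C.chart_dom_cases)
        obtain q' where "z = snd b q'" "q' \<in> fst b" "q' \<in> W'"
          using z by (auto simp: R_def)
        then have "Z q \<in> D q"
          using q M.inv_left[OF b(1)] Z(4) by metis
        then show ?thesis
          using q b(1) by (simp add: M.field_in_chart_at C.\<alpha>_components C.\<beta>_components u_D v_D)
      qed
      have Zy: "field_in_chart B b Z y = x"
        using b by (simp add: y_def M.field_in_chart_at comp Z(5))
      have \<Phi>\<Psi>: "C.\<Phi> y ?w x = g (\<iota> p) (T p ?w) (G i (\<iota> p) (T p x))"
        "C.\<Psi> y ?w x = g (\<iota> p) (T p ?w) (H i (\<iota> p) (T p x))"
        using C.\<Phi>_components[OF b(2) a(2) i, of ?w x] C.\<Psi>_components[OF b(2) a(2) i, of ?w x]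
        unfolding comp y_def[symmetric] by blast+
      note br = C.adapted_bracket[OF R(1-3) smooth_Z zero, of K _ L, unfolded Zy]
      show ?thesis
        using br \<Phi>\<Psi> adapted_subset[OF _ R(4)] by metis
    qed
    fix x assume x: "x \<in> D p"
    then have "T p x \<in> G i (\<iota> p) ` T p ` D p" "T p x \<in> H i (\<iota> p) ` T p ` D p"
      using D_image[OF i] by auto
    then obtain x1 x2 where "x1 \<in> D p" "T p x = G i (\<iota> p) (T p x1)" "x2 \<in> D p" "T p x = H i (\<iota> p) (T p x2)"
      by blast
    then show "g (\<iota> p) (T p ?w) (T p x) = 0"
      using that orth[of x1] orth[of x2] by metis
  qed
  have diff: "K differentiable (at y)" if "C.adapted S K c d" for K c d
    using that S(2) smooth_on_differentiable unfolding C.adapted_def by blast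
  \<comment> \<open>Neither form vanishes on both \<open>E\<close> and \<open>F\<close>, so
    \<open>bracket_N\<close> does not cover this pair. Relatedness sends the bracket to
    \<open>[U, V]\<close>, which is orthogonal to horizontal vectors and hence to
    \<open>D\<close>.\<close>
  have EF: "vbracket E F y \<in> N"
  proof -
    have fy: "C.incl y = snd a (\<iota> p)"
      unfolding y_def by (rule C.incl_eq[OF b(2) a(2) i])
    have "snd a (\<iota> p) \<in> snd a ` (fst a \<inter> \<U> i)"
      using a(2) i by simp
    then have "field_in_chart A a (U i) differentiable (at (C.incl y))" "field_in_chart A a (V i) differentiable (at (C.incl y))"
      using smooth_U[of i] smooth_V[of i] a(1) unfolding smooth_field_def fy
      by (blast intro: smooth_on_differentiable)+
    then have "T p (vbracket E F y) = lie_bracket A (U i) (V i) (\<iota> p)"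
      unfolding fd_y[symmetric] lie_bracket_eq a_def[symmetric] fy[symmetric]
      by (rule vbracket_related[OF S(1,2) smooth_on_subset[OF C.smooth_incl S(3)] diff[OF E'] diff[OF F'] _ _ E_rel F_rel])
    then show ?thesis
      using lie_bracket_U_V_orthogonal[OF i] u_D[OF i] v_D[OF i] by (simp add: N_def)
  qed
  have swap: "vbracket L K y \<in> N" if "vbracket K L y \<in> N" for K L
    using subspace_neg[OF N that] by (simp add: vbracket_swap[of L K])
  have self: "vbracket K K y \<in> N" for K
    using subspace_0[OF N] by (simp add: vbracket_def)
  note diffs = diff[OF E'] diff[OF F'] diff[OF X'(3)] diff[OF Y'(3)]
    smooth_on_differentiable[OF X'(1) S(2)] smooth_on_differentiable[OF X'(2) S(2)]
    smooth_on_differentiable[OF Y'(1) S(2)] smooth_on_differentiable[OF Y'(2) S(2)]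
  define Y'' where "Y'' = (\<lambda>z. Y' z + h2 z *\<^sub>R E z + k2 z *\<^sub>R F z)"
  have "Y'' differentiable (at y)"
    unfolding Y''_def using diffs by (intro differentiable_add differentiable_scaleR)
  \<comment> \<open>The Leibniz rule for left arguments handles the right one after a swap.\<close>
  have Y''_N: "vbracket K Y'' y \<in> N"
    if "vbracket Y' K y \<in> N" "vbracket E K y \<in> N" "vbracket F K y \<in> N" "K differentiable (at y)" for K
    unfolding Y''_def
    by (rule swap, rule vbracket_combination_in_subspace[OF N that(1-3) EF_N])
      (use diffs that(4) in auto)
  \<comment> \<open>Each of \<open>X'\<close>, \<open>E\<close>, \<open>F\<close> is bracketed with
    each of \<open>Y'\<close>, \<open>E\<close>, \<open>F\<close>. Pairs of \<open>F\<close> with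
    \<open>X'\<close> or \<open>Y'\<close> use the second alternative of \<open>bracket_N\<close>,
    the other pairs containing \<open>X'\<close> or \<open>Y'\<close> the first;
    \<open>[E, E]\<close> and \<open>[F, F]\<close> vanish.\<close>
  have "vbracket X' Y'' y \<in> N" "vbracket E Y'' y \<in> N" "vbracket F Y'' y \<in> N"
    using bracket_N[of Y' 0 X' 0] bracket_N[of E 1 X' 0] bracket_N[of F _ X' _ 1 0]
      bracket_N[of Y' 0 E 1] bracket_N[of Y' _ F _ 0 1] E' F' X'(3) Y'(3) diffs EF swap[OF EF] self
    by (auto intro!: Y''_N)
  then have "vbracket (\<lambda>z. X' z + h1 z *\<^sub>R E z + k1 z *\<^sub>R F z) Y'' y \<in> N"
    using diffs \<open>Y'' differentiable (at y)\<close> by (intro vbracket_combination_in_subspace N EF_N)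
  moreover have "lie_bracket B X Y p = vbracket (\<lambda>z. X' z + h1 z *\<^sub>R E z + k1 z *\<^sub>R F z) Y'' y"
    unfolding M.lie_bracket_eq b_def[symmetric] y_def[symmetric] Y''_def
    by (rule vbracket_cong_open[OF S(1,2) X'(4) Y'(4)])
  ultimately have "lie_bracket B X Y p \<in> N"
    by simp
  then show "lie_bracket B X Y p \<in> sum_distribution Dperp (structure_span A \<U> U V B \<iota>) p"
    by (intro orthogonal_D_imp) (simp add: N_def)
qed

end

theorem theorem5p4:
  fixes A :: "('m::{second_countable_topology,t2_space}, 'n::finite) chart set"
    and m :: nat
    and \<U> :: "'i \<Rightarrow> 'm set"
    and \<omega> :: "'i \<Rightarrow> 'm \<Rightarrow> complex^'n \<Rightarrow> complex"
    and g :: "'m \<Rightarrow> complex^'n \<Rightarrow> complex^'n \<Rightarrow> real"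
    and u v :: "'i \<Rightarrow> 'm \<Rightarrow> complex^'n \<Rightarrow> real"
    and U V :: "'i \<Rightarrow> 'm \<Rightarrow> complex^'n"
    and G H :: "'i \<Rightarrow> 'm \<Rightarrow> complex^'n \<Rightarrow> complex^'n"
    and conn :: "('m \<Rightarrow> complex^'n) \<Rightarrow> ('m \<Rightarrow> complex^'n) \<Rightarrow> 'm \<Rightarrow> complex^'n"
    and \<sigma> :: "'i \<Rightarrow> ('m \<Rightarrow> complex^'n) \<Rightarrow> 'm \<Rightarrow> real"
    and B :: "('s::{second_countable_topology,t2_space}, 'k::finite) chart set"
    and \<iota> :: "'s \<Rightarrow> 'm"
    and D Dperp :: "'s \<Rightarrow> (complex^'k) set"
  assumes "normal_complex_contact_metric_manifold A m \<U> \<omega> g u v U V G H conn \<sigma>"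
    and "semi_invariant_submanifold A \<U> g U V G H B \<iota> D Dperp"
  shows "involutive B (sum_distribution Dperp (structure_span A \<U> U V B \<iota>))"
proof -
  interpret normal_complex_contact_metric_manifold A m \<U> \<omega> g u v U V G H conn \<sigma>
    by (rule assms(1))
  interpret semi_invariant A m \<U> \<omega> g u v U V G H conn \<sigma> B \<iota> D Dperp
    by unfold_locales (rule assms(2))
  show ?thesis
    by (rule involutive_Dperp_span)
qed

end
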